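(* Let $0<h<\epsilon<1$. Let $\{\hat u_i(t)\}_{i,\,x_i\in D}$ be the solution of the semi-discrete initial boundary value problem $$\ddot{\hat u}_i(t)=\mathcal{L}^\epsilon(\hat u(t))(x_i)+b(t,x_i),\qquad t\in[0,T],\ x_i\in D,$$ with $\hat u_i(t)=0$ for all $t$ and all $x_i\notin D$, and $\hat u_i(0)=u_0(x_i)$, $\dot{\hat u}_i(0)=v_0(x_i)$, where $\hat u(t)$ denotes the piecewise constant extension of $\{\hat u_i(t)\}$. Let $\hat b(t)$ denote the piecewise constant extension of $\{b(t,x_i)\}_{i,\,x_i\in D}$. (1) If $f$ and $g$ are convex-concave potential functions with $C^f_i<\infty$ and $C^g_i<\infty$ for $i=0,1,2,3$, then the total energy satisfies $$\mathcal{E}^\epsilon(\hat u)(t)\le\left(\sqrt{\mathcal{E}^\epsilon(\hat u)(0)}+\frac{tC}{\epsilon^2}+\int_0^t\|\hat b(s)\|_{L^2}\,ds\right)^2\qquad\text{for all }t\in[0,T],$$ where the constant $C$ is independent of $\epsilon$ and $h$. (2) If $f$ is a convex-concave potential function with $C^f_i<\infty$ for $i=0,1,2,3$ and $g$ is quadratic, then the augmented energy satisfies $$\bar{\mathcal{E}}^\epsilon(\hat u)(t)\le\exp\!\left[3\left(\tfrac{C_2}{\epsilon^2}+1\right)t\right]\left(\bar{\mathcal{E}}^\epsilon(\hat u)(0)+\int_0^T\left(\tfrac{C_1^2}{\epsilon^4}+\|\hat b(s)\|_{L^2}^2\right)\exp\!\left[-3\left(\tfrac{C_2}{\epsilon^2}+1\right)s\right]ds\right)$$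 for all $t\in[0,T]$, where the constants $C_1$ and $C_2$ are independent of $\epsilon$ and $h$.
   Context: Setting. $d\in\{2,3\}$, $D\subset\mathbb{R}^d$ is the (bounded) material domain with volume $|D|$, $\epsilon$ is the horizon, $H_r(x)$ is the open ball of radius $r$ centered at $x$, and $\omega_d$ is the volume of the unit ball in $\mathbb{R}^d$. The density is normalized to $1$. The influence function $J:[0,\infty)\to[0,\infty)$ satisfies $J(r)=0$ for $r\ge1$ and $0\le J(r)\le M<\infty$ for $r<1$; $J^\epsilon(r)=J(r/\epsilon)$. For $\gamma\in(0,1]$, $C^{0,\gamma}_0(D)=C^{0,\gamma}(D)\cap C_0(D)$, where $C_0(D)$ is the sup-norm closure of the continuous functions with compact support in $D$. The boundary function $\omega\in C^{0,\gamma}_0(D;[0,1])$ equals $1$ at points of $D$ at distance at least $\epsilon$ from $\partial D$, decays to $0$ on $\partial D$, and is extended by zero outside $D$. $u_0,v_0$ are the initial displacement and velocity and $b$ is the body force. $\|\cdot\|_{L^2}$ is the norm of $L^2(D;\mathbb{R}^d)$. Potentials. $f:\mathbb{R}\to\mathbb{R}$ is convex-concave: $f(0)=f'(0)=0$, there are inflection points $r^-<0<r^+$ with $f$ convex on $[r^-,r^+]$ and concave on $(-\infty,r^-]$ and on $[r^+,\infty)$, and $f$ has finite limits at $\pm\infty$. $C^f_0=\sup_r|f(r)|$, $C^f_i=\sup_r|f^{(i)}(r)|$ for $i=1,2,3$. The function $g:\mathbb{R}\to\mathbb{R}$ is either quadratic with a minimum at zero, $g(r)=\beta r^2/2$, or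 convex-concave of the same shape, with a well at zero ($g(0)=g'(0)=0$) and inflection points $r^-_*<0<r^+_*$; in the latter case $C^g_0=\sup_r|g(r)|$, $C^g_i=\sup_r|g^{(i)}(r)|$ for $i=1,2,3$. Peridynamic force. For a displacement $u$ (zero outside $D$), with $e_\xi=\xi/|\xi|$, the hydrostatic strain is $$\theta(x;u)=\frac{1}{\omega_d}\int_{H_1(0)}\omega(x+\epsilon\xi)J(|\xi|)\,(u(x+\epsilon\xi)-u(x))\cdot e_\xi\,d\xi,$$ and $\mathcal{L}^\epsilon=\mathcal{L}^\epsilon_T+\mathcal{L}^\epsilon_D$ with $$\mathcal{L}^\epsilon_T(u)(x)=\frac{2}{\epsilon\omega_d}\int_{H_1(0)}\omega(x)\omega(x+\epsilon\xi)\frac{J(|\xi|)}{\sqrt{\epsilon|\xi|}}\,f'\!\left(\frac{(u(x+\epsilon\xi)-u(x))\cdot e_\xi}{\sqrt{\epsilon|\xi|}}\right)e_\xi\,d\xi,$$ $$\mathcal{L}^\epsilon_D(u)(x)=\frac{1}{\epsilon^2\omega_d}\int_{H_1(0)}\omega(x)\omega(x+\epsilon\xi)J(|\xi|)\left[g'(\theta(x+\epsilon\xi;u))+g'(\theta(x;u))\right]e_\xi\,d\xi.$$ Energies. With the tensile strain $S(y,x,u)=\frac{u(y)-u(x)}{|y-x|}\cdot\frac{y-x}{|y-x|}$, the potential energy is $$PD^\epsilon(u)=\frac{1}{\epsilon^d\omega_d}\int_D\int_{H_\epsilon(x)}|y-x|\,\mathcal{W}^\epsilon(S(y,x,u))\,dy\,dx+\int_D\omega(x)\frac{g(\theta(x;u))}{\epsilon^2}\,dx,$$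 where $\mathcal{W}^\epsilon(S(y,x,u))=\omega(x)\omega(y)J^\epsilon(|y-x|)\frac{1}{\epsilon|y-x|}f(\sqrt{|y-x|}\,S(y,x,u))$. The total energy is $\mathcal{E}^\epsilon(u)(t)=\frac12\|\dot u(t)\|_{L^2}^2+PD^\epsilon(u(t))$, and the augmented energy is $\bar{\mathcal{E}}^\epsilon(u)(t)=\mathcal{E}^\epsilon(u)(t)+\frac12\|u(t)\|_{L^2}^2$. Discretization. $h>0$ is the mesh size, the grid points are $x_i=hi$, $i\in\mathbb{Z}^d$, and $U_i$ is the cell of volume $h^d$ corresponding to $x_i$ (the axis-parallel cube of side $h$ centered at $x_i$; the cells tile $\mathbb{R}^d$). The piecewise constant extension of a discrete set $\{\hat w_i\}_{i,\,x_i\in D}$ is $\hat w(x)=\sum_{i,\,x_i\in D}\hat w_i\,\chi_{U_i}(x)$, with value zero on cells $U_i$ with $x_i\notin D$. *)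

theory Defs
  imports "HOL-Analysis.Analysis"
begin

definition convex_concave :: "(real \<Rightarrow> real) \<Rightarrow> bool" where
  "convex_concave f \<longleftrightarrow>
     f 0 = 0 \<and> (f has_real_derivative 0) (at 0) \<and>
     (\<exists>rm rp. rm < 0 \<and> 0 < rp \<and> convex_on {rm..rp} f \<and>
        concave_on {..rm} f \<and> concave_on {rp..} f) \<and>
     (\<exists>l. (f \<longlongrightarrow> l) at_top) \<and> (\<exists>l. (f \<longlongrightarrow> l) at_bot)"

(* The suprema C_i = sup_r |f^(i)(r)|, i = 0,1,2,3, are finite; this includes the existence of
   the derivatives up to order three, since deriv is underspecified at points of
   non-differentiability. *)
definition finite_C0_to_C3 :: "(real \<Rightarrow> real) \<Rightarrow> bool" where
  "finite_C0_to_C3 f \<longleftrightarrow>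
     (\<forall>i<3. \<forall>r. ((deriv ^^ i) f) differentiable (at r)) \<and>
     (\<forall>i\<le>3. bdd_above (range (\<lambda>r. \<bar>(deriv ^^ i) f r\<bar>)))"

definition quadratic_potential :: "(real \<Rightarrow> real) \<Rightarrow> bool" where
  "quadratic_potential g \<longleftrightarrow> (\<exists>\<beta>>0. \<forall>r. g r = \<beta> * r\<^sup>2 / 2)"

(* Only the values of J on [0,\<infinity>) matter. *)
definition influence_function :: "(real \<Rightarrow> real) \<Rightarrow> bool" where
  "influence_function J \<longleftrightarrow>
     J \<in> borel_measurable (restrict_space borel {0..}) \<and>
     (\<forall>r\<ge>1. J r = 0) \<and> (\<exists>M. \<forall>r. 0 \<le> r \<and> r < 1 \<longrightarrow> 0 \<le> J r \<and> J r \<le> M)"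

definition holder_space :: "real \<Rightarrow> ('a::metric_space) set \<Rightarrow> ('a \<Rightarrow> real) \<Rightarrow> bool" where
  "holder_space \<gamma> D \<phi> \<longleftrightarrow>
     bounded (\<phi> ` D) \<and> (\<exists>L. \<forall>x\<in>D. \<forall>y\<in>D. \<bar>\<phi> x - \<phi> y\<bar> \<le> L * dist x y powr \<gamma>)"

(* Sup-norm closure of the continuous functions with compact support in D. *)
definition C0_space :: "('a::metric_space) set \<Rightarrow> ('a \<Rightarrow> real) \<Rightarrow> bool" where
  "C0_space D \<phi> \<longleftrightarrow>
     (\<forall>\<delta>>0. \<exists>\<psi>. continuous_on D \<psi> \<and>
        (\<exists>K. compact K \<and> K \<subseteq> D \<and> (\<forall>x\<in>D - K. \<psi> x = 0)) \<and>
        (\<forall>x\<in>D. \<bar>\<phi> x - \<psi> x\<bar> \<le> \<delta>))"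

definition boundary_function ::
  "real \<Rightarrow> real \<Rightarrow> ('a::euclidean_space) set \<Rightarrow> ('a \<Rightarrow> real) \<Rightarrow> bool" where
  "boundary_function \<gamma> \<epsilon> D \<omega> \<longleftrightarrow>
     holder_space \<gamma> D \<omega> \<and> C0_space D \<omega> \<and>
     (\<forall>x\<in>D. 0 \<le> \<omega> x \<and> \<omega> x \<le> 1) \<and>
     (\<forall>x\<in>D. \<epsilon> \<le> infdist x (frontier D) \<longrightarrow> \<omega> x = 1) \<and>
     (\<forall>z\<in>frontier D. (\<omega> \<longlongrightarrow> 0) (at z within D)) \<and>
     (\<forall>x. x \<notin> D \<longrightarrow> \<omega> x = 0)"

(* Below, sgn \<xi> = \<xi> / |\<xi>| is the unit vector e_\<xi>. *)

definition unit_vol :: "'n::finite itself \<Rightarrow> real" where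
  "unit_vol _ = measure lborel (ball (0::real^'n) 1)"

definition hydro_strain ::
  "real \<Rightarrow> (real \<Rightarrow> real) \<Rightarrow> (real^'n \<Rightarrow> real) \<Rightarrow> (real^'n \<Rightarrow> real^'n) \<Rightarrow> real^'n \<Rightarrow> real" where
  "hydro_strain \<epsilon> J \<omega> u x =
     1 / unit_vol TYPE('n) *
     (LBINT \<xi>:ball 0 1.
        \<omega> (x + \<epsilon> *\<^sub>R \<xi>) * J (norm \<xi>) * ((u (x + \<epsilon> *\<^sub>R \<xi>) - u x) \<bullet> sgn \<xi>))"

definition force_T ::
  "real \<Rightarrow> (real \<Rightarrow> real) \<Rightarrow> (real^'n \<Rightarrow> real) \<Rightarrow> (real \<Rightarrow> real) \<Rightarrow>
   (real^'n \<Rightarrow> real^'n) \<Rightarrow> real^'n \<Rightarrow> real^'n" where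
  "force_T \<epsilon> J \<omega> f u x =
     (2 / (\<epsilon> * unit_vol TYPE('n))) *\<^sub>R
     (LBINT \<xi>:ball 0 1.
        (\<omega> x * \<omega> (x + \<epsilon> *\<^sub>R \<xi>) * (J (norm \<xi>) / sqrt (\<epsilon> * norm \<xi>)) *
         deriv f (((u (x + \<epsilon> *\<^sub>R \<xi>) - u x) \<bullet> sgn \<xi>) / sqrt (\<epsilon> * norm \<xi>))) *\<^sub>R sgn \<xi>)"

definition force_D ::
  "real \<Rightarrow> (real \<Rightarrow> real) \<Rightarrow> (real^'n \<Rightarrow> real) \<Rightarrow> (real \<Rightarrow> real) \<Rightarrow>
   (real^'n \<Rightarrow> real^'n) \<Rightarrow> real^'n \<Rightarrow> real^'n" where
  "force_D \<epsilon> J \<omega> g u x =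
     (1 / (\<epsilon>\<^sup>2 * unit_vol TYPE('n))) *\<^sub>R
     (LBINT \<xi>:ball 0 1.
        (\<omega> x * \<omega> (x + \<epsilon> *\<^sub>R \<xi>) * J (norm \<xi>) *
         (deriv g (hydro_strain \<epsilon> J \<omega> u (x + \<epsilon> *\<^sub>R \<xi>)) + deriv g (hydro_strain \<epsilon> J \<omega> u x)))
        *\<^sub>R sgn \<xi>)"

definition force ::
  "real \<Rightarrow> (real \<Rightarrow> real) \<Rightarrow> (real^'n \<Rightarrow> real) \<Rightarrow> (real \<Rightarrow> real) \<Rightarrow> (real \<Rightarrow> real) \<Rightarrow>
   (real^'n \<Rightarrow> real^'n) \<Rightarrow> real^'n \<Rightarrow> real^'n" where
  "force \<epsilon> J \<omega> f g u x = force_T \<epsilon> J \<omega> f u x + force_D \<epsilon> J \<omega> g u x"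

definition L2_norm_on :: "(real^'n) set \<Rightarrow> (real^'n \<Rightarrow> real^'n) \<Rightarrow> real" where
  "L2_norm_on D w = sqrt (LBINT x:D. (norm (w x))\<^sup>2)"

definition tensile_strain :: "real^'n \<Rightarrow> real^'n \<Rightarrow> (real^'n \<Rightarrow> real^'n) \<Rightarrow> real" where
  "tensile_strain y x u =
     ((1 / norm (y - x)) *\<^sub>R (u y - u x)) \<bullet> ((1 / norm (y - x)) *\<^sub>R (y - x))"

definition tensile_energy_density ::
  "real \<Rightarrow> (real \<Rightarrow> real) \<Rightarrow> (real^'n \<Rightarrow> real) \<Rightarrow> (real \<Rightarrow> real) \<Rightarrow>
   (real^'n \<Rightarrow> real^'n) \<Rightarrow> real^'n \<Rightarrow> real^'n \<Rightarrow> real" where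
  "tensile_energy_density \<epsilon> J \<omega> f u y x =
     \<omega> x * \<omega> y * J (norm (y - x) / \<epsilon>) * (1 / (\<epsilon> * norm (y - x))) *
     f (sqrt (norm (y - x)) * tensile_strain y x u)"

definition potential_energy ::
  "(real^'n) set \<Rightarrow> real \<Rightarrow> (real \<Rightarrow> real) \<Rightarrow> (real^'n \<Rightarrow> real) \<Rightarrow> (real \<Rightarrow> real) \<Rightarrow> (real \<Rightarrow> real) \<Rightarrow>
   (real^'n \<Rightarrow> real^'n) \<Rightarrow> real" where
  "potential_energy D \<epsilon> J \<omega> f g u =
     1 / (\<epsilon> ^ CARD('n) * unit_vol TYPE('n)) *
       (LBINT x:D. (LBINT y:ball x \<epsilon>. norm (y - x) * tensile_energy_density \<epsilon> J \<omega> f u y x)) +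
     (LBINT x:D. \<omega> x * (g (hydro_strain \<epsilon> J \<omega> u x) / \<epsilon>\<^sup>2))"

(* The velocity of a motion on [0,T]; one-sided derivatives at the end points. *)
definition velocity :: "real \<Rightarrow> (real \<Rightarrow> real^'n \<Rightarrow> real^'n) \<Rightarrow> real \<Rightarrow> real^'n \<Rightarrow> real^'n" where
  "velocity T u t x = vector_derivative (\<lambda>s. u s x) (at t within {0..T})"

definition total_energy ::
  "(real^'n) set \<Rightarrow> real \<Rightarrow> (real \<Rightarrow> real) \<Rightarrow> (real^'n \<Rightarrow> real) \<Rightarrow> (real \<Rightarrow> real) \<Rightarrow> (real \<Rightarrow> real) \<Rightarrow>
   real \<Rightarrow> (real \<Rightarrow> real^'n \<Rightarrow> real^'n) \<Rightarrow> real \<Rightarrow> real" where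
  "total_energy D \<epsilon> J \<omega> f g T u t =
     1/2 * (L2_norm_on D (velocity T u t))\<^sup>2 + potential_energy D \<epsilon> J \<omega> f g (u t)"

definition augmented_energy ::
  "(real^'n) set \<Rightarrow> real \<Rightarrow> (real \<Rightarrow> real) \<Rightarrow> (real^'n \<Rightarrow> real) \<Rightarrow> (real \<Rightarrow> real) \<Rightarrow> (real \<Rightarrow> real) \<Rightarrow>
   real \<Rightarrow> (real \<Rightarrow> real^'n \<Rightarrow> real^'n) \<Rightarrow> real \<Rightarrow> real" where
  "augmented_energy D \<epsilon> J \<omega> f g T u t =
     total_energy D \<epsilon> J \<omega> f g T u t + 1/2 * (L2_norm_on D (u t))\<^sup>2"

definition grid_point :: "real \<Rightarrow> int^'n \<Rightarrow> real^'n" where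
  "grid_point h i = h *\<^sub>R (\<chi> k. real_of_int (i $ k))"

(* Half-open, so that the cells tile the space exactly. *)
definition grid_cell :: "real \<Rightarrow> int^'n \<Rightarrow> (real^'n) set" where
  "grid_cell h i =
     {x. \<forall>k. grid_point h i $ k - h / 2 \<le> x $ k \<and> x $ k < grid_point h i $ k + h / 2}"

(* For h > 0 and bounded D the index set is finite. *)
definition pc_extension ::
  "(real^'n) set \<Rightarrow> real \<Rightarrow> (int^'n \<Rightarrow> real^'n) \<Rightarrow> real^'n \<Rightarrow> real^'n" where
  "pc_extension D h w x =
     (\<Sum>i | grid_point h i \<in> D. indicat_real (grid_cell h i) x *\<^sub>R w i)"

definition semidiscrete_solution ::
  "(real^'n) set \<Rightarrow> real \<Rightarrow> real \<Rightarrow> (real \<Rightarrow> real) \<Rightarrow> (real^'n \<Rightarrow> real) \<Rightarrow> (real \<Rightarrow> real) \<Rightarrow> (real \<Rightarrow> real) \<Rightarrow>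
   real \<Rightarrow> (real^'n \<Rightarrow> real^'n) \<Rightarrow> (real^'n \<Rightarrow> real^'n) \<Rightarrow> (real \<Rightarrow> real^'n \<Rightarrow> real^'n) \<Rightarrow>
   (int^'n \<Rightarrow> real \<Rightarrow> real^'n) \<Rightarrow> bool" where
  "semidiscrete_solution D h \<epsilon> J \<omega> f g T u\<^sub>0 v\<^sub>0 b w \<longleftrightarrow>
     (\<exists>w'. \<forall>i. grid_point h i \<in> D \<longrightarrow>
        (\<forall>t\<in>{0..T}.
           (w i has_vector_derivative w' i t) (at t within {0..T}) \<and>
           (w' i has_vector_derivative
              force \<epsilon> J \<omega> f g (pc_extension D h (\<lambda>j. w j t)) (grid_point h i) + b t (grid_point h i))
             (at t within {0..T})) \<and>
        w i 0 = u\<^sub>0 (grid_point h i) \<and> w' i 0 = v\<^sub>0 (grid_point h i)) \<and>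
     (\<forall>i. grid_point h i \<notin> D \<longrightarrow> (\<forall>t\<in>{0..T}. w i t = 0))"

end

theory Submission
  imports Defs
begin

text \<open>
Both bounds are energy estimates, and the point is that the constants do not see the mesh. The
equation of motion evaluates the force at grid points only, whereas the time derivative of the
potential energy involves the force at every point of \<^term>\<open>D\<close>. The proof never
compares the two: it does not differentiate the potential energy at all.

Let $V(t)$ be the $L^2$ norm of the velocity. As a function of the displacement field the potential
energy is Lipschitz in $L^2$ with constant $C/\epsilon^2$ (\<open>bond_energy_lipschitz\<close>,
\<open>dilation_energy_lipschitz\<close>), and the displacement moves by at most
$\int_0^t V$ in $L^2$ (\<open>displacement_le_path_length\<close>). Hence
$E(t) = V(t)^2/2 + PD(u(0)) + (C/\epsilon^2)\int_0^t V$ dominates the total energy, agrees with it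
at time $0$, and is differentiable at every time. Its derivative is the power supplied by force and
load plus $(C/\epsilon^2)V$. The peridynamic force is itself bounded by a multiple of $1/\epsilon^2$,
so that $E' \le (2C/\epsilon^2 + \|b\|)V$. Convex-concave potentials are nonnegative, so $V \le
\sqrt{2E}$, and integrating the derivative of $\sqrt E$ gives the first bound.

For quadratic \<^term>\<open>g\<close> the dilatational force is controlled by the $L^2$ norm of the
displacement only, and the dilatational energy is the square of a seminorm, which grows at most
linearly along the path (\<open>weighted_strain_L2_lipschitz\<close>); its majorant is the square of
the affine bound. After adding $\|u\|^2/2$, Young's inequality turns the derivative of the majorant
into a linear differential inequality, and Gronwall's argument gives the second bound.

All $L^2$ estimates rest on one inequality, \<open>nn_integral_smoothing_le\<close>: averages over
translates are bounded on $L^2$. In the scaled variable $\xi$ the kernels live on the unit ball and do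
not depend on $\epsilon$, which is why the constants do not either; the singularity
$|\xi|^{-1/2}$ of the bond force is integrable. Values at grid points are turned into integrals over
cells by enlarging the ball of integration by a fixed factor, which is possible because $h<\epsilon$.
\<close>

section \<open>Nonnegativity of convex-concave potentials\<close>

text \<open>A concave function that becomes negative must have decreased, and then it keeps decreasing at
least linearly; this is incompatible with a finite limit. Below, \<^term>\<open>x\<close> is written as a
convex combination of \<^term>\<open>a\<close> and a point \<^term>\<open>s\<close> that tends to
infinity.\<close>

lemma concave_on_half_line_nonneg:
  fixes f :: "real \<Rightarrow> real"
  assumes conc: "concave_on {a..} f" and lim: "(f \<longlongrightarrow> l) at_top" and "0 \<le> f a" and "a \<le> x"
  shows "0 \<le> f x"
proof (cases "x = a")
  case False
  with assms have ax: "a < x" by simp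
  have q: "((\<lambda>s. (x - a) / (s - a)) \<longlongrightarrow> 0) at_top"
    by (intro tendsto_divide_0[OF tendsto_const] filterlim_at_top_imp_at_infinity
        filterlim_tendsto_add_at_top[OF tendsto_const filterlim_ident, of "- a", simplified])
  have "((\<lambda>s. (1 - (x - a) / (s - a)) * f a + (x - a) / (s - a) * f s) \<longlongrightarrow>
          (1 - 0) * f a + 0 * l) at_top"
    by (intro tendsto_intros q lim)
  moreover have "\<forall>\<^sub>F s in at_top. (1 - (x - a) / (s - a)) * f a + (x - a) / (s - a) * f s \<le> f x"
    using eventually_gt_at_top[of x]
  proof eventually_elim
    case (elim s)
    define \<mu> where "\<mu> = (x - a) / (s - a)"
    have \<mu>: "0 \<le> \<mu>" "\<mu> \<le> 1"
      using ax elim by (auto simp: \<mu>_def field_simps)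
    have "\<mu> * (s - a) = x - a"
      using ax elim by (simp add: \<mu>_def)
    then have \<mu>x: "(1 - \<mu>) *\<^sub>R a + \<mu> *\<^sub>R s = x"
      by (simp add: algebra_simps)
    have "(1 - \<mu>) * f a + \<mu> * f s \<le> f ((1 - \<mu>) *\<^sub>R a + \<mu> *\<^sub>R s)"
      using conc \<mu> ax elim unfolding concave_on_iff by auto
    then show ?case by (simp only: \<mu>x) (simp add: \<mu>_def)
  qed
  ultimately have "(1 - 0) * f a + 0 * l \<le> f x"
    by (intro tendsto_upperbound) auto
  with assms(3) show ?thesis by simp
qed (use assms in simp)

text \<open>The potential lies above its horizontal tangent at the origin between the inflection points; beyond them
  it is concave with a finite limit.\<close>

lemma convex_concave_nonneg:
  assumes "convex_concave f"
  shows "0 \<le> f x"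
proof -
  obtain rm rp l l' where f0: "f 0 = 0" "(f has_real_derivative 0) (at 0)"
    and r: "rm < 0" "0 < rp" and cv: "convex_on {rm..rp} f"
    and cc: "concave_on {..rm} f" "concave_on {rp..} f"
    and lim: "(f \<longlongrightarrow> l) at_top" "(f \<longlongrightarrow> l') at_bot"
    using assms unfolding convex_concave_def by blast
  have mid: "0 \<le> f y" if "y \<in> {rm..rp}" for y
    using convex_on_imp_above_tangent[OF cv, of 0 y 0] r f0 that
    by (auto intro: has_field_derivative_at_within)
  consider "x \<in> {rm..rp}" | "rp \<le> x" | "x \<le> rm" by fastforce
  then show ?thesis
  proof cases
    case 2
    then show ?thesis
      using concave_on_half_line_nonneg[OF cc(2) lim(1)] mid[of rp] r by simp
  next
    case 3
    have c: "concave_on {- rm..} (\<lambda>y. f (- y))"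
      unfolding concave_on_iff
    proof (intro conjI ballI allI impI)
      fix y z u v :: real assume H: "y \<in> {- rm..}" "z \<in> {- rm..}" "0 \<le> u" "0 \<le> v" "u + v = 1"
      then have "u * f (- y) + v * f (- z) \<le> f (u *\<^sub>R (- y) + v *\<^sub>R (- z))"
        using cc(1)[unfolded concave_on_iff, THEN conjunct2, rule_format, of "- y" "- z" u v] by auto
      then show "u * f (- y) + v * f (- z) \<le> f (- (u *\<^sub>R y + v *\<^sub>R z))"
        by (simp add: algebra_simps)
    qed simp
    have l: "((\<lambda>y. f (- y)) \<longlongrightarrow> l') at_top"
      using lim(2) by (rule filterlim_compose[OF _ filterlim_uminus_at_bot_at_top])
    show ?thesis
      using concave_on_half_line_nonneg[OF c l, of "- x"] mid[of rm] r 3 by simp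
  qed (rule mid)
qed

section \<open>Growth bounds from differential inequalities\<close>

text \<open>The derivative is only known to exist pointwise and may fail to be continuous or bounded, because the load
  is an arbitrary function of time with integrable norm. The Henstock-Kurzweil integral still recovers the increment,
  and it agrees with the Lebesgue integral on the majorant.\<close>

lemma derivative_bound_imp_increment_bound:
  fixes E :: "real \<Rightarrow> real"
  assumes t: "t \<in> {0..T}"
    and der: "\<And>s. s \<in> {0..T} \<Longrightarrow> (E has_real_derivative E' s) (at s within {0..T})"
    and bound: "\<And>s. s \<in> {0..T} \<Longrightarrow> E' s \<le> k s"
    and int: "set_integrable lborel {0..T} k"
  shows "E t - E 0 \<le> (LBINT s:{0..t}. k s)"
proof -
  have sub: "{0..t} \<subseteq> {0..T}" using t by auto
  have "set_integrable lborel {0..t} k"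
    by (rule set_integrable_subset[OF int _ sub]) simp
  then have k: "(k has_integral (LBINT s:{0..t}. k s)) {0..t}"
    using set_borel_integral_eq_integral[of "{0..t}" k] by (simp add: integrable_integral)
  have E: "(E' has_integral (E t - E 0)) {0..t}"
  proof (rule fundamental_theorem_of_calculus)
    fix s assume "s \<in> {0..t}"
    with sub show "(E has_vector_derivative E' s) (at s within {0..t})"
      unfolding has_real_derivative_iff_has_vector_derivative[symmetric]
      by (intro DERIV_subset[OF der sub]) auto
  qed (use t in simp)
  show ?thesis
    by (rule has_integral_le[OF E k]) (use bound sub in auto)
qed

text \<open>Formally $(\sqrt E)' = E'/(2\sqrt E) \le k/\sqrt 2$. The square root is differentiated at $E+\delta$, as
  $E$ may vanish, and then $\delta \to 0$.\<close>

lemma sqrt_growth_bound: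
  fixes E :: "real \<Rightarrow> real"
  assumes t: "t \<in> {0..T}"
    and der: "\<And>s. s \<in> {0..T} \<Longrightarrow> (E has_real_derivative E' s) (at s within {0..T})"
    and nonneg: "\<And>s. s \<in> {0..T} \<Longrightarrow> 0 \<le> E s"
    and bound: "\<And>s. s \<in> {0..T} \<Longrightarrow> E' s \<le> k s * sqrt (2 * E s)"
    and k: "\<And>s. 0 \<le> k s"
    and int: "set_integrable lborel {0..T} k"
  shows "E t \<le> (sqrt (E 0) + (LBINT s:{0..t}. k s))\<^sup>2"
proof -
  define A where "A = (LBINT s:{0..t}. k s)"
  have A: "0 \<le> A"
    unfolding A_def set_lebesgue_integral_def by (intro Bochner_Integration.integral_nonneg) (simp add: k)
  have step: "sqrt (E t + \<delta>) \<le> sqrt (E 0 + \<delta>) + A" if \<delta>: "0 < \<delta>" for \<delta>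
  proof -
    have pos: "0 < E s + \<delta>" if "s \<in> {0..T}" for s
      using nonneg[OF that] \<delta> by simp
    have d: "((\<lambda>s. sqrt (E s + \<delta>)) has_real_derivative E' s * (inverse (sqrt (E s + \<delta>)) / 2))
        (at s within {0..T})" if "s \<in> {0..T}" for s
      using pos[OF that] der[OF that]
      by (auto intro!: derivative_eq_intros simp: field_simps)
    have b: "E' s * (inverse (sqrt (E s + \<delta>)) / 2) \<le> k s" if s: "s \<in> {0..T}" for s
    proof -
      have "sqrt (2 * E s) \<le> sqrt (4 * (E s + \<delta>))"
        using nonneg[OF s] \<delta> by (intro real_sqrt_le_mono) simp
      also have "\<dots> = 2 * sqrt (E s + \<delta>)"
        by (subst real_sqrt_mult) simp
      finally have "E' s \<le> k s * (2 * sqrt (E s + \<delta>))"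
        using bound[OF s] k[of s] by (meson mult_left_mono order_trans)
      then show ?thesis
        using pos[OF s] by (simp add: field_simps)
    qed
    show ?thesis
      using derivative_bound_imp_increment_bound[OF t d b int] by (simp add: A_def)
  qed
  have "sqrt (E t) \<le> sqrt (E 0) + A"
  proof (rule tendsto_le[where F = "at_right 0"])
    show "((\<lambda>\<delta>. sqrt (E t + \<delta>)) \<longlongrightarrow> sqrt (E t)) (at_right 0)"
      by (auto intro!: tendsto_eq_intros)
    show "((\<lambda>\<delta>. sqrt (E 0 + \<delta>) + A) \<longlongrightarrow> sqrt (E 0) + A) (at_right 0)"
      by (auto intro!: tendsto_eq_intros)
    show "\<forall>\<^sub>F \<delta> in at_right 0. sqrt (E t + \<delta>) \<le> sqrt (E 0 + \<delta>) + A"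
      by (auto simp: eventually_at_right_field intro!: exI[of _ 1] step)
  qed simp
  then have "(sqrt (E t))\<^sup>2 \<le> (sqrt (E 0) + A)\<^sup>2"
    using nonneg[OF t] by (intro power_mono) auto
  then show ?thesis
    using nonneg[OF t] by (simp add: A_def)
qed

text \<open>The function $E e^{-Kt}$ has derivative at most $q e^{-Kt}$.\<close>

lemma gronwall_bound:
  fixes E :: "real \<Rightarrow> real"
  assumes t: "t \<in> {0..T}"
    and der: "\<And>s. s \<in> {0..T} \<Longrightarrow> (E has_real_derivative E' s) (at s within {0..T})"
    and bound: "\<And>s. s \<in> {0..T} \<Longrightarrow> E' s \<le> K * E s + q s"
    and q: "\<And>s. 0 \<le> q s"
    and int: "set_integrable lborel {0..T} q"
  shows "E t \<le> exp (K * t) * (E 0 + (LBINT s:{0..T}. q s * exp (- K * s)))"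
proof -
  have ci: "set_integrable lborel {0..T} (\<lambda>s. q s * exp (- K * s))"
  proof (rule set_integrable_bound)
    show "set_integrable lborel {0..T} (\<lambda>s. exp (\<bar>K\<bar> * T) * q s)"
      using int by simp
    have "set_borel_measurable lborel {0..T} q"
      using int unfolding set_integrable_def set_borel_measurable_def by auto
    then have q_meas: "(\<lambda>s. indicat_real {0..T} s * q s) \<in> borel_measurable borel"
      by (simp add: set_borel_measurable_def)
    have "(\<lambda>s. (indicat_real {0..T} s * q s) * exp (- K * s)) \<in> borel_measurable borel"
      by (rule borel_measurable_times[OF q_meas]) measurable
    then show "set_borel_measurable lborel {0..T} (\<lambda>s. q s * exp (- K * s))"
      unfolding set_borel_measurable_def by (simp add: mult.assoc)
    show "AE x in lborel. x \<in> {0..T} \<longrightarrow> norm (q x * exp (- K * x)) \<le> norm (exp (\<bar>K\<bar> * T) * q x)"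
    proof (intro always_eventually allI impI)
      fix x assume x: "x \<in> {0..T}"
      have "- K * x \<le> \<bar>K\<bar> * x"
        using x by (intro mult_right_mono) auto
      also have "\<dots> \<le> \<bar>K\<bar> * T"
        using x by (intro mult_left_mono) auto
      finally have "q x * exp (- K * x) \<le> q x * exp (\<bar>K\<bar> * T)"
        by (intro mult_left_mono q) simp
      then show "norm (q x * exp (- K * x)) \<le> norm (exp (\<bar>K\<bar> * T) * q x)"
        by (simp add: q abs_mult mult.commute)
    qed
  qed
  have "E t * exp (- K * t) - E 0 * exp (- K * 0) \<le> (LBINT s:{0..t}. q s * exp (- K * s))"
  proof (rule derivative_bound_imp_increment_bound[OF t _ _ ci])
    fix s assume s: "s \<in> {0..T}"
    show "((\<lambda>s. E s * exp (- K * s)) has_real_derivative (E' s - K * E s) * exp (- K * s))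
        (at s within {0..T})"
      using der[OF s] by (auto intro!: derivative_eq_intros simp: algebra_simps)
    show "(E' s - K * E s) * exp (- K * s) \<le> q s * exp (- K * s)"
      using bound[OF s] by (intro mult_right_mono) auto
  qed
  also have "\<dots> \<le> (LBINT s:{0..T}. q s * exp (- K * s))"
    using ci set_integrable_subset[OF ci, of "{0..t}"] t q
    unfolding set_lebesgue_integral_def set_integrable_def
    by (intro Bochner_Integration.integral_mono) (auto simp: indicator_def)
  finally have "exp (K * t) * (E t * exp (- K * t)) \<le>
      exp (K * t) * (E 0 + (LBINT s:{0..T}. q s * exp (- K * s)))"
    by (intro mult_left_mono) auto
  moreover have "exp (K * t) * (E t * exp (- K * t)) = E t"
    by (simp add: exp_minus)
  ultimately show ?thesis by (simp only:)
qed

text \<open>This is the statement that a curve is at least as long as its chord, in the Hilbert norm with weights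
  \<^term>\<open>m\<close>. The chord is paired with the curve, which makes the integrand a real function and gives
  $R^2 \le R\int V$.\<close>

lemma weighted_displacement_le_integral_velocity:
  fixes w w' :: "'i \<Rightarrow> real \<Rightarrow> 'a::euclidean_space"
  assumes m: "\<And>i. 0 \<le> m i" and t: "t \<in> {0..T}"
    and der: "\<And>i s. i \<in> I \<Longrightarrow> s \<in> {0..T} \<Longrightarrow> (w i has_vector_derivative w' i s) (at s within {0..T})"
    and cont: "\<And>i. i \<in> I \<Longrightarrow> continuous_on {0..T} (w' i)"
  shows "sqrt (\<Sum>i\<in>I. m i * (norm (w i t - w i 0))\<^sup>2)
    \<le> integral {0..t} (\<lambda>s. sqrt (\<Sum>i\<in>I. m i * (norm (w' i s))\<^sup>2))"
proof -
  define z where "z i = w i t - w i 0" for i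
  define V where "V = (\<lambda>s. sqrt (\<Sum>i\<in>I. m i * (norm (w' i s))\<^sup>2))"
  define R where "R = sqrt (\<Sum>i\<in>I. m i * (norm (z i))\<^sup>2)"
  have sub: "{0..t} \<subseteq> {0..T}" using t by auto
  have R2: "R\<^sup>2 = (\<Sum>i\<in>I. m i * (norm (z i))\<^sup>2)"
    unfolding R_def by (intro real_sqrt_pow2 sum_nonneg mult_nonneg_nonneg m) auto
  have R0: "0 \<le> R" unfolding R_def by (intro real_sqrt_ge_zero sum_nonneg mult_nonneg_nonneg m) auto
  have Vc: "continuous_on {0..t} V"
    unfolding V_def by (intro continuous_intros continuous_on_subset[OF cont sub]) auto
  have "((\<lambda>s. \<Sum>i\<in>I. m i * (z i \<bullet> w' i s)) has_integral
      (\<Sum>i\<in>I. m i * (z i \<bullet> w i t)) - (\<Sum>i\<in>I. m i * (z i \<bullet> w i 0))) {0..t}"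
  proof (rule fundamental_theorem_of_calculus)
    fix s assume s: "s \<in> {0..t}"
    have "(w i has_vector_derivative w' i s) (at s within {0..t})" if "i \<in> I" for i
      using der[OF that] s sub by (meson has_vector_derivative_within_subset subsetD)
    then show "((\<lambda>s. \<Sum>i\<in>I. m i * (z i \<bullet> w i s)) has_vector_derivative
        (\<Sum>i\<in>I. m i * (z i \<bullet> w' i s))) (at s within {0..t})"
      unfolding has_vector_derivative_def
      by (auto intro!: derivative_eq_intros simp: sum_distrib_left algebra_simps inner_right_distrib
          sum.distrib fun_eq_iff)
  qed (use t in simp)
  moreover have "(\<Sum>i\<in>I. m i * (z i \<bullet> w i t)) - (\<Sum>i\<in>I. m i * (z i \<bullet> w i 0)) = R\<^sup>2"
    by (simp add: R2 z_def power2_norm_eq_inner inner_diff_right inner_diff_left algebra_simps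
        flip: sum_subtractf)
  ultimately have "((\<lambda>s. \<Sum>i\<in>I. m i * (z i \<bullet> w' i s)) has_integral R\<^sup>2) {0..t}" by simp
  moreover have "((\<lambda>s. R * V s) has_integral R * integral {0..t} V) {0..t}"
    by (intro has_integral_mult_right integrable_integral integrable_continuous_real Vc)
  moreover have "(\<Sum>i\<in>I. m i * (z i \<bullet> w' i s)) \<le> R * V s" for s
  proof -
    have "(\<Sum>i\<in>I. m i * (z i \<bullet> w' i s))
        \<le> (\<Sum>i\<in>I. \<bar>sqrt (m i) * norm (z i)\<bar> * \<bar>sqrt (m i) * norm (w' i s)\<bar>)"
    proof (rule sum_mono)
      fix i
      have "m i * (z i \<bullet> w' i s) \<le> m i * (norm (z i) * norm (w' i s))"
        by (intro mult_left_mono norm_cauchy_schwarz m)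
      also have "\<dots> = (sqrt (m i) * sqrt (m i)) * (norm (z i) * norm (w' i s))"
        using m[of i] by simp
      also have "\<dots> = \<bar>sqrt (m i) * norm (z i)\<bar> * \<bar>sqrt (m i) * norm (w' i s)\<bar>"
        using m[of i] by (simp add: abs_mult mult_ac)
      finally show "m i * (z i \<bullet> w' i s) \<le> \<bar>sqrt (m i) * norm (z i)\<bar> * \<bar>sqrt (m i) * norm (w' i s)\<bar>" .
    qed
    also have "\<dots> \<le> L2_set (\<lambda>i. sqrt (m i) * norm (z i)) I * L2_set (\<lambda>i. sqrt (m i) * norm (w' i s)) I"
      by (rule L2_set_mult_ineq)
    also have "\<dots> = R * V s"
      using m by (simp add: L2_set_def R_def V_def power_mult_distrib)
    finally show ?thesis .
  qed
  ultimately have "R\<^sup>2 \<le> R * integral {0..t} V"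
    by (rule has_integral_le)
  moreover have "0 \<le> integral {0..t} V"
    unfolding V_def
    by (intro integral_nonneg integrable_continuous_real Vc[unfolded V_def] real_sqrt_ge_zero
        sum_nonneg mult_nonneg_nonneg m) auto
  ultimately have "R \<le> integral {0..t} V"
    using R0 by (cases "R = 0") (auto simp: power2_eq_square)
  then show ?thesis by (simp add: R_def V_def z_def)
qed

section \<open>Averages over translates in $L^2$\<close>

lemma ball_in_sets_borel [measurable]: "ball (a::'a::euclidean_space) r \<in> sets borel"
  by simp

lemma ennreal_norm_integral_le:
  fixes f :: "'a \<Rightarrow> 'b::{banach, second_countable_topology}"
  shows "ennreal (norm (integral\<^sup>L M f)) \<le> (\<integral>\<^sup>+x. norm (f x) \<partial>M)"
  by (cases "integrable M f") (auto simp: integral_norm_bound_ennreal not_integrable_integral_eq)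

lemma nn_integral_mult_le_L2:
  fixes \<phi> \<psi> :: "'a \<Rightarrow> ennreal"
  assumes [measurable]: "\<phi> \<in> borel_measurable M" "\<psi> \<in> borel_measurable M"
    and A: "(\<integral>\<^sup>+x. \<phi> x ^ 2 \<partial>M) \<le> ennreal (A\<^sup>2)" "0 \<le> A"
    and B: "(\<integral>\<^sup>+x. \<psi> x ^ 2 \<partial>M) \<le> ennreal (B\<^sup>2)" "0 \<le> B"
  shows "(\<integral>\<^sup>+x. \<phi> x * \<psi> x \<partial>M) \<le> ennreal (A * B)"
proof -
  have le: "(\<integral>\<^sup>+x. \<phi> x * \<psi> x \<partial>M)\<^sup>2 \<le> ennreal ((A * B)\<^sup>2)"
  proof -
    have "(\<integral>\<^sup>+x. \<phi> x * \<psi> x \<partial>M)\<^sup>2 \<le> (\<integral>\<^sup>+x. \<phi> x ^ 2 \<partial>M) * (\<integral>\<^sup>+x. \<psi> x ^ 2 \<partial>M)"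
      by (rule Cauchy_Schwarz_nn_integral) auto
    also have "\<dots> \<le> ennreal (A\<^sup>2) * ennreal (B\<^sup>2)"
      by (intro mult_mono A B) auto
    finally show ?thesis by (simp add: power_mult_distrib ennreal_mult)
  qed
  show ?thesis
  proof (cases "\<integral>\<^sup>+x. \<phi> x * \<psi> x \<partial>M")
    case (real r)
    with le have "ennreal (r\<^sup>2) \<le> ennreal ((A * B)\<^sup>2)" by (simp only: ennreal_power)
    then have "r\<^sup>2 \<le> (A * B)\<^sup>2" by (subst (asm) ennreal_le_iff) auto
    then have "r \<le> A * B" by (rule power2_le_imp_le) (simp add: A(2) B(2))
    with real show ?thesis by (simp add: ennreal_leI)
  next
    case top
    with le show ?thesis by (simp add: top_unique power_eq_top_ennreal)
  qed
qed

lemma nn_integral_lborel_shift: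
  fixes f :: "'a::euclidean_space \<Rightarrow> ennreal"
  assumes [measurable]: "f \<in> borel_measurable borel"
  shows "(\<integral>\<^sup>+x. f (x + a) \<partial>lborel) = (\<integral>\<^sup>+x. f x \<partial>lborel)"
  by (subst (2) lborel_distr_plus[of a, symmetric])
     (simp add: nn_integral_distr add.commute)

text \<open>Fubini moves the average outside; each translate of \<^term>\<open>\<phi>\<close> has the same $L^2$ norm,
  so that Cauchy-Schwarz bounds the inner integral uniformly in \<^term>\<open>\<xi>\<close>. The bound does not
  involve \<^term>\<open>\<epsilon>\<close>.\<close>

lemma nn_integral_smoothing_le:
  fixes \<phi> \<psi> k :: "'a::euclidean_space \<Rightarrow> ennreal" and \<epsilon> :: real
  assumes [measurable]: "\<phi> \<in> borel_measurable borel" "\<psi> \<in> borel_measurable borel" "k \<in> borel_measurable borel"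
    and \<kappa>: "(\<integral>\<^sup>+\<xi>. k \<xi> \<partial>lborel) \<le> ennreal \<kappa>" "0 \<le> \<kappa>"
    and A: "(\<integral>\<^sup>+x. \<phi> x ^ 2 \<partial>lborel) \<le> ennreal (A\<^sup>2)" "0 \<le> A"
    and B: "(\<integral>\<^sup>+x. \<psi> x ^ 2 \<partial>lborel) \<le> ennreal (B\<^sup>2)" "0 \<le> B"
  shows "(\<integral>\<^sup>+x. (\<integral>\<^sup>+\<xi>. k \<xi> * \<phi> (x + \<epsilon> *\<^sub>R \<xi>) \<partial>lborel) * \<psi> x \<partial>lborel) \<le> ennreal (\<kappa> * A * B)"
proof -
  have "(\<integral>\<^sup>+x. (\<integral>\<^sup>+\<xi>. k \<xi> * \<phi> (x + \<epsilon> *\<^sub>R \<xi>) \<partial>lborel) * \<psi> x \<partial>lborel)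
      = (\<integral>\<^sup>+x. (\<integral>\<^sup>+\<xi>. k \<xi> * (\<phi> (x + \<epsilon> *\<^sub>R \<xi>) * \<psi> x) \<partial>lborel) \<partial>lborel)"
    by (subst nn_integral_multc[symmetric]) (auto simp: mult.assoc)
  also have "\<dots> = (\<integral>\<^sup>+\<xi>. (\<integral>\<^sup>+x. k \<xi> * (\<phi> (x + \<epsilon> *\<^sub>R \<xi>) * \<psi> x) \<partial>lborel) \<partial>lborel)"
    by (rule lborel_pair.Fubini') measurable
  also have "\<dots> = (\<integral>\<^sup>+\<xi>. k \<xi> * (\<integral>\<^sup>+x. \<phi> (x + \<epsilon> *\<^sub>R \<xi>) * \<psi> x \<partial>lborel) \<partial>lborel)"
    by (subst nn_integral_cmult) auto
  also have "\<dots> \<le> (\<integral>\<^sup>+\<xi>. k \<xi> * ennreal (A * B) \<partial>lborel)"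
  proof (intro nn_integral_mono mult_left_mono nn_integral_mult_le_L2 A(2) B)
    fix \<xi> :: 'a
    show "(\<lambda>x. \<phi> (x + \<epsilon> *\<^sub>R \<xi>)) \<in> borel_measurable lborel" by measurable
    show "(\<integral>\<^sup>+x. \<phi> (x + \<epsilon> *\<^sub>R \<xi>) ^ 2 \<partial>lborel) \<le> ennreal (A\<^sup>2)"
      using A(1) by (subst nn_integral_lborel_shift[where f = "\<lambda>x. \<phi> x ^ 2"]) auto
  qed simp_all
  also have "\<dots> = (\<integral>\<^sup>+\<xi>. k \<xi> \<partial>lborel) * ennreal (A * B)"
    by (rule nn_integral_multc) simp
  also have "\<dots> \<le> ennreal \<kappa> * ennreal (A * B)"
    by (intro mult_right_mono \<kappa>) auto
  also have "\<dots> = ennreal (\<kappa> * A * B)"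
    using \<kappa>(2) A(2) B(2) by (simp add: ennreal_mult mult.assoc)
  finally show ?thesis .
qed

text \<open>The form in which differences of a field across a bond enter: $|u(x+\epsilon\xi)-u(x)|$ is at most a sum
  of two moduli. The term without translation is the case $\epsilon=0$ of the previous lemma.\<close>

lemma nn_integral_difference_kernel_le:
  fixes \<phi> \<psi> k :: "'a::euclidean_space \<Rightarrow> ennreal" and \<epsilon> :: real
  assumes [measurable]: "\<phi> \<in> borel_measurable borel" "\<psi> \<in> borel_measurable borel" "k \<in> borel_measurable borel"
    and \<kappa>: "(\<integral>\<^sup>+\<xi>. k \<xi> \<partial>lborel) \<le> ennreal \<kappa>" "0 \<le> \<kappa>"
    and A: "(\<integral>\<^sup>+x. \<phi> x ^ 2 \<partial>lborel) \<le> ennreal (A\<^sup>2)" "0 \<le> A"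
    and B: "(\<integral>\<^sup>+x. \<psi> x ^ 2 \<partial>lborel) \<le> ennreal (B\<^sup>2)" "0 \<le> B"
  shows "(\<integral>\<^sup>+x. (\<integral>\<^sup>+\<xi>. k \<xi> * (\<phi> (x + \<epsilon> *\<^sub>R \<xi>) + \<phi> x) \<partial>lborel) * \<psi> x \<partial>lborel) \<le> ennreal (2 * \<kappa> * A * B)"
proof -
  have "(\<integral>\<^sup>+\<xi>. k \<xi> * (\<phi> (x + \<epsilon> *\<^sub>R \<xi>) + \<phi> (x + 0 *\<^sub>R \<xi>)) \<partial>lborel)
      = (\<integral>\<^sup>+\<xi>. k \<xi> * \<phi> (x + \<epsilon> *\<^sub>R \<xi>) \<partial>lborel) + (\<integral>\<^sup>+\<xi>. k \<xi> * \<phi> (x + 0 *\<^sub>R \<xi>) \<partial>lborel)" for x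
    by (subst nn_integral_add[symmetric]) (measurable, rule nn_integral_cong, rule distrib_left)
  then have "(\<integral>\<^sup>+x. (\<integral>\<^sup>+\<xi>. k \<xi> * (\<phi> (x + \<epsilon> *\<^sub>R \<xi>) + \<phi> (x + 0 *\<^sub>R \<xi>)) \<partial>lborel) * \<psi> x \<partial>lborel)
      = (\<integral>\<^sup>+x. (\<integral>\<^sup>+\<xi>. k \<xi> * \<phi> (x + \<epsilon> *\<^sub>R \<xi>) \<partial>lborel) * \<psi> x
             + (\<integral>\<^sup>+\<xi>. k \<xi> * \<phi> (x + 0 *\<^sub>R \<xi>) \<partial>lborel) * \<psi> x \<partial>lborel)"
    by (simp only: distrib_right)
  also have "\<dots> = (\<integral>\<^sup>+x. (\<integral>\<^sup>+\<xi>. k \<xi> * \<phi> (x + \<epsilon> *\<^sub>R \<xi>) \<partial>lborel) * \<psi> x \<partial>lborel)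
      + (\<integral>\<^sup>+x. (\<integral>\<^sup>+\<xi>. k \<xi> * \<phi> (x + 0 *\<^sub>R \<xi>) \<partial>lborel) * \<psi> x \<partial>lborel)"
    by (rule nn_integral_add) measurable
  also have "\<dots> \<le> ennreal (\<kappa> * A * B) + ennreal (\<kappa> * A * B)"
    by (intro add_mono nn_integral_smoothing_le assms)
  also have "\<dots> = ennreal (2 * \<kappa> * A * B)"
    using \<kappa> A B by (subst ennreal_plus[symmetric]) auto
  finally show ?thesis unfolding scaleR_zero_left add_0_right .
qed

text \<open>On the dyadic shell $2^{-k-1} \le |\xi| < 2^{-k}$ the integrand is at most $2\cdot 2^{k/2}$, and the ball
  of radius $2^{-k}$ has volume at most a multiple of $2^{-k}$ in every dimension; the geometric series of ratio
  $2^{-1/2}$ converges.\<close>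

lemma nn_integral_inverse_sqrt_norm_unit_ball_finite:
  "(\<integral>\<^sup>+(\<xi>::'a::euclidean_space). indicator (ball 0 1) \<xi> * ennreal (1 / sqrt (norm \<xi>)) \<partial>lborel) < \<infinity>"
proof -
  define q where "q = sqrt 2 / 2"
  have q: "0 \<le> q" "q < 1"
    using real_sqrt_less_mono[of 2 4] by (auto simp: q_def)
  have s2: "sqrt 2 ^ n = (2 * q) ^ n" for n by (simp add: q_def)
  define v where "v = measure lborel (ball (0::'a) 1)"
  define t where "t k \<xi> = ennreal (2 * sqrt 2 ^ k) * indicator (ball (0::'a) ((1/2)^k)) \<xi>" for k \<xi>
  have "indicator (ball 0 1) \<xi> * ennreal (1 / sqrt (norm \<xi>)) \<le> (\<Sum>k. t k \<xi>)" for \<xi> :: 'a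
  proof (cases "\<xi> \<noteq> 0 \<and> norm \<xi> < 1")
    case True
    define r where "r = norm \<xi>"
    have r: "0 < r" "r < 1" using True by (auto simp: r_def)
    have "\<exists>n. (1/2::real)^n < r" by (rule real_arch_pow_inv) (use r in auto)
    then obtain n where n: "(1/2::real)^n < r" ..
    define m where "m = (LEAST n. (1/2::real)^n \<le> r)"
    have m: "(1/2::real)^m \<le> r" unfolding m_def by (rule LeastI[of _ n]) (use n in simp)
    have "m \<noteq> 0" using m r by (cases m) auto
    then obtain k where k: "m = Suc k" by (cases m) auto
    have k2: "r < (1/2)^k"
      using not_less_Least[of k "\<lambda>n. (1/2::real)^n \<le> r"] k unfolding m_def by linarith
    have "1 / sqrt r \<le> 1 / sqrt ((1/2)^m)"
      using m r by (intro divide_left_mono real_sqrt_le_mono mult_pos_pos) auto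
    also have "\<dots> = sqrt 2 * sqrt 2 ^ k"
      by (simp add: k real_sqrt_power real_sqrt_divide real_sqrt_mult power_divide)
    also have "\<dots> \<le> 2 * sqrt 2 ^ k"
      using q by (intro mult_right_mono) (auto simp: q_def)
    finally have "ennreal (1 / sqrt (norm \<xi>)) \<le> t k \<xi>"
      using k2 by (simp add: t_def r_def ennreal_leI)
    also have "\<dots> \<le> (\<Sum>k. t k \<xi>)"
      using sum_le_suminf[of "\<lambda>k. t k \<xi>" "{k}"] by simp
    finally show ?thesis using True by simp
  qed auto
  then have "(\<integral>\<^sup>+(\<xi>::'a). indicator (ball 0 1) \<xi> * ennreal (1 / sqrt (norm \<xi>)) \<partial>lborel)
      \<le> (\<integral>\<^sup>+\<xi>. (\<Sum>k. t k \<xi>) \<partial>lborel)"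
    by (intro nn_integral_mono)
  also have "\<dots> = (\<Sum>k. (\<integral>\<^sup>+\<xi>. t k \<xi> \<partial>lborel))"
    unfolding t_def by (rule nn_integral_suminf) measurable
  also have "\<dots> \<le> (\<Sum>k. ennreal (2 * v * q ^ k))"
  proof (intro suminf_le)
    fix k
    have "measure lborel (ball (0::'a) ((1/2)^k)) = ((1/2)^k) ^ DIM('a) * v"
      using content_ball_conv_unit_ball[of "(1/2)^k" "0::'a"] by (simp add: v_def)
    also have "\<dots> \<le> (1/2)^k * v"
    proof (rule mult_right_mono)
      have "((1/2::real)^k) ^ DIM('a) \<le> ((1/2)^k) ^ 1"
        by (intro power_decreasing) (auto simp: power_le_one Suc_leI)
      then show "((1/2::real)^k) ^ DIM('a) \<le> (1/2)^k" by simp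
    qed (simp add: v_def)
    finally have mb: "measure lborel (ball (0::'a) ((1/2)^k)) \<le> (1/2)^k * v" .
    have "(\<integral>\<^sup>+\<xi>. t k \<xi> \<partial>lborel) = ennreal (2 * sqrt 2 ^ k) * ennreal (measure lborel (ball (0::'a) ((1/2)^k)))"
      by (simp add: t_def nn_integral_cmult_indicator) (metis emeasure_eq_ennreal_measure emeasure_lborel_ball_finite less_irrefl infinity_ennreal_def)
    also have "\<dots> \<le> ennreal (2 * sqrt 2 ^ k) * ennreal ((1/2)^k * v)"
      by (intro mult_left_mono ennreal_leI mb) auto
    also have "\<dots> = ennreal (2 * v * q ^ k)"
      using q by (subst ennreal_mult[symmetric]) (auto simp: v_def s2 power_mult_distrib power_divide mult_ac)
    finally show "(\<integral>\<^sup>+\<xi>. t k \<xi> \<partial>lborel) \<le> ennreal (2 * v * q ^ k)" .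
  qed auto
  also have "\<dots> = ennreal (\<Sum>k. 2 * v * q ^ k)"
    using q by (intro suminf_ennreal_eq summable_sums summable_mult summable_geometric) (auto simp: v_def)
  also have "\<dots> < \<infinity>" by simp
  finally show ?thesis .
qed

section \<open>Hydrostatic strain\<close>

lemma borel_measurable_sgn_vector [measurable]:
  "(sgn :: 'a::euclidean_space \<Rightarrow> 'a) \<in> borel_measurable borel"
  unfolding sgn_div_norm by measurable

lemma unit_vol_pos: "0 < unit_vol TYPE('n::finite)"
  by (simp add: unit_vol_def content_ball_pos)

lemma emeasure_ball_unit_vol:
  assumes "0 \<le> r"
  shows "emeasure lborel (ball (0::real^'n) r) = ennreal (r ^ CARD('n) * unit_vol TYPE('n))"
proof -
  have "measure lborel (ball (0::real^'n) r) = r ^ CARD('n) * unit_vol TYPE('n)"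
    using content_ball_conv_unit_ball[OF assms, of "0::real^'n"] by (simp add: unit_vol_def)
  then show ?thesis
    by (metis emeasure_eq_ennreal_measure emeasure_lborel_ball_finite less_irrefl infinity_ennreal_def)
qed

lemma set_integral_ball_rescale:
  fixes H :: "'a::euclidean_space \<Rightarrow> real"
  assumes "0 < \<epsilon>" and [measurable]: "H \<in> borel_measurable borel"
  shows "(LBINT y:ball x \<epsilon>. H y) = \<epsilon> ^ DIM('a) * (LBINT \<xi>:ball 0 1. H (x + \<epsilon> *\<^sub>R \<xi>))"
proof -
  have ind: "indicat_real (ball x \<epsilon>) (x + \<epsilon> *\<^sub>R \<xi>) = indicat_real (ball 0 1) \<xi>" for \<xi>
    using assms(1) by (simp add: indicator_def dist_norm)
  have "(LBINT y:ball x \<epsilon>. H y) =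
      (\<integral>y. indicat_real (ball x \<epsilon>) y * H y \<partial>density (distr lborel borel (\<lambda>\<xi>. x + \<epsilon> *\<^sub>R \<xi>)) (\<lambda>_. ennreal (\<bar>\<epsilon>\<bar> ^ DIM('a))))"
    unfolding set_lebesgue_integral_def using assms(1)
    by (subst lborel_affine[of \<epsilon> x]) auto
  also have "\<dots> = (\<integral>\<xi>. \<epsilon> ^ DIM('a) * (indicat_real (ball x \<epsilon>) (x + \<epsilon> *\<^sub>R \<xi>) * H (x + \<epsilon> *\<^sub>R \<xi>)) \<partial>lborel)"
    using assms(1) by (subst integral_density) (auto simp: integral_distr)
  finally show ?thesis
    by (simp add: ind set_lebesgue_integral_def)
qed

text \<open>The mass of the singular weight in the bond force.\<close>

definition inverse_sqrt_mass :: "'n::finite itself \<Rightarrow> real" where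
  "inverse_sqrt_mass _ =
     enn2real (\<integral>\<^sup>+(\<xi>::real^'n). indicator (ball 0 1) \<xi> * ennreal (1 / sqrt (norm \<xi>)) \<partial>lborel)"

lemma nn_integral_inverse_sqrt_mass:
  "(\<integral>\<^sup>+(\<xi>::real^'n). indicator (ball 0 1) \<xi> * ennreal (1 / sqrt (norm \<xi>)) \<partial>lborel)
     = ennreal (inverse_sqrt_mass TYPE('n::finite))"
  using nn_integral_inverse_sqrt_norm_unit_ball_finite[where 'a = "real^'n"]
  unfolding inverse_sqrt_mass_def infinity_ennreal_def by (simp only: ennreal_enn2real)

lemma inverse_sqrt_mass_nonneg: "0 \<le> inverse_sqrt_mass TYPE('n::finite)"
  by (simp add: inverse_sqrt_mass_def)

text \<open>The data that all operators share. The upper bound \<^term>\<open>M\<close> of the influence function is a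
  parameter because all constants are expressed in it.\<close>

locale peridynamic_setting =
  fixes D :: "(real^'n) set" and J :: "real \<Rightarrow> real" and \<omega> :: "real^'n \<Rightarrow> real" and \<epsilon> M :: real
  assumes D_open: "open D" and D_bounded: "bounded D"
    and J_measurable [measurable]: "(\<lambda>\<xi>::real^'n. J (norm \<xi>)) \<in> borel_measurable borel"
    and J_nonneg: "\<And>r. 0 \<le> r \<Longrightarrow> r < 1 \<Longrightarrow> 0 \<le> J r"
    and J_le: "\<And>r. 0 \<le> r \<Longrightarrow> r < 1 \<Longrightarrow> J r \<le> M"
    and \<omega>_measurable [measurable]: "\<omega> \<in> borel_measurable borel"
    and \<omega>_nonneg: "\<And>x. 0 \<le> \<omega> x" and \<omega>_le_1: "\<And>x. \<omega> x \<le> 1"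
    and \<omega>_outside: "\<And>x. x \<notin> D \<Longrightarrow> \<omega> x = 0"
    and \<epsilon>_pos: "0 < \<epsilon>" and \<epsilon>_less_1: "\<epsilon> < 1"
begin

abbreviation "\<theta> \<equiv> hydro_strain \<epsilon> J \<omega>"

lemma D_sets [measurable]: "D \<in> sets borel"
  using D_open by simp

lemma emeasure_D: "emeasure lborel D = ennreal (measure lborel D)"
  by (metis D_bounded emeasure_bounded_finite emeasure_eq_ennreal_measure less_irrefl infinity_ennreal_def)

lemma emeasure_D_finite: "emeasure lborel D < \<infinity>"
  by (simp add: emeasure_D)

lemma M_nonneg: "0 \<le> M"
  using J_nonneg[of 0] J_le[of 0] by simp

lemma vol_pos: "0 < unit_vol TYPE('n)"
  by (rule unit_vol_pos)

lemma emeasure_unit_ball: "emeasure lborel (ball (0::real^'n) 1) = ennreal (unit_vol TYPE('n))"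
  using emeasure_ball_unit_vol[of 1, where 'n = 'n] by simp

lemma set_integrable_unit_ball:
  fixes F :: "real^'n \<Rightarrow> 'b::{banach, second_countable_topology}"
  assumes "F \<in> borel_measurable borel" and "\<And>\<xi>. norm \<xi> < 1 \<Longrightarrow> norm (F \<xi>) \<le> B"
  shows "set_integrable lborel (ball 0 1) F"
  unfolding set_integrable_def
  by (rule integrableI_bounded_set_indicator[where B = B])
     (use assms in \<open>auto simp: emeasure_unit_ball\<close>)

lemma set_integrable_D:
  fixes F :: "real^'n \<Rightarrow> 'b::{banach, second_countable_topology}"
  assumes "F \<in> borel_measurable borel" and "\<And>x. x \<in> D \<Longrightarrow> norm (F x) \<le> B"
  shows "set_integrable lborel D F"
  unfolding set_integrable_def
  by (rule integrableI_bounded_set_indicator[where B = B])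
     (use assms emeasure_D_finite in auto)

lemma ennreal_norm_set_integral_le:
  fixes F :: "real^'n \<Rightarrow> 'b::{banach, second_countable_topology}"
  assumes "\<And>x. x \<in> A \<Longrightarrow> ennreal (norm (F x)) \<le> (G x :: ennreal)"
  shows "ennreal (norm (LBINT x:A. F x)) \<le> (\<integral>\<^sup>+x. indicator A x * G x \<partial>lborel)"
  unfolding set_lebesgue_integral_def
  by (rule order_trans[OF ennreal_norm_integral_le], rule nn_integral_mono)
     (use assms in \<open>auto simp: indicator_def\<close>)

definition bounded_field :: "(real^'n \<Rightarrow> real^'n) \<Rightarrow> bool" where
  "bounded_field u \<longleftrightarrow> u \<in> borel_measurable borel \<and> (\<exists>B. \<forall>x. norm (u x) \<le> B)"

lemma bounded_field_measurable: "bounded_field u \<Longrightarrow> u \<in> borel_measurable borel"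
  by (simp add: bounded_field_def)

lemma bounded_fieldE:
  assumes "bounded_field u"
  obtains B where "0 \<le> B" "\<And>x. norm (u x) \<le> B"
  using assms unfolding bounded_field_def by (metis norm_ge_zero order_trans)

lemma bounded_field_diff:
  assumes "bounded_field u" "bounded_field v"
  shows "bounded_field (\<lambda>x. u x - v x)"
proof -
  obtain A B where "\<And>x. norm (u x) \<le> A" "\<And>x. norm (v x) \<le> B"
    using assms unfolding bounded_field_def by auto
  then have "norm (u x - v x) \<le> A + B" for x
    by (meson add_mono norm_triangle_ineq4 order_trans)
  then show ?thesis using assms unfolding bounded_field_def by (auto intro!: borel_measurable_diff)
qed

text \<open>The modulus is cut off outside \<^term>\<open>D\<close>: a piecewise constant field lives on whole cells,
  which stick out of the domain, whereas only its values in \<^term>\<open>D\<close> are weighted by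
  \<^term>\<open>\<omega>\<close> and counted in the $L^2$ norm.\<close>

definition modulus :: "(real^'n \<Rightarrow> 'b::real_normed_vector) \<Rightarrow> real^'n \<Rightarrow> ennreal" where
  "modulus u x = indicator D x * ennreal (norm (u x))"

lemma modulus_measurable [measurable]:
  fixes u :: "real^'n \<Rightarrow> 'b::{real_normed_vector, second_countable_topology}"
  shows "u \<in> borel_measurable borel \<Longrightarrow> modulus u \<in> borel_measurable borel"
  unfolding modulus_def by measurable

lemma \<omega>_mult_norm_le_modulus: "ennreal (\<omega> x * norm (u x)) \<le> modulus u x"
  using \<omega>_nonneg[of x] \<omega>_le_1[of x] \<omega>_outside[of x]
  by (cases "x \<in> D") (auto simp: modulus_def intro!: ennreal_leI mult_left_le_one_le)

text \<open>Up to constants, \<^term>\<open>ball_sum\<close> of the modulus of a field bounds its hydrostatic strain,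
  and \<^term>\<open>ball_sum\<close> of the modulus of the strain bounds the dilatational force.\<close>

definition ball_sum :: "(real^'n \<Rightarrow> ennreal) \<Rightarrow> real^'n \<Rightarrow> ennreal" where
  "ball_sum \<phi> x = (\<integral>\<^sup>+\<xi>. indicator (ball 0 1) \<xi> * (\<phi> (x + \<epsilon> *\<^sub>R \<xi>) + \<phi> x) \<partial>lborel)"

definition ball_integral :: "real \<Rightarrow> (real^'n \<Rightarrow> ennreal) \<Rightarrow> real^'n \<Rightarrow> ennreal" where
  "ball_integral r \<phi> x = (\<integral>\<^sup>+\<xi>. indicator (ball 0 r) \<xi> * \<phi> (x + \<epsilon> *\<^sub>R \<xi>) \<partial>lborel)"

lemma ball_integral_measurable [measurable]:
  assumes [measurable]: "\<phi> \<in> borel_measurable borel"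
  shows "ball_integral r \<phi> \<in> borel_measurable borel"
  unfolding ball_integral_def by measurable

lemma ball_sum_measurable [measurable]:
  assumes [measurable]: "\<phi> \<in> borel_measurable borel"
  shows "ball_sum \<phi> \<in> borel_measurable borel"
  unfolding ball_sum_def by measurable

lemma ball_sum_eq:
  assumes [measurable]: "\<phi> \<in> borel_measurable borel"
  shows "ball_sum \<phi> x = ball_integral 1 \<phi> x + ennreal (unit_vol TYPE('n)) * \<phi> x"
proof -
  have "ball_sum \<phi> x = (\<integral>\<^sup>+\<xi>. indicator (ball 0 1) \<xi> * \<phi> (x + \<epsilon> *\<^sub>R \<xi>) + \<phi> x * indicator (ball 0 1) \<xi> \<partial>lborel)"
    unfolding ball_sum_def by (intro nn_integral_cong) (simp add: distrib_left mult.commute)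
  also have "\<dots> = ball_integral 1 \<phi> x + (\<integral>\<^sup>+\<xi>. \<phi> x * indicator (ball (0::real^'n) 1) \<xi> \<partial>lborel)"
    unfolding ball_integral_def by (rule nn_integral_add) measurable
  also have "(\<integral>\<^sup>+\<xi>. \<phi> x * indicator (ball (0::real^'n) 1) \<xi> \<partial>lborel) = ennreal (unit_vol TYPE('n)) * \<phi> x"
    by (subst nn_integral_cmult_indicator) (auto simp: emeasure_unit_ball mult.commute)
  finally show ?thesis .
qed

lemma ball_sum_mono: "(\<And>x. \<phi> x \<le> \<psi> x) \<Longrightarrow> ball_sum \<phi> x \<le> ball_sum \<psi> x"
  unfolding ball_sum_def by (intro nn_integral_mono mult_left_mono add_mono) auto

lemma ball_sum_cmult:
  assumes [measurable]: "\<phi> \<in> borel_measurable borel"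
  shows "ball_sum (\<lambda>x. c * \<phi> x) x = c * ball_sum \<phi> x"
  unfolding ball_sum_def
  by (subst nn_integral_cmult[symmetric]) (auto intro!: nn_integral_cong simp: algebra_simps)

text \<open>A ball around \<^term>\<open>y\<close> is contained in a larger ball around \<^term>\<open>x\<close>. This
  is what replaces a grid point by an arbitrary point of its cell.\<close>

lemma ball_integral_recenter:
  assumes [measurable]: "\<phi> \<in> borel_measurable borel" and "norm (y - x) \<le> \<epsilon> * c"
  shows "ball_integral r \<phi> y \<le> ball_integral (r + c) \<phi> x"
proof -
  define a where "a = (1 / \<epsilon>) *\<^sub>R (y - x)"
  have y: "y = x + \<epsilon> *\<^sub>R a"
    using \<epsilon>_pos by (simp add: a_def)
  have a: "norm a \<le> c"
    using assms(2) \<epsilon>_pos by (simp add: y)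
  have "ball_integral r \<phi> y \<le> (\<integral>\<^sup>+\<xi>. indicator (ball 0 (r + c)) (\<xi> + a) * \<phi> (x + \<epsilon> *\<^sub>R (\<xi> + a)) \<partial>lborel)"
    unfolding ball_integral_def
  proof (intro nn_integral_mono mult_mono)
    fix \<xi> :: "real^'n"
    show "(indicator (ball 0 r) \<xi> :: ennreal) \<le> indicator (ball 0 (r + c)) (\<xi> + a)"
      using norm_triangle_ineq[of \<xi> a] a by (auto simp: indicator_def)
    show "\<phi> (y + \<epsilon> *\<^sub>R \<xi>) \<le> \<phi> (x + \<epsilon> *\<^sub>R (\<xi> + a))"
      by (simp add: y algebra_simps)
  qed auto
  also have "\<dots> = ball_integral (r + c) \<phi> x"
    unfolding ball_integral_def
    by (rule nn_integral_lborel_shift[where f = "\<lambda>\<xi>. indicator (ball 0 (r + c)) \<xi> * \<phi> (x + \<epsilon> *\<^sub>R \<xi>)"]) measurable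
  finally show ?thesis .
qed

text \<open>An average of averages over unit balls only sees the ball of radius two.\<close>

lemma ball_integral_twice_le:
  assumes [measurable]: "\<phi> \<in> borel_measurable borel"
  shows "ball_integral 1 (ball_integral 1 \<phi>) x \<le> ennreal (unit_vol TYPE('n)) * ball_integral 2 \<phi> x"
proof -
  have "ball_integral 1 (ball_integral 1 \<phi>) x \<le> (\<integral>\<^sup>+(\<xi>::real^'n). ball_integral 2 \<phi> x * indicator (ball 0 1) \<xi> \<partial>lborel)"
    unfolding ball_integral_def[of 1 "ball_integral 1 \<phi>"]
  proof (rule nn_integral_mono)
    fix \<xi> :: "real^'n"
    show "indicator (ball 0 1) \<xi> * ball_integral 1 \<phi> (x + \<epsilon> *\<^sub>R \<xi>) \<le> ball_integral 2 \<phi> x * indicator (ball 0 1) \<xi>"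
      using ball_integral_recenter[OF assms, of "x + \<epsilon> *\<^sub>R \<xi>" x 1 1] \<epsilon>_pos
      by (cases "norm \<xi> < 1") auto
  qed
  also have "\<dots> = ennreal (unit_vol TYPE('n)) * ball_integral 2 \<phi> x"
    by (subst nn_integral_cmult_indicator) (auto simp: emeasure_unit_ball mult.commute)
  finally show ?thesis .
qed

text \<open>The dilatational force is obtained by applying the averaging twice, so this bound reduces it to a single
  ball integral.\<close>

lemma ball_sum_twice_le:
  assumes [measurable]: "\<phi> \<in> borel_measurable borel"
  shows "ball_sum (ball_sum \<phi>) x \<le> ennreal (unit_vol TYPE('n)) * (3 * ball_integral 2 \<phi> x + ennreal (unit_vol TYPE('n)) * \<phi> x)"
proof -
  have mono: "ball_integral 1 \<phi> x \<le> ball_integral 2 \<phi> x"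
    using ball_integral_recenter[OF assms, of x x 1 1] \<epsilon>_pos by simp
  have "ball_integral 1 (ball_sum \<phi>) x = ball_integral 1 (ball_integral 1 \<phi>) x + ennreal (unit_vol TYPE('n)) * ball_integral 1 \<phi> x"
  proof -
    have "ball_integral 1 (ball_sum \<phi>) x =
        (\<integral>\<^sup>+\<xi>. indicator (ball 0 1) \<xi> * ball_integral 1 \<phi> (x + \<epsilon> *\<^sub>R \<xi>)
            + ennreal (unit_vol TYPE('n)) * (indicator (ball 0 1) \<xi> * \<phi> (x + \<epsilon> *\<^sub>R \<xi>)) \<partial>lborel)"
      unfolding ball_integral_def[of 1 "ball_sum \<phi>"]
      by (intro nn_integral_cong) (simp add: ball_sum_eq[OF assms] distrib_left mult_ac)
    also have "\<dots> = ball_integral 1 (ball_integral 1 \<phi>) x + (\<integral>\<^sup>+\<xi>. ennreal (unit_vol TYPE('n)) * (indicator (ball 0 1) \<xi> * \<phi> (x + \<epsilon> *\<^sub>R \<xi>)) \<partial>lborel)"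
      unfolding ball_integral_def[of 1 "ball_integral 1 \<phi>"] by (rule nn_integral_add) measurable
    also have "(\<integral>\<^sup>+\<xi>. ennreal (unit_vol TYPE('n)) * (indicator (ball 0 1) \<xi> * \<phi> (x + \<epsilon> *\<^sub>R \<xi>)) \<partial>lborel) = ennreal (unit_vol TYPE('n)) * ball_integral 1 \<phi> x"
      unfolding ball_integral_def by (rule nn_integral_cmult) measurable
    finally show ?thesis .
  qed
  then have "ball_sum (ball_sum \<phi>) x
      = ball_integral 1 (ball_integral 1 \<phi>) x + ennreal (unit_vol TYPE('n)) * ball_integral 1 \<phi> x
        + ennreal (unit_vol TYPE('n)) * (ball_integral 1 \<phi> x + ennreal (unit_vol TYPE('n)) * \<phi> x)"
    by (simp add: ball_sum_eq assms)
  also have "\<dots> \<le> ennreal (unit_vol TYPE('n)) * ball_integral 2 \<phi> x + ennreal (unit_vol TYPE('n)) * ball_integral 2 \<phi> x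
        + ennreal (unit_vol TYPE('n)) * (ball_integral 2 \<phi> x + ennreal (unit_vol TYPE('n)) * \<phi> x)"
    by (intro add_mono mult_left_mono ball_integral_twice_le assms mono) auto
  also have "\<dots> = ennreal (unit_vol TYPE('n)) * ((1 + 1 + 1) * ball_integral 2 \<phi> x + ennreal (unit_vol TYPE('n)) * \<phi> x)"
    by (simp only: distrib_left distrib_right mult_1 add.assoc)
  finally show ?thesis by simp
qed

lemma norm_inner_sgn_le: "\<bar>v \<bullet> sgn \<xi>\<bar> \<le> norm (v :: real^'n)"
  using Cauchy_Schwarz_ineq2[of v "sgn \<xi>"] by (auto simp: norm_sgn split: if_splits)

lemma abs_J_le: "norm \<xi> < 1 \<Longrightarrow> \<bar>J (norm (\<xi> :: real^'n))\<bar> \<le> M"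
  using J_nonneg[of "norm \<xi>"] J_le[of "norm \<xi>"] by simp

lemma strain_integrand_le:
  assumes "norm (\<xi> :: real^'n) < 1"
  shows "\<bar>\<omega> (x + \<epsilon> *\<^sub>R \<xi>) * J (norm \<xi>) * ((u (x + \<epsilon> *\<^sub>R \<xi>) - u x) \<bullet> sgn \<xi>)\<bar>
    \<le> M * (\<omega> (x + \<epsilon> *\<^sub>R \<xi>) * (norm (u (x + \<epsilon> *\<^sub>R \<xi>)) + norm (u x)))"
proof -
  have "\<bar>\<omega> (x + \<epsilon> *\<^sub>R \<xi>) * J (norm \<xi>) * ((u (x + \<epsilon> *\<^sub>R \<xi>) - u x) \<bullet> sgn \<xi>)\<bar>
      = \<bar>J (norm \<xi>)\<bar> * (\<omega> (x + \<epsilon> *\<^sub>R \<xi>) * \<bar>(u (x + \<epsilon> *\<^sub>R \<xi>) - u x) \<bullet> sgn \<xi>\<bar>)"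
    using \<omega>_nonneg by (simp add: abs_mult)
  also have "\<dots> \<le> M * (\<omega> (x + \<epsilon> *\<^sub>R \<xi>) * (norm (u (x + \<epsilon> *\<^sub>R \<xi>)) + norm (u x)))"
    using M_nonneg \<omega>_nonneg abs_J_le[OF assms]
    by (intro mult_mono order_trans[OF norm_inner_sgn_le norm_triangle_ineq4])
       (auto intro!: mult_nonneg_nonneg add_nonneg_nonneg)
  finally show ?thesis .
qed

lemma strain_le_ball_sum:
  assumes [measurable]: "u \<in> borel_measurable borel" and "x \<in> D"
  shows "ennreal \<bar>\<theta> u x\<bar> \<le> ennreal (M / unit_vol TYPE('n)) * ball_sum (modulus u) x"
proof -
  have "ennreal \<bar>LBINT \<xi>:ball 0 1. \<omega> (x + \<epsilon> *\<^sub>R \<xi>) * J (norm \<xi>) * ((u (x + \<epsilon> *\<^sub>R \<xi>) - u x) \<bullet> sgn \<xi>)\<bar>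
      \<le> (\<integral>\<^sup>+\<xi>. indicator (ball 0 1) \<xi> * (ennreal M * (modulus u (x + \<epsilon> *\<^sub>R \<xi>) + modulus u x)) \<partial>lborel)"
    unfolding real_norm_def[symmetric]
  proof (rule ennreal_norm_set_integral_le)
    fix \<xi> :: "real^'n" assume "\<xi> \<in> ball 0 1"
    then have "norm \<xi> < 1" by simp
    let ?y = "x + \<epsilon> *\<^sub>R \<xi>"
    have "ennreal (norm (\<omega> ?y * J (norm \<xi>) * ((u ?y - u x) \<bullet> sgn \<xi>)))
        \<le> ennreal (M * (\<omega> ?y * (norm (u ?y) + norm (u x))))"
      using strain_integrand_le[OF \<open>norm \<xi> < 1\<close>] by (intro ennreal_leI) simp
    also have "\<dots> = ennreal M * (ennreal (\<omega> ?y * norm (u ?y)) + ennreal (\<omega> ?y * norm (u x)))"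
      using M_nonneg \<omega>_nonneg by (simp add: ennreal_mult distrib_left mult_nonneg_nonneg)
    also have "\<dots> \<le> ennreal M * (modulus u ?y + modulus u x)"
      using assms \<omega>_le_1[of ?y] \<omega>_nonneg[of ?y]
      by (intro mult_left_mono add_mono \<omega>_mult_norm_le_modulus)
         (auto simp: modulus_def intro!: ennreal_leI mult_left_le_one_le)
    finally show "ennreal (norm (\<omega> ?y * J (norm \<xi>) * ((u ?y - u x) \<bullet> sgn \<xi>)))
        \<le> ennreal M * (modulus u ?y + modulus u x)" .
  qed
  also have "\<dots> = (\<integral>\<^sup>+\<xi>. ennreal M * (indicator (ball 0 1) \<xi> * (modulus u (x + \<epsilon> *\<^sub>R \<xi>) + modulus u x)) \<partial>lborel)"
    by (simp only: mult_ac)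
  also have "\<dots> = ennreal M * ball_sum (modulus u) x"
    unfolding ball_sum_def by (rule nn_integral_cmult) measurable
  finally have "ennreal (1 / unit_vol TYPE('n)) * ennreal \<bar>LBINT \<xi>:ball 0 1. \<omega> (x + \<epsilon> *\<^sub>R \<xi>) * J (norm \<xi>) * ((u (x + \<epsilon> *\<^sub>R \<xi>) - u x) \<bullet> sgn \<xi>)\<bar>
      \<le> ennreal (1 / unit_vol TYPE('n)) * (ennreal M * ball_sum (modulus u) x)"
    by (rule mult_left_mono) simp
  also have "\<dots> = ennreal (M / unit_vol TYPE('n)) * ball_sum (modulus u) x"
    using M_nonneg vol_pos by (simp flip: mult.assoc ennreal_mult)
  also have "ennreal (1 / unit_vol TYPE('n)) * ennreal \<bar>LBINT \<xi>:ball 0 1. \<omega> (x + \<epsilon> *\<^sub>R \<xi>) * J (norm \<xi>) * ((u (x + \<epsilon> *\<^sub>R \<xi>) - u x) \<bullet> sgn \<xi>)\<bar>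
      = ennreal \<bar>\<theta> u x\<bar>"
    using vol_pos by (simp add: hydro_strain_def abs_mult flip: ennreal_mult)
  finally show ?thesis .
qed

lemma strain_measurable [measurable]:
  assumes [measurable]: "u \<in> borel_measurable borel"
  shows "\<theta> u \<in> borel_measurable borel"
  unfolding hydro_strain_def set_lebesgue_integral_def by measurable

lemma strain_integrable:
  assumes "bounded_field u"
  shows "set_integrable lborel (ball 0 1)
     (\<lambda>\<xi>. \<omega> (x + \<epsilon> *\<^sub>R \<xi>) * J (norm \<xi>) * ((u (x + \<epsilon> *\<^sub>R \<xi>) - u x) \<bullet> sgn \<xi>))"
proof -
  obtain B where B: "0 \<le> B" "\<And>x. norm (u x) \<le> B"
    using bounded_fieldE[OF assms] by metis
  have [measurable]: "u \<in> borel_measurable borel"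
    using assms by (rule bounded_field_measurable)
  show ?thesis
  proof (rule set_integrable_unit_ball[where B = "M * (1 * (B + B))"])
    fix \<xi> :: "real^'n" assume "norm \<xi> < 1"
    then have "\<bar>\<omega> (x + \<epsilon> *\<^sub>R \<xi>) * J (norm \<xi>) * ((u (x + \<epsilon> *\<^sub>R \<xi>) - u x) \<bullet> sgn \<xi>)\<bar>
        \<le> M * (\<omega> (x + \<epsilon> *\<^sub>R \<xi>) * (norm (u (x + \<epsilon> *\<^sub>R \<xi>)) + norm (u x)))"
      by (rule strain_integrand_le)
    also have "\<dots> \<le> M * (1 * (B + B))"
      by (intro mult_left_mono mult_mono add_mono B \<omega>_le_1 M_nonneg) auto
    finally show "norm (\<omega> (x + \<epsilon> *\<^sub>R \<xi>) * J (norm \<xi>) * ((u (x + \<epsilon> *\<^sub>R \<xi>) - u x) \<bullet> sgn \<xi>)) \<le> M * (1 * (B + B))"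
      by simp
  qed measurable
qed

lemma strain_diff:
  assumes "bounded_field u" "bounded_field v"
  shows "\<theta> (\<lambda>x. u x - v x) x = \<theta> u x - \<theta> v x"
  unfolding hydro_strain_def right_diff_distrib[symmetric]
  by (subst set_integral_diff(2)[OF strain_integrable[OF assms(1)] strain_integrable[OF assms(2)], symmetric])
     (simp add: algebra_simps inner_diff_left)

lemma strain_bounded:
  assumes "bounded_field u"
  obtains B where "0 \<le> B" "\<And>x. x \<in> D \<Longrightarrow> \<bar>\<theta> u x\<bar> \<le> B"
proof -
  obtain B where B: "0 \<le> B" "\<And>x. norm (u x) \<le> B"
    using bounded_fieldE[OF assms] by metis
  have "\<bar>\<theta> u x\<bar> \<le> M / unit_vol TYPE('n) * (2 * B * unit_vol TYPE('n))" if "x \<in> D" for x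
  proof -
    have "ball_sum (modulus u) x \<le> (\<integral>\<^sup>+(\<xi>::real^'n). ennreal (2 * B) * indicator (ball 0 1) \<xi> \<partial>lborel)"
      unfolding ball_sum_def
    proof (rule nn_integral_mono)
      fix \<xi> :: "real^'n"
      have "modulus u y \<le> ennreal B" for y
        using B by (auto simp: modulus_def indicator_def intro!: ennreal_leI)
      then have "modulus u (x + \<epsilon> *\<^sub>R \<xi>) + modulus u x \<le> ennreal B + ennreal B"
        by (intro add_mono)
      also have "\<dots> = ennreal (2 * B)"
        using B(1) by (subst ennreal_plus[symmetric]) auto
      finally show "indicator (ball 0 1) \<xi> * (modulus u (x + \<epsilon> *\<^sub>R \<xi>) + modulus u x) \<le> ennreal (2 * B) * indicator (ball 0 1) \<xi>"
        by (simp add: indicator_def)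
    qed
    also have "\<dots> = ennreal (2 * B * unit_vol TYPE('n))"
      using B(1) vol_pos by (simp add: nn_integral_cmult_indicator emeasure_unit_ball flip: ennreal_mult)
    finally have "ennreal \<bar>\<theta> u x\<bar> \<le> ennreal (M / unit_vol TYPE('n)) * ennreal (2 * B * unit_vol TYPE('n))"
      using strain_le_ball_sum[OF bounded_field_measurable[OF assms] that] by (meson mult_left_mono order_trans zero_le)
    also have "\<dots> = ennreal (M / unit_vol TYPE('n) * (2 * B * unit_vol TYPE('n)))"
      using B(1) vol_pos M_nonneg by (intro ennreal_mult[symmetric]) auto
    finally show ?thesis
      using B(1) vol_pos M_nonneg by (subst (asm) ennreal_le_iff) auto
  qed
  moreover have "0 \<le> M / unit_vol TYPE('n) * (2 * B * unit_vol TYPE('n))"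
    using B(1) vol_pos M_nonneg by simp
  ultimately show ?thesis using that by blast
qed

lemma ball_sum_L2_le:
  assumes [measurable]: "\<phi> \<in> borel_measurable borel" "\<psi> \<in> borel_measurable borel"
    and A: "(\<integral>\<^sup>+x. \<phi> x ^ 2 \<partial>lborel) \<le> ennreal (A\<^sup>2)" "0 \<le> A"
    and B: "(\<integral>\<^sup>+x. \<psi> x ^ 2 \<partial>lborel) \<le> ennreal (B\<^sup>2)" "0 \<le> B"
  shows "(\<integral>\<^sup>+x. ball_sum \<phi> x * \<psi> x \<partial>lborel) \<le> ennreal (2 * unit_vol TYPE('n) * A * B)"
  unfolding ball_sum_def
  using vol_pos by (intro nn_integral_difference_kernel_le A B assms) (auto simp: emeasure_unit_ball)

text \<open>Testing the strain against \<^term>\<open>\<psi>\<close> yields both its $L^1$ bound, for the indicator of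
  \<^term>\<open>D\<close>, and its $L^2$ bound, for the strain itself.\<close>

lemma nn_integral_modulus_strain_le:
  assumes u: "bounded_field u"
    and A: "(\<integral>\<^sup>+x. modulus u x ^ 2 \<partial>lborel) \<le> ennreal (A\<^sup>2)" "0 \<le> A"
    and [measurable]: "\<psi> \<in> borel_measurable borel"
    and B: "(\<integral>\<^sup>+x. \<psi> x ^ 2 \<partial>lborel) \<le> ennreal (B\<^sup>2)" "0 \<le> B"
  shows "(\<integral>\<^sup>+x. modulus (\<theta> u) x * \<psi> x \<partial>lborel) \<le> ennreal (2 * M * A * B)"
proof -
  have [measurable]: "u \<in> borel_measurable borel"
    using u by (rule bounded_field_measurable)
  have "(\<integral>\<^sup>+x. modulus (\<theta> u) x * \<psi> x \<partial>lborel)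
      \<le> (\<integral>\<^sup>+x. ennreal (M / unit_vol TYPE('n)) * (ball_sum (modulus u) x * \<psi> x) \<partial>lborel)"
    using strain_le_ball_sum[of u]
    by (intro nn_integral_mono)
       (auto simp: modulus_def[of "\<theta> u"] indicator_def mult.assoc[symmetric] intro!: mult_right_mono)
  also have "\<dots> = ennreal (M / unit_vol TYPE('n)) * (\<integral>\<^sup>+x. ball_sum (modulus u) x * \<psi> x \<partial>lborel)"
    by (rule nn_integral_cmult) measurable
  also have "\<dots> \<le> ennreal (M / unit_vol TYPE('n)) * ennreal (2 * unit_vol TYPE('n) * A * B)"
    by (intro mult_left_mono ball_sum_L2_le A B) measurable
  also have "\<dots> = ennreal (2 * M * A * B)"
    using M_nonneg vol_pos A(2) B(2) by (simp flip: ennreal_mult)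
  finally show ?thesis .
qed

section \<open>Bounds for the force\<close>

text \<open>The bond force and the bond energy scale like $\epsilon^{-3/2}$, which is weaker than the order
  $\epsilon^{-2}$ of the dilatational part.\<close>

lemma inverse_eps_powr_le: "1 / (\<epsilon> * sqrt \<epsilon>) \<le> 1 / \<epsilon>\<^sup>2"
proof -
  have "\<epsilon> * \<epsilon> \<le> 1 * \<epsilon>"
    using \<epsilon>_pos \<epsilon>_less_1 by (intro mult_right_mono) auto
  then have "sqrt (\<epsilon> * \<epsilon>) \<le> sqrt \<epsilon>" by (intro real_sqrt_le_mono) simp
  then have "\<epsilon> \<le> sqrt \<epsilon>" using \<epsilon>_pos by simp
  then show ?thesis
    using \<epsilon>_pos by (intro divide_left_mono) (auto simp: power2_eq_square)
qed

lemma norm_force_T_le: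
  assumes f': "\<And>r. \<bar>deriv f r\<bar> \<le> C"
  shows "norm (force_T \<epsilon> J \<omega> f u x)
    \<le> 2 * M * C * inverse_sqrt_mass TYPE('n) / unit_vol TYPE('n) / \<epsilon>\<^sup>2"
proof -
  have C: "0 \<le> C" using f'[of 0] by simp
  let ?G = "\<lambda>\<xi>. (\<omega> x * \<omega> (x + \<epsilon> *\<^sub>R \<xi>) * (J (norm \<xi>) / sqrt (\<epsilon> * norm \<xi>)) *
         deriv f (((u (x + \<epsilon> *\<^sub>R \<xi>) - u x) \<bullet> sgn \<xi>) / sqrt (\<epsilon> * norm \<xi>))) *\<^sub>R sgn \<xi>"
  have "ennreal (norm (LBINT \<xi>:ball 0 1. ?G \<xi>))
      \<le> (\<integral>\<^sup>+(\<xi>::real^'n). indicator (ball 0 1) \<xi> * (ennreal (M * C / sqrt \<epsilon>) * ennreal (1 / sqrt (norm \<xi>))) \<partial>lborel)"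
  proof (rule ennreal_norm_set_integral_le)
    fix \<xi> :: "real^'n" assume "\<xi> \<in> ball 0 1"
    then have \<xi>: "norm \<xi> < 1" by simp
    have "norm (?G \<xi>) \<le> \<bar>\<omega> x * \<omega> (x + \<epsilon> *\<^sub>R \<xi>) * (J (norm \<xi>) / sqrt (\<epsilon> * norm \<xi>)) *
         deriv f (((u (x + \<epsilon> *\<^sub>R \<xi>) - u x) \<bullet> sgn \<xi>) / sqrt (\<epsilon> * norm \<xi>))\<bar> * 1"
      unfolding norm_scaleR by (intro mult_left_mono) (auto simp: norm_sgn)
    also have "\<dots> = (\<omega> x * \<omega> (x + \<epsilon> *\<^sub>R \<xi>)) * (\<bar>J (norm \<xi>)\<bar> / sqrt (\<epsilon> * norm \<xi>)) *
         \<bar>deriv f (((u (x + \<epsilon> *\<^sub>R \<xi>) - u x) \<bullet> sgn \<xi>) / sqrt (\<epsilon> * norm \<xi>))\<bar>"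
      using \<epsilon>_pos \<omega>_nonneg by (simp add: abs_mult)
    also have "\<dots> \<le> (1 * 1) * (M / sqrt (\<epsilon> * norm \<xi>)) * C"
      using \<epsilon>_pos \<omega>_nonneg \<omega>_le_1 M_nonneg f' abs_J_le[OF \<xi>]
      by (intro mult_mono divide_right_mono) auto
    also have "\<dots> = (M * C / sqrt \<epsilon>) * (1 / sqrt (norm \<xi>))"
      by (simp add: real_sqrt_mult)
    finally have "ennreal (norm (?G \<xi>)) \<le> ennreal ((M * C / sqrt \<epsilon>) * (1 / sqrt (norm \<xi>)))"
      by (rule ennreal_leI)
    also have "\<dots> = ennreal (M * C / sqrt \<epsilon>) * ennreal (1 / sqrt (norm \<xi>))"
      using M_nonneg C \<epsilon>_pos by (intro ennreal_mult) auto
    finally show "ennreal (norm (?G \<xi>)) \<le> ennreal (M * C / sqrt \<epsilon>) * ennreal (1 / sqrt (norm \<xi>))" .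
  qed
  also have "\<dots> = (\<integral>\<^sup>+(\<xi>::real^'n). ennreal (M * C / sqrt \<epsilon>) * (indicator (ball 0 1) \<xi> * ennreal (1 / sqrt (norm \<xi>))) \<partial>lborel)"
    by (simp only: mult_ac)
  also have "\<dots> = ennreal (M * C / sqrt \<epsilon>) * ennreal (inverse_sqrt_mass TYPE('n))"
    by (subst nn_integral_cmult) (measurable, simp only: nn_integral_inverse_sqrt_mass)
  also have "\<dots> = ennreal (M * C / sqrt \<epsilon> * inverse_sqrt_mass TYPE('n))"
    using M_nonneg C \<epsilon>_pos inverse_sqrt_mass_nonneg[where 'n = 'n] by (intro ennreal_mult[symmetric]) auto
  finally have I: "norm (LBINT \<xi>:ball 0 1. ?G \<xi>) \<le> M * C / sqrt \<epsilon> * inverse_sqrt_mass TYPE('n)"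
    using M_nonneg C \<epsilon>_pos inverse_sqrt_mass_nonneg[where 'n = 'n] by (subst (asm) ennreal_le_iff) auto
  have "norm (force_T \<epsilon> J \<omega> f u x) = 2 / (\<epsilon> * unit_vol TYPE('n)) * norm (LBINT \<xi>:ball 0 1. ?G \<xi>)"
    using \<epsilon>_pos vol_pos by (simp add: force_T_def)
  also have "\<dots> \<le> 2 / (\<epsilon> * unit_vol TYPE('n)) * (M * C / sqrt \<epsilon> * inverse_sqrt_mass TYPE('n))"
    using \<epsilon>_pos vol_pos by (intro mult_left_mono I) auto
  also have "\<dots> = 2 * M * C * inverse_sqrt_mass TYPE('n) / unit_vol TYPE('n) * (1 / (\<epsilon> * sqrt \<epsilon>))"
    by (simp add: mult_ac)
  also have "\<dots> \<le> 2 * M * C * inverse_sqrt_mass TYPE('n) / unit_vol TYPE('n) * (1 / \<epsilon>\<^sup>2)"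
    using M_nonneg C vol_pos inverse_sqrt_mass_nonneg[where 'n = 'n]
    by (intro mult_left_mono inverse_eps_powr_le) auto
  finally show ?thesis by simp
qed

lemma norm_force_D_integrand_le:
  assumes "norm (\<xi> :: real^'n) < 1"
  shows "norm ((\<omega> x * \<omega> y * J (norm \<xi>) * (a + b)) *\<^sub>R sgn \<xi>)
    \<le> M * (\<omega> y * (\<bar>a\<bar> + \<bar>b\<bar>))"
proof -
  have "norm ((\<omega> x * \<omega> y * J (norm \<xi>) * (a + b)) *\<^sub>R sgn \<xi>)
      \<le> \<bar>\<omega> x * \<omega> y * J (norm \<xi>) * (a + b)\<bar> * 1"
    unfolding norm_scaleR by (intro mult_left_mono) (auto simp: norm_sgn)
  also have "\<dots> = (\<omega> x * \<bar>J (norm \<xi>)\<bar>) * (\<omega> y * \<bar>a + b\<bar>)"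
    using \<omega>_nonneg by (simp add: abs_mult)
  also have "\<dots> \<le> (1 * M) * (\<omega> y * (\<bar>a\<bar> + \<bar>b\<bar>))"
    using \<omega>_nonneg \<omega>_le_1 M_nonneg abs_J_le[OF assms] by (intro mult_mono) auto
  finally show ?thesis by simp
qed

lemma norm_force_D_le:
  assumes g': "\<And>r. \<bar>deriv g r\<bar> \<le> C"
  shows "norm (force_D \<epsilon> J \<omega> g u x) \<le> 2 * M * C / \<epsilon>\<^sup>2"
proof -
  have C: "0 \<le> C" using g'[of 0] by simp
  let ?G = "\<lambda>\<xi>. (\<omega> x * \<omega> (x + \<epsilon> *\<^sub>R \<xi>) * J (norm \<xi>) *
         (deriv g (\<theta> u (x + \<epsilon> *\<^sub>R \<xi>)) + deriv g (\<theta> u x))) *\<^sub>R sgn \<xi>"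
  have "ennreal (norm (LBINT \<xi>:ball 0 1. ?G \<xi>))
      \<le> (\<integral>\<^sup>+(\<xi>::real^'n). indicator (ball 0 1) \<xi> * ennreal (M * (1 * (C + C))) \<partial>lborel)"
  proof (rule ennreal_norm_set_integral_le, rule ennreal_leI)
    fix \<xi> :: "real^'n" assume "\<xi> \<in> ball 0 1"
    then have "norm \<xi> < 1" by simp
    then have "norm (?G \<xi>) \<le> M * (\<omega> (x + \<epsilon> *\<^sub>R \<xi>) *
        (\<bar>deriv g (\<theta> u (x + \<epsilon> *\<^sub>R \<xi>))\<bar> + \<bar>deriv g (\<theta> u x)\<bar>))"
      by (rule norm_force_D_integrand_le)
    also have "\<dots> \<le> M * (1 * (C + C))"
      using \<omega>_le_1 M_nonneg C by (intro mult_left_mono mult_mono add_mono g') auto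
    finally show "norm (?G \<xi>) \<le> M * (1 * (C + C))" .
  qed
  also have "\<dots> = ennreal (2 * M * C * unit_vol TYPE('n))"
    using M_nonneg C vol_pos
    by (subst nn_integral_multc) (auto simp: emeasure_unit_ball mult_ac simp flip: ennreal_mult)
  finally have I: "norm (LBINT \<xi>:ball 0 1. ?G \<xi>) \<le> 2 * M * C * unit_vol TYPE('n)"
    using M_nonneg C vol_pos by (subst (asm) ennreal_le_iff) auto
  have "norm (force_D \<epsilon> J \<omega> g u x) = 1 / (\<epsilon>\<^sup>2 * unit_vol TYPE('n)) * norm (LBINT \<xi>:ball 0 1. ?G \<xi>)"
    using \<epsilon>_pos vol_pos by (simp add: force_D_def)
  also have "\<dots> \<le> 1 / (\<epsilon>\<^sup>2 * unit_vol TYPE('n)) * (2 * M * C * unit_vol TYPE('n))"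
    using \<epsilon>_pos vol_pos by (intro mult_left_mono I) auto
  finally show ?thesis using vol_pos by simp
qed

text \<open>Without a bound on \<^term>\<open>deriv g\<close> the force can only be estimated by local averages of the
  displacement.\<close>

lemma norm_force_D_quadratic_le:
  assumes g': "\<And>r. deriv g r = \<beta> * r" and \<beta>: "0 \<le> \<beta>"
    and [measurable]: "u \<in> borel_measurable borel" and x: "x \<in> D"
  shows "ennreal (norm (force_D \<epsilon> J \<omega> g u x))
    \<le> ennreal (\<beta> * M\<^sup>2 / \<epsilon>\<^sup>2) * (ennreal (3 / unit_vol TYPE('n)) * ball_integral 2 (modulus u) x + modulus u x)"
proof -
  define v where "v = unit_vol TYPE('n)"
  have v: "0 < v" by (simp add: v_def vol_pos)
  let ?G = "\<lambda>\<xi>. (\<omega> x * \<omega> (x + \<epsilon> *\<^sub>R \<xi>) * J (norm \<xi>) *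
         (deriv g (\<theta> u (x + \<epsilon> *\<^sub>R \<xi>)) + deriv g (\<theta> u x))) *\<^sub>R sgn \<xi>"
  have "ennreal (norm (LBINT \<xi>:ball 0 1. ?G \<xi>))
      \<le> (\<integral>\<^sup>+\<xi>. indicator (ball 0 1) \<xi> *
            (ennreal (M * \<beta>) * (modulus (\<theta> u) (x + \<epsilon> *\<^sub>R \<xi>) + modulus (\<theta> u) x)) \<partial>lborel)"
  proof (rule ennreal_norm_set_integral_le)
    fix \<xi> :: "real^'n" assume "\<xi> \<in> ball 0 1"
    then have \<xi>: "norm \<xi> < 1" by simp
    let ?y = "x + \<epsilon> *\<^sub>R \<xi>"
    have "ennreal (norm (?G \<xi>)) \<le> ennreal (M * (\<omega> ?y * (\<bar>deriv g (\<theta> u ?y)\<bar> + \<bar>deriv g (\<theta> u x)\<bar>)))"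
      by (intro ennreal_leI norm_force_D_integrand_le \<xi>)
    also have "\<dots> = ennreal ((M * \<beta>) * (\<omega> ?y * norm (\<theta> u ?y) + \<omega> ?y * norm (\<theta> u x)))"
      using \<beta> by (simp add: g' abs_mult algebra_simps)
    also have "\<dots> = ennreal (M * \<beta>) * (ennreal (\<omega> ?y * norm (\<theta> u ?y)) + ennreal (\<omega> ?y * norm (\<theta> u x)))"
      using \<beta> M_nonneg \<omega>_nonneg by (simp add: ennreal_mult mult_nonneg_nonneg)
    also have "\<dots> \<le> ennreal (M * \<beta>) * (modulus (\<theta> u) ?y + modulus (\<theta> u) x)"
      using x \<omega>_le_1[of ?y] \<omega>_nonneg[of ?y]
      by (intro mult_left_mono add_mono \<omega>_mult_norm_le_modulus)
         (auto simp: modulus_def intro!: ennreal_leI mult_left_le_one_le)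
    finally show "ennreal (norm (?G \<xi>)) \<le> ennreal (M * \<beta>) * (modulus (\<theta> u) ?y + modulus (\<theta> u) x)" .
  qed
  also have "\<dots> = (\<integral>\<^sup>+\<xi>. ennreal (M * \<beta>) *
        (indicator (ball 0 1) \<xi> * (modulus (\<theta> u) (x + \<epsilon> *\<^sub>R \<xi>) + modulus (\<theta> u) x)) \<partial>lborel)"
    by (simp only: mult_ac)
  also have "\<dots> = ennreal (M * \<beta>) * ball_sum (modulus (\<theta> u)) x"
    unfolding ball_sum_def by (rule nn_integral_cmult) measurable
  also have "\<dots> \<le> ennreal (M * \<beta>) * ball_sum (\<lambda>y. ennreal (M / v) * ball_sum (modulus u) y) x"
  proof (intro mult_left_mono ball_sum_mono)
    fix y show "modulus (\<theta> u) y \<le> ennreal (M / v) * ball_sum (modulus u) y"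
      using strain_le_ball_sum[of u y] by (auto simp: modulus_def[of "\<theta> u"] indicator_def v_def)
  qed simp
  also have "\<dots> = ennreal (M * \<beta>) * (ennreal (M / v) * ball_sum (ball_sum (modulus u)) x)"
    by (subst ball_sum_cmult) auto
  also have "\<dots> \<le> ennreal (M * \<beta>) * (ennreal (M / v) *
      (ennreal v * (3 * ball_integral 2 (modulus u) x + ennreal v * modulus u x)))"
    unfolding v_def by (intro mult_left_mono ball_sum_twice_le) auto
  finally have I: "ennreal (norm (LBINT \<xi>:ball 0 1. ?G \<xi>)) \<le> ennreal (M * \<beta>) * (ennreal (M / v) *
      (ennreal v * (3 * ball_integral 2 (modulus u) x + ennreal v * modulus u x)))" .
  have collect: "ennreal a * (ennreal b * (ennreal c * (ennreal d * t))) = ennreal (a * b * c * d) * t"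
    if "0 \<le> a" "0 \<le> b" "0 \<le> c" "0 \<le> d" for a b c d t
    using that by (simp add: ennreal_mult mult.assoc)
  have spread: "ennreal (a * b) * (ennreal p * s + ennreal q * t)
      = ennreal a * (ennreal b * ennreal p * s + ennreal b * ennreal q * t)"
    if "0 \<le> a" "0 \<le> b" for a b p q s t
    using that by (simp add: ennreal_mult distrib_left mult.assoc)
  have "ennreal (norm (force_D \<epsilon> J \<omega> g u x)) = ennreal (1 / (\<epsilon>\<^sup>2 * v)) * ennreal (norm (LBINT \<xi>:ball 0 1. ?G \<xi>))"
    using \<epsilon>_pos v by (simp add: force_D_def v_def flip: ennreal_mult)
  also have "\<dots> \<le> ennreal (1 / (\<epsilon>\<^sup>2 * v)) * (ennreal (M * \<beta>) * (ennreal (M / v) *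
      (ennreal v * (3 * ball_integral 2 (modulus u) x + ennreal v * modulus u x))))"
    by (intro mult_left_mono I) simp
  also have "\<dots> = ennreal (1 / (\<epsilon>\<^sup>2 * v) * (M * \<beta>) * (M / v) * v) * (ennreal 3 * ball_integral 2 (modulus u) x + ennreal v * modulus u x)"
    using \<epsilon>_pos v \<beta> M_nonneg by (subst collect) auto
  also have "1 / (\<epsilon>\<^sup>2 * v) * (M * \<beta>) * (M / v) * v = \<beta> * M\<^sup>2 / \<epsilon>\<^sup>2 * (1 / v)"
    using v by (simp add: power2_eq_square)
  also have "ennreal (\<beta> * M\<^sup>2 / \<epsilon>\<^sup>2 * (1 / v)) * (ennreal 3 * ball_integral 2 (modulus u) x + ennreal v * modulus u x)
      = ennreal (\<beta> * M\<^sup>2 / \<epsilon>\<^sup>2) * (ennreal (1 / v) * ennreal 3 * ball_integral 2 (modulus u) x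
          + ennreal (1 / v) * ennreal v * modulus u x)"
    by (rule spread) (use v \<beta> in auto)
  also have "ennreal (1 / v) * ennreal 3 = ennreal (3 / v)"
    using v by (subst ennreal_mult[symmetric]) auto
  also have "ennreal (1 / v) * ennreal v = 1"
    using v by (simp flip: ennreal_mult)
  finally show ?thesis by (simp add: v_def)
qed

section \<open>The potential energy as a Lipschitz function of the displacement\<close>

text \<open>The bond part of the energy density in the scaled variable $\xi = (y-x)/\epsilon$, in which the prefactor
  $\epsilon^{-d}$ disappears.\<close>

definition bond_integrand :: "(real \<Rightarrow> real) \<Rightarrow> (real^'n \<Rightarrow> real^'n) \<Rightarrow> real^'n \<Rightarrow> real^'n \<Rightarrow> real" where
  "bond_integrand f u x \<xi> = \<omega> x * \<omega> (x + \<epsilon> *\<^sub>R \<xi>) * J (norm \<xi>) / \<epsilon> *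
     f (((u (x + \<epsilon> *\<^sub>R \<xi>) - u x) \<bullet> sgn \<xi>) / sqrt (\<epsilon> * norm \<xi>))"

definition bond_energy :: "(real \<Rightarrow> real) \<Rightarrow> (real^'n \<Rightarrow> real^'n) \<Rightarrow> real" where
  "bond_energy f u = 1 / unit_vol TYPE('n) * (LBINT x:D. (LBINT \<xi>:ball 0 1. bond_integrand f u x \<xi>))"

definition dilation_energy :: "(real \<Rightarrow> real) \<Rightarrow> (real^'n \<Rightarrow> real^'n) \<Rightarrow> real" where
  "dilation_energy g u = (LBINT x:D. \<omega> x * (g (\<theta> u x) / \<epsilon>\<^sup>2))"

lemma potential_energy_eq:
  assumes f0: "f 0 = 0" and [measurable]: "f \<in> borel_measurable borel" "u \<in> borel_measurable borel"
  shows "potential_energy D \<epsilon> J \<omega> f g u = bond_energy f u + dilation_energy g u"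
proof -
  have inner: "(LBINT y:ball x \<epsilon>. norm (y - x) * tensile_energy_density \<epsilon> J \<omega> f u y x)
      = \<epsilon> ^ CARD('n) * (LBINT \<xi>:ball 0 1. bond_integrand f u x \<xi>)" for x
  proof -
    have [measurable]: "(\<lambda>y. J (norm (y - x) / \<epsilon>)) \<in> borel_measurable borel"
    proof -
      have "(\<lambda>y. J (norm ((1 / \<epsilon>) *\<^sub>R (y - x)))) \<in> borel_measurable borel"
        by measurable
      then show ?thesis using \<epsilon>_pos by simp
    qed
    have meas: "(\<lambda>y. norm (y - x) * tensile_energy_density \<epsilon> J \<omega> f u y x) \<in> borel_measurable borel"
      unfolding tensile_energy_density_def tensile_strain_def by measurable
    have pt: "norm (x + \<epsilon> *\<^sub>R \<xi> - x) * tensile_energy_density \<epsilon> J \<omega> f u (x + \<epsilon> *\<^sub>R \<xi>) x = bond_integrand f u x \<xi>" for \<xi>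
    proof (cases "\<xi> = 0")
      \<comment> \<open>At the centre of the ball both sides vanish: division by zero gives zero, and so does the
        potential at the origin.\<close>
      case True
      then show ?thesis by (simp add: bond_integrand_def f0)
    next
      case False
      define r where "r = \<epsilon> * norm \<xi>"
      have r: "0 < r" using False \<epsilon>_pos by (simp add: r_def)
      have "sqrt r * tensile_strain (x + \<epsilon> *\<^sub>R \<xi>) x u = ((u (x + \<epsilon> *\<^sub>R \<xi>) - u x) \<bullet> sgn \<xi>) / sqrt r"
      proof -
        have "(1 / r) *\<^sub>R (\<epsilon> *\<^sub>R \<xi>) = sgn \<xi>"
          using False \<epsilon>_pos by (simp add: r_def sgn_div_norm divide_inverse)
        then have "tensile_strain (x + \<epsilon> *\<^sub>R \<xi>) x u = ((u (x + \<epsilon> *\<^sub>R \<xi>) - u x) \<bullet> sgn \<xi>) / r"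
          using \<epsilon>_pos by (simp add: tensile_strain_def r_def)
        also have "\<dots> = ((u (x + \<epsilon> *\<^sub>R \<xi>) - u x) \<bullet> sgn \<xi>) / (sqrt r * sqrt r)"
          using r by simp
        finally have ts: "tensile_strain (x + \<epsilon> *\<^sub>R \<xi>) x u = ((u (x + \<epsilon> *\<^sub>R \<xi>) - u x) \<bullet> sgn \<xi>) / (sqrt r * sqrt r)" .
        have cancel: "s * (X / (s * s)) = X / s" if "s \<noteq> 0" for s X :: real
          using that by simp
        show ?thesis unfolding ts by (rule cancel) (use r in simp)
      qed
      then show ?thesis
        using r \<epsilon>_pos False
        by (simp add: tensile_energy_density_def bond_integrand_def r_def)
    qed
    have "(LBINT y:ball x \<epsilon>. norm (y - x) * tensile_energy_density \<epsilon> J \<omega> f u y x)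
        = \<epsilon> ^ CARD('n) * (LBINT \<xi>:ball 0 1. norm (x + \<epsilon> *\<^sub>R \<xi> - x) * tensile_energy_density \<epsilon> J \<omega> f u (x + \<epsilon> *\<^sub>R \<xi>) x)"
      using set_integral_ball_rescale[OF \<epsilon>_pos meas, of x] by simp
    then show ?thesis by (simp only: pt)
  qed
  show ?thesis
    unfolding potential_energy_def bond_energy_def dilation_energy_def inner
    using \<epsilon>_pos by simp
qed

lemma bond_integrand_measurable:
  assumes [measurable]: "f \<in> borel_measurable borel" "u \<in> borel_measurable borel"
  shows "(\<lambda>(x, \<xi>). bond_integrand f u x \<xi>) \<in> borel_measurable (borel \<Otimes>\<^sub>M borel)"
  unfolding bond_integrand_def by measurable

lemma abs_bond_integrand_le:
  assumes "\<And>r. \<bar>f r\<bar> \<le> B" and "norm \<xi> < 1"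
  shows "\<bar>bond_integrand f u x \<xi>\<bar> \<le> M / \<epsilon> * B"
proof -
  have "\<bar>bond_integrand f u x \<xi>\<bar> = (\<omega> x * \<omega> (x + \<epsilon> *\<^sub>R \<xi>)) * \<bar>J (norm \<xi>)\<bar> / \<epsilon> *
     \<bar>f (((u (x + \<epsilon> *\<^sub>R \<xi>) - u x) \<bullet> sgn \<xi>) / sqrt (\<epsilon> * norm \<xi>))\<bar>"
    using \<omega>_nonneg \<epsilon>_pos by (simp add: bond_integrand_def abs_mult)
  also have "\<dots> \<le> (1 * 1) * M / \<epsilon> * B"
    using \<omega>_nonneg \<omega>_le_1 \<epsilon>_pos M_nonneg abs_J_le[OF assms(2)] assms(1)
    by (intro mult_mono divide_right_mono) auto
  finally show ?thesis by simp
qed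

lemma bond_integrand_nonneg:
  assumes "\<And>r. 0 \<le> f r" and "norm \<xi> < 1"
  shows "0 \<le> bond_integrand f u x \<xi>"
  using assms \<omega>_nonneg \<epsilon>_pos J_nonneg[of "norm \<xi>"] by (simp add: bond_integrand_def)

lemma set_integral_nonneg_real:
  fixes F :: "'a \<Rightarrow> real"
  assumes "\<And>x. x \<in> A \<Longrightarrow> 0 \<le> F x"
  shows "0 \<le> set_lebesgue_integral N A F"
  unfolding set_lebesgue_integral_def
  by (intro Bochner_Integration.integral_nonneg) (use assms in \<open>auto simp: indicator_def\<close>)

lemma bond_energy_nonneg:
  assumes "\<And>r. 0 \<le> f r"
  shows "0 \<le> bond_energy f u"
  unfolding bond_energy_def using vol_pos bond_integrand_nonneg[OF assms]
  by (intro mult_nonneg_nonneg set_integral_nonneg_real) auto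

lemma dilation_energy_nonneg:
  assumes "\<And>r. 0 \<le> g r"
  shows "0 \<le> dilation_energy g u"
  unfolding dilation_energy_def using \<omega>_nonneg assms
  by (intro set_integral_nonneg_real) auto

lemma indicator_D_L2: "(\<integral>\<^sup>+x. (indicator D x :: ennreal) ^ 2 \<partial>lborel) \<le> ennreal ((sqrt (measure lborel D))\<^sup>2)"
proof -
  have "(\<integral>\<^sup>+x. (indicator D x :: ennreal) ^ 2 \<partial>lborel) = (\<integral>\<^sup>+x. indicator D x \<partial>lborel)"
    by (intro nn_integral_cong) (auto simp: indicator_def)
  also have "\<dots> = emeasure lborel D"
    by (rule nn_integral_indicator) simp
  also have "\<dots> = ennreal ((sqrt (measure lborel D))\<^sup>2)"
    by (simp add: emeasure_D)
  finally show ?thesis by simp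
qed

text \<open>The argument of \<^term>\<open>f\<close> carries the factor $(\epsilon|\xi|)^{-1/2}$. The Lipschitz bound
  passes it on to the difference of the energies, where it is the integrable singularity.\<close>

lemma abs_bond_integrand_diff_le:
  assumes lip: "\<And>a b. \<bar>f a - f b\<bar> \<le> C * \<bar>a - b\<bar>" and C: "0 \<le> C" and \<xi>: "norm \<xi> < 1" and x: "x \<in> D"
  shows "ennreal \<bar>bond_integrand f u x \<xi> - bond_integrand f v x \<xi>\<bar>
    \<le> ennreal (M * C / \<epsilon>\<^sup>2) * (ennreal (1 / sqrt (norm \<xi>)) *
          (modulus (\<lambda>x. u x - v x) (x + \<epsilon> *\<^sub>R \<xi>) + modulus (\<lambda>x. u x - v x) x))"
proof -
  let ?y = "x + \<epsilon> *\<^sub>R \<xi>" and ?s = "sqrt (\<epsilon> * norm \<xi>)"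
  define p q where "p = norm (u ?y - v ?y)" and "q = norm (u x - v x)"
  define c where "c = M * C / \<epsilon>\<^sup>2 * (1 / sqrt (norm \<xi>))"
  have c0: "0 \<le> c" using M_nonneg C by (simp add: c_def)
  have "\<bar>((u ?y - u x) \<bullet> sgn \<xi>) / ?s - ((v ?y - v x) \<bullet> sgn \<xi>) / ?s\<bar>
      = \<bar>((u ?y - v ?y) - (u x - v x)) \<bullet> sgn \<xi>\<bar> / ?s"
    using \<epsilon>_pos by (simp add: diff_divide_distrib[symmetric] abs_divide inner_diff_left algebra_simps)
  also have "\<dots> \<le> (p + q) / ?s"
    unfolding p_def q_def using \<epsilon>_pos
    by (intro divide_right_mono order_trans[OF norm_inner_sgn_le norm_triangle_ineq4]) auto
  finally have arg: "\<bar>((u ?y - u x) \<bullet> sgn \<xi>) / ?s - ((v ?y - v x) \<bullet> sgn \<xi>) / ?s\<bar> \<le> (p + q) / ?s" .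
  have "\<bar>bond_integrand f u x \<xi> - bond_integrand f v x \<xi>\<bar>
      = \<omega> x * (\<omega> ?y * (\<bar>J (norm \<xi>)\<bar> / \<epsilon> * \<bar>f (((u ?y - u x) \<bullet> sgn \<xi>) / ?s) - f (((v ?y - v x) \<bullet> sgn \<xi>) / ?s)\<bar>))"
    using \<omega>_nonneg \<epsilon>_pos
    unfolding bond_integrand_def right_diff_distrib[symmetric] by (simp add: abs_mult)
  also have "\<dots> \<le> 1 * (\<omega> ?y * (M / \<epsilon> * (C * ((p + q) / ?s))))"
    using \<omega>_nonneg \<omega>_le_1 \<epsilon>_pos M_nonneg abs_J_le[OF \<xi>] C
    by (intro mult_mono divide_right_mono order_trans[OF lip mult_left_mono[OF arg]]) 
       (auto intro!: mult_nonneg_nonneg divide_nonneg_nonneg)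
  also have "\<dots> = M * C * (1 / (\<epsilon> * sqrt \<epsilon>)) * (1 / sqrt (norm \<xi>)) * (\<omega> ?y * p + \<omega> ?y * q)"
    by (simp add: real_sqrt_mult algebra_simps add_divide_distrib)
  also have "\<dots> \<le> M * C * (1 / \<epsilon>\<^sup>2) * (1 / sqrt (norm \<xi>)) * (\<omega> ?y * p + \<omega> ?y * q)"
    using M_nonneg C \<omega>_nonneg
    by (intro mult_left_mono mult_right_mono inverse_eps_powr_le add_nonneg_nonneg mult_nonneg_nonneg)
       (auto simp: p_def q_def)
  finally have "ennreal \<bar>bond_integrand f u x \<xi> - bond_integrand f v x \<xi>\<bar> \<le> ennreal (c * (\<omega> ?y * p + \<omega> ?y * q))"
    by (intro ennreal_leI) (simp add: c_def)
  also have "\<dots> = ennreal c * (ennreal (\<omega> ?y * p) + ennreal (\<omega> ?y * q))"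
    using c0 \<omega>_nonneg by (simp add: ennreal_mult mult_nonneg_nonneg p_def q_def)
  also have "\<dots> \<le> ennreal c * (modulus (\<lambda>x. u x - v x) ?y + modulus (\<lambda>x. u x - v x) x)"
    unfolding p_def q_def
    using x \<omega>_le_1[of ?y] \<omega>_nonneg[of ?y]
    by (intro mult_left_mono add_mono \<omega>_mult_norm_le_modulus)
       (auto simp: modulus_def intro!: ennreal_leI mult_left_le_one_le)
  also have "ennreal c = ennreal (M * C / \<epsilon>\<^sup>2) * ennreal (1 / sqrt (norm \<xi>))"
    unfolding c_def using M_nonneg C by (intro ennreal_mult) auto
  finally show ?thesis by (simp add: mult.assoc)
qed

text \<open>The pointwise difference bound is tested against the indicator of \<^term>\<open>D\<close>, whose $L^2$
  norm is the square root of the volume.\<close>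

lemma bond_energy_lipschitz:
  assumes lip: "\<And>a b. \<bar>f a - f b\<bar> \<le> C * \<bar>a - b\<bar>" and C: "0 \<le> C"
    and bdd: "\<And>r. \<bar>f r\<bar> \<le> B" and f_meas [measurable]: "f \<in> borel_measurable borel"
    and u: "bounded_field u" and v: "bounded_field v"
    and A: "(\<integral>\<^sup>+x. modulus (\<lambda>x. u x - v x) x ^ 2 \<partial>lborel) \<le> ennreal (A\<^sup>2)" "0 \<le> A"
  shows "\<bar>bond_energy f u - bond_energy f v\<bar>
    \<le> 2 * M * C * inverse_sqrt_mass TYPE('n) * sqrt (measure lborel D) / unit_vol TYPE('n) / \<epsilon>\<^sup>2 * A"
proof -
  define \<kappa> where "\<kappa> = inverse_sqrt_mass TYPE('n)"
  have \<kappa>: "0 \<le> \<kappa>" by (simp add: \<kappa>_def inverse_sqrt_mass_nonneg)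
  define d where "d = modulus (\<lambda>x. u x - v x)"
  define k where "k \<xi> = indicator (ball 0 1) \<xi> * ennreal (1 / sqrt (norm \<xi>))" for \<xi> :: "real^'n"
  have [measurable]: "u \<in> borel_measurable borel" "v \<in> borel_measurable borel"
    using u v by (auto intro: bounded_field_measurable)
  have d_meas [measurable]: "d \<in> borel_measurable borel" unfolding d_def by measurable
  have k_meas [measurable]: "k \<in> borel_measurable borel" unfolding k_def by measurable
  note bond_integrand_measurable [measurable]
  have B: "0 \<le> B" using bdd[of 0] by simp
  have int\<xi>: "set_integrable lborel (ball 0 1) (bond_integrand f z x)" if "bounded_field z" for z x
    using bounded_field_measurable[OF that] abs_bond_integrand_le[OF bdd]
    by (intro set_integrable_unit_ball[where B = "M / \<epsilon> * B"]) (auto simp: bond_integrand_def)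
  define I where "I z x = (LBINT \<xi>:ball 0 1. bond_integrand f z x \<xi>)" for z x
  have intx: "set_integrable lborel D (I z)" if z: "bounded_field z" for z
  proof (rule set_integrable_D[where B = "M / \<epsilon> * B * unit_vol TYPE('n)"])
    have [measurable]: "z \<in> borel_measurable borel" using z by (rule bounded_field_measurable)
    show "I z \<in> borel_measurable borel"
      unfolding I_def set_lebesgue_integral_def bond_integrand_def by measurable
    fix x
    have "ennreal (norm (I z x)) \<le> (\<integral>\<^sup>+(\<xi>::real^'n). indicator (ball 0 1) \<xi> * ennreal (M / \<epsilon> * B) \<partial>lborel)"
      unfolding I_def
      by (intro ennreal_norm_set_integral_le ennreal_leI) (use abs_bond_integrand_le[OF bdd] in auto)
    also have "\<dots> = ennreal (M / \<epsilon> * B * unit_vol TYPE('n))"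
      using M_nonneg B \<epsilon>_pos vol_pos
      by (subst nn_integral_multc) (auto simp: emeasure_unit_ball mult_ac simp flip: ennreal_mult)
    finally show "norm (I z x) \<le> M / \<epsilon> * B * unit_vol TYPE('n)"
      using M_nonneg B \<epsilon>_pos vol_pos by (subst (asm) ennreal_le_iff) auto
  qed
  have "ennreal \<bar>LBINT x:D. I u x - I v x\<bar>
      \<le> (\<integral>\<^sup>+x. indicator D x * (ennreal (M * C / \<epsilon>\<^sup>2) * (\<integral>\<^sup>+\<xi>. k \<xi> * (d (x + \<epsilon> *\<^sub>R \<xi>) + d x) \<partial>lborel)) \<partial>lborel)"
    unfolding real_norm_def[symmetric]
  proof (rule ennreal_norm_set_integral_le)
    fix x assume x: "x \<in> D"
    have "ennreal (norm (I u x - I v x)) = ennreal (norm (LBINT \<xi>:ball 0 1. bond_integrand f u x \<xi> - bond_integrand f v x \<xi>))"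
      unfolding I_def by (simp add: set_integral_diff(2)[OF int\<xi>[OF u] int\<xi>[OF v]])
    also have "\<dots> \<le> (\<integral>\<^sup>+\<xi>. indicator (ball 0 1) \<xi> * (ennreal (M * C / \<epsilon>\<^sup>2) * (ennreal (1 / sqrt (norm \<xi>)) *
          (d (x + \<epsilon> *\<^sub>R \<xi>) + d x))) \<partial>lborel)"
      unfolding d_def
      by (rule ennreal_norm_set_integral_le) (use abs_bond_integrand_diff_le[OF lip C _ x] in auto)
    also have "\<dots> = (\<integral>\<^sup>+\<xi>. ennreal (M * C / \<epsilon>\<^sup>2) * (k \<xi> * (d (x + \<epsilon> *\<^sub>R \<xi>) + d x)) \<partial>lborel)"
      unfolding k_def by (simp only: mult_ac)
    also have "\<dots> = ennreal (M * C / \<epsilon>\<^sup>2) * (\<integral>\<^sup>+\<xi>. k \<xi> * (d (x + \<epsilon> *\<^sub>R \<xi>) + d x) \<partial>lborel)"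
      by (rule nn_integral_cmult) measurable
    finally show "ennreal (norm (I u x - I v x)) \<le> ennreal (M * C / \<epsilon>\<^sup>2) * (\<integral>\<^sup>+\<xi>. k \<xi> * (d (x + \<epsilon> *\<^sub>R \<xi>) + d x) \<partial>lborel)" .
  qed
  also have "\<dots> = (\<integral>\<^sup>+x. ennreal (M * C / \<epsilon>\<^sup>2) * ((\<integral>\<^sup>+\<xi>. k \<xi> * (d (x + \<epsilon> *\<^sub>R \<xi>) + d x) \<partial>lborel) * indicator D x) \<partial>lborel)"
    by (simp only: mult_ac)
  also have "\<dots> = ennreal (M * C / \<epsilon>\<^sup>2) * (\<integral>\<^sup>+x. (\<integral>\<^sup>+\<xi>. k \<xi> * (d (x + \<epsilon> *\<^sub>R \<xi>) + d x) \<partial>lborel) * indicator D x \<partial>lborel)"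
    by (rule nn_integral_cmult) measurable
  also have "\<dots> \<le> ennreal (M * C / \<epsilon>\<^sup>2) * ennreal (2 * \<kappa> * A * sqrt (measure lborel D))"
  proof (intro mult_left_mono nn_integral_difference_kernel_le indicator_D_L2)
    show "integral\<^sup>N lborel k \<le> ennreal \<kappa>"
      unfolding k_def \<kappa>_def by (simp only: nn_integral_inverse_sqrt_mass order_refl)
    show "(\<integral>\<^sup>+x. d x ^ 2 \<partial>lborel) \<le> ennreal (A\<^sup>2)"
      unfolding d_def by (rule A(1))
  qed (use \<kappa> A(2) d_meas k_meas in auto)
  also have "\<dots> = ennreal (M * C / \<epsilon>\<^sup>2 * (2 * \<kappa> * A * sqrt (measure lborel D)))"
    using M_nonneg C \<kappa> A(2) by (intro ennreal_mult[symmetric]) auto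
  finally have le: "\<bar>LBINT x:D. I u x - I v x\<bar> \<le> M * C / \<epsilon>\<^sup>2 * (2 * \<kappa> * A * sqrt (measure lborel D))"
    using M_nonneg C \<kappa> A(2) by (subst (asm) ennreal_le_iff) auto
  have "bond_energy f u - bond_energy f v = 1 / unit_vol TYPE('n) * (LBINT x:D. I u x - I v x)"
    unfolding bond_energy_def I_def[symmetric] set_integral_diff(2)[OF intx[OF u] intx[OF v]]
    by (simp only: right_diff_distrib)
  then have "\<bar>bond_energy f u - bond_energy f v\<bar> = 1 / unit_vol TYPE('n) * \<bar>LBINT x:D. I u x - I v x\<bar>"
    using vol_pos by (simp add: abs_mult)
  also have "\<dots> \<le> 1 / unit_vol TYPE('n) * (M * C / \<epsilon>\<^sup>2 * (2 * \<kappa> * A * sqrt (measure lborel D)))"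
    using vol_pos by (intro mult_left_mono le) auto
  finally show ?thesis by (simp add: \<kappa>_def mult_ac)
qed

lemma dilation_energy_lipschitz:
  assumes lip: "\<And>a b. \<bar>g a - g b\<bar> \<le> C * \<bar>a - b\<bar>" and C: "0 \<le> C"
    and bdd: "\<And>r. \<bar>g r\<bar> \<le> B" and [measurable]: "g \<in> borel_measurable borel"
    and u: "bounded_field u" and v: "bounded_field v"
    and A: "(\<integral>\<^sup>+x. modulus (\<lambda>x. u x - v x) x ^ 2 \<partial>lborel) \<le> ennreal (A\<^sup>2)" "0 \<le> A"
  shows "\<bar>dilation_energy g u - dilation_energy g v\<bar>
    \<le> 2 * M * C * sqrt (measure lborel D) / \<epsilon>\<^sup>2 * A"
proof -
  have B: "0 \<le> B" using bdd[of 0] by simp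
  define w where "w = (\<lambda>x. u x - v x)"
  have w: "bounded_field w" unfolding w_def by (rule bounded_field_diff[OF u v])
  have [measurable]: "w \<in> borel_measurable borel" using w by (rule bounded_field_measurable)
  have int: "set_integrable lborel D (\<lambda>x. \<omega> x * (g (\<theta> z x) / \<epsilon>\<^sup>2))" if z: "bounded_field z" for z
  proof (rule set_integrable_D[where B = "1 * (B / \<epsilon>\<^sup>2)"])
    have [measurable]: "z \<in> borel_measurable borel" using z by (rule bounded_field_measurable)
    show "(\<lambda>x. \<omega> x * (g (\<theta> z x) / \<epsilon>\<^sup>2)) \<in> borel_measurable borel" by measurable
    show "norm (\<omega> x * (g (\<theta> z x) / \<epsilon>\<^sup>2)) \<le> 1 * (B / \<epsilon>\<^sup>2)" for x
      unfolding norm_mult using \<omega>_nonneg \<omega>_le_1 bdd B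
      by (intro mult_mono) (auto intro!: divide_right_mono)
  qed
  have "ennreal \<bar>LBINT x:D. \<omega> x * (g (\<theta> u x) / \<epsilon>\<^sup>2) - \<omega> x * (g (\<theta> v x) / \<epsilon>\<^sup>2)\<bar>
      \<le> (\<integral>\<^sup>+x. indicator D x * (ennreal (C / \<epsilon>\<^sup>2) * modulus (\<theta> w) x) \<partial>lborel)"
    unfolding real_norm_def[symmetric]
  proof (rule ennreal_norm_set_integral_le)
    fix x assume x: "x \<in> D"
    have "\<bar>\<omega> x * (g (\<theta> u x) / \<epsilon>\<^sup>2) - \<omega> x * (g (\<theta> v x) / \<epsilon>\<^sup>2)\<bar> = \<omega> x * (\<bar>g (\<theta> u x) - g (\<theta> v x)\<bar> / \<epsilon>\<^sup>2)"
      using \<omega>_nonneg by (simp add: right_diff_distrib[symmetric] diff_divide_distrib[symmetric] abs_mult)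
    also have "\<dots> \<le> 1 * (C * \<bar>\<theta> u x - \<theta> v x\<bar> / \<epsilon>\<^sup>2)"
      using \<omega>_nonneg \<omega>_le_1 C by (intro mult_mono divide_right_mono lip) auto
    finally have "ennreal (norm (\<omega> x * (g (\<theta> u x) / \<epsilon>\<^sup>2) - \<omega> x * (g (\<theta> v x) / \<epsilon>\<^sup>2))) \<le> ennreal (C / \<epsilon>\<^sup>2 * norm (\<theta> w x))"
      unfolding w_def strain_diff[OF u v] by (intro ennreal_leI) simp
    also have "\<dots> = ennreal (C / \<epsilon>\<^sup>2) * modulus (\<theta> w) x"
      using x C by (subst ennreal_mult) (auto simp: modulus_def)
    finally show "ennreal (norm (\<omega> x * (g (\<theta> u x) / \<epsilon>\<^sup>2) - \<omega> x * (g (\<theta> v x) / \<epsilon>\<^sup>2))) \<le> ennreal (C / \<epsilon>\<^sup>2) * modulus (\<theta> w) x" .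
  qed
  also have "\<dots> = (\<integral>\<^sup>+x. ennreal (C / \<epsilon>\<^sup>2) * (modulus (\<theta> w) x * indicator D x) \<partial>lborel)"
    by (simp only: mult_ac)
  also have "\<dots> = ennreal (C / \<epsilon>\<^sup>2) * (\<integral>\<^sup>+x. modulus (\<theta> w) x * indicator D x \<partial>lborel)"
    by (rule nn_integral_cmult) measurable
  also have "\<dots> \<le> ennreal (C / \<epsilon>\<^sup>2) * ennreal (2 * M * A * sqrt (measure lborel D))"
    by (intro mult_left_mono nn_integral_modulus_strain_le w indicator_D_L2 A[folded w_def]) auto
  also have "\<dots> = ennreal (C / \<epsilon>\<^sup>2 * (2 * M * A * sqrt (measure lborel D)))"
    using M_nonneg C A(2) by (intro ennreal_mult[symmetric]) auto
  finally have le: "\<bar>LBINT x:D. \<omega> x * (g (\<theta> u x) / \<epsilon>\<^sup>2) - \<omega> x * (g (\<theta> v x) / \<epsilon>\<^sup>2)\<bar>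
      \<le> C / \<epsilon>\<^sup>2 * (2 * M * A * sqrt (measure lborel D))"
    using M_nonneg C A(2) by (subst (asm) ennreal_le_iff) auto
  then show ?thesis
    unfolding dilation_energy_def set_integral_diff(2)[OF int[OF u] int[OF v]] by (simp add: mult_ac)
qed

lemma modulus_square_integral_bounded:
  fixes w :: "real^'n \<Rightarrow> 'b::{real_normed_vector, second_countable_topology}"
  assumes "w \<in> borel_measurable borel" and "\<And>x. x \<in> D \<Longrightarrow> norm (w x) \<le> B"
  shows "(\<integral>\<^sup>+x. modulus w x ^ 2 \<partial>lborel) = ennreal (LBINT x:D. (norm (w x))\<^sup>2)"
proof -
  have "set_integrable lborel D (\<lambda>x. (norm (w x))\<^sup>2)"
    by (rule set_integrable_D[where B = "B\<^sup>2"])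
       (use assms in \<open>auto intro!: power_mono borel_measurable_power borel_measurable_norm\<close>)
  then have "ennreal (LBINT x:D. (norm (w x))\<^sup>2) = (\<integral>\<^sup>+x. ennreal (indicator D x *\<^sub>R (norm (w x))\<^sup>2) \<partial>lborel)"
    unfolding set_lebesgue_integral_def set_integrable_def
    by (intro nn_integral_eq_integral[symmetric]) auto
  also have "\<dots> = (\<integral>\<^sup>+x. modulus w x ^ 2 \<partial>lborel)"
    by (intro nn_integral_cong) (auto simp: modulus_def indicator_def ennreal_power)
  finally show ?thesis ..
qed

text \<open>The pairing bound with the strain as its own test function gives $N^2 \le 2MAN$.\<close>

lemma strain_L2_le:
  assumes u: "bounded_field u"
    and A: "(\<integral>\<^sup>+x. modulus u x ^ 2 \<partial>lborel) \<le> ennreal (A\<^sup>2)" "0 \<le> A"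
  shows "sqrt (LBINT x:D. (\<theta> u x)\<^sup>2) \<le> 2 * M * A"
proof -
  have [measurable]: "u \<in> borel_measurable borel" using u by (rule bounded_field_measurable)
  obtain B where B: "\<And>x. x \<in> D \<Longrightarrow> \<bar>\<theta> u x\<bar> \<le> B" using strain_bounded[OF u] by metis
  define N where "N = sqrt (LBINT x:D. (\<theta> u x)\<^sup>2)"
  have N: "0 \<le> N" unfolding N_def by (intro real_sqrt_ge_zero set_integral_nonneg_real) auto
  have N2: "(\<integral>\<^sup>+x. modulus (\<theta> u) x ^ 2 \<partial>lborel) = ennreal (N\<^sup>2)"
    using modulus_square_integral_bounded[of "\<theta> u" B] B
    by (simp add: N_def set_integral_nonneg_real)
  have "ennreal (N\<^sup>2) \<le> ennreal (2 * M * A * N)"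
    using nn_integral_modulus_strain_le[OF u A, of "modulus (\<theta> u)" N] N N2
    by (simp add: power2_eq_square)
  then have "N * N \<le> 2 * M * A * N"
    using M_nonneg A(2) N by (subst (asm) ennreal_le_iff) (auto simp: power2_eq_square)
  then have "N \<le> 2 * M * A"
    using N M_nonneg A(2) by (cases "N = 0") auto
  then show ?thesis by (simp add: N_def)
qed

lemma weighted_L2_triangle:
  fixes a b :: "real^'n \<Rightarrow> real"
  assumes [measurable]: "a \<in> borel_measurable borel" "b \<in> borel_measurable borel"
    and bdd: "\<And>x. x \<in> D \<Longrightarrow> \<bar>a x\<bar> \<le> B" "\<And>x. x \<in> D \<Longrightarrow> \<bar>b x\<bar> \<le> B"
  shows "sqrt (LBINT x:D. \<omega> x * (a x + b x)\<^sup>2)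
    \<le> sqrt (LBINT x:D. \<omega> x * (a x)\<^sup>2) + sqrt (LBINT x:D. \<omega> x * (b x)\<^sup>2)"
proof -
  define a' b' where "a' x = sqrt (\<omega> x) * a x" and "b' x = sqrt (\<omega> x) * b x" for x
  have [measurable]: "a' \<in> borel_measurable borel" "b' \<in> borel_measurable borel"
    unfolding a'_def b'_def by measurable
  have bd: "\<bar>a' x\<bar> \<le> B" "\<bar>b' x\<bar> \<le> B" if "x \<in> D" for x
  proof -
    have "sqrt (\<omega> x) * \<bar>c\<bar> \<le> B" if "\<bar>c\<bar> \<le> B" for c
      using mult_mono[of "sqrt (\<omega> x)" 1 "\<bar>c\<bar>" B] that \<omega>_le_1[of x] by simp
    then show "\<bar>a' x\<bar> \<le> B" "\<bar>b' x\<bar> \<le> B"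
      using bdd that \<omega>_nonneg[of x] by (auto simp: a'_def b'_def abs_mult)
  qed
  have sq: "\<omega> x * (a x)\<^sup>2 = (a' x)\<^sup>2" "\<omega> x * (b x)\<^sup>2 = (b' x)\<^sup>2"
    "\<omega> x * (a x + b x)\<^sup>2 = (a' x)\<^sup>2 + 2 * (a' x * b' x) + (b' x)\<^sup>2" for x
  proof -
    have w: "\<omega> x = sqrt (\<omega> x) * sqrt (\<omega> x)" using \<omega>_nonneg[of x] by simp
    show "\<omega> x * (a x)\<^sup>2 = (a' x)\<^sup>2" "\<omega> x * (b x)\<^sup>2 = (b' x)\<^sup>2"
      "\<omega> x * (a x + b x)\<^sup>2 = (a' x)\<^sup>2 + 2 * (a' x * b' x) + (b' x)\<^sup>2"
      by (subst w, simp only: a'_def b'_def power2_eq_square, algebra)+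
  qed
  define p q where "p = sqrt (LBINT x:D. (a' x)\<^sup>2)" and "q = sqrt (LBINT x:D. (b' x)\<^sup>2)"
  have p: "0 \<le> p" and q: "0 \<le> q"
    unfolding p_def q_def by (intro real_sqrt_ge_zero set_integral_nonneg_real; simp)+
  have p2: "p\<^sup>2 = (LBINT x:D. (a' x)\<^sup>2)" and q2: "q\<^sup>2 = (LBINT x:D. (b' x)\<^sup>2)"
    unfolding p_def q_def by (intro real_sqrt_pow2 set_integral_nonneg_real; simp)+
  have int: "set_integrable lborel D (\<lambda>x. (a' x)\<^sup>2)" "set_integrable lborel D (\<lambda>x. (b' x)\<^sup>2)"
    "set_integrable lborel D (\<lambda>x. 2 * (a' x * b' x))"
  proof -
    have prod: "norm (p * q) \<le> B * B" if "\<bar>p\<bar> \<le> B" "\<bar>q\<bar> \<le> B" for p q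
      using mult_mono'[OF that] by (simp add: abs_mult)
    show "set_integrable lborel D (\<lambda>x. (a' x)\<^sup>2)"
      unfolding power2_eq_square by (rule set_integrable_D[where B = "B * B"]) (measurable, intro prod bd)
    show "set_integrable lborel D (\<lambda>x. (b' x)\<^sup>2)"
      unfolding power2_eq_square by (rule set_integrable_D[where B = "B * B"]) (measurable, intro prod bd)
    have "set_integrable lborel D (\<lambda>x. a' x * b' x)"
      by (rule set_integrable_D[where B = "B * B"]) (measurable, intro prod bd)
    then show "set_integrable lborel D (\<lambda>x. 2 * (a' x * b' x))" by simp
  qed
  have cs: "(LBINT x:D. a' x * b' x) \<le> p * q"
  proof -
    have "ennreal \<bar>LBINT x:D. a' x * b' x\<bar> \<le> (\<integral>\<^sup>+x. indicator D x * (ennreal \<bar>a' x\<bar> * ennreal \<bar>b' x\<bar>) \<partial>lborel)"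
      unfolding real_norm_def[symmetric]
      by (rule ennreal_norm_set_integral_le) (simp add: abs_mult ennreal_mult'')
    also have "\<dots> = (\<integral>\<^sup>+x. modulus a' x * modulus b' x \<partial>lborel)"
      by (intro nn_integral_cong) (auto simp: modulus_def indicator_def)
    also have "\<dots> \<le> ennreal (p * q)"
    proof (rule nn_integral_mult_le_L2)
      show "(\<integral>\<^sup>+x. modulus a' x ^ 2 \<partial>lborel) \<le> ennreal (p\<^sup>2)"
        using modulus_square_integral_bounded[of a' B] bd(1) by (simp add: p2)
      show "(\<integral>\<^sup>+x. modulus b' x ^ 2 \<partial>lborel) \<le> ennreal (q\<^sup>2)"
        using modulus_square_integral_bounded[of b' B] bd(2) by (simp add: q2)
    qed (use p q in auto)
    finally show ?thesis
      using p q by (subst (asm) ennreal_le_iff) auto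
  qed
  have "(LBINT x:D. \<omega> x * (a x + b x)\<^sup>2) = p\<^sup>2 + 2 * (LBINT x:D. a' x * b' x) + q\<^sup>2"
    unfolding sq p2 q2
    by (subst set_integral_add(2)[OF set_integral_add(1)[OF int(1,3)] int(2)],
        subst set_integral_add(2)[OF int(1,3)]) simp
  also have "\<dots> \<le> (p + q)\<^sup>2"
    using cs by (simp add: power2_sum)
  finally have "sqrt (LBINT x:D. \<omega> x * (a x + b x)\<^sup>2) \<le> sqrt ((p + q)\<^sup>2)"
    by (rule real_sqrt_le_mono)
  then show ?thesis
    using p q by (simp add: sq(1,2) p_def[symmetric] q_def[symmetric])
qed

text \<open>The square root of a quadratic dilatational energy is a seminorm. It is Lipschitz in $L^2$ with a constant
  that does not depend on the size of the fields, unlike the energy itself.\<close>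

lemma weighted_strain_L2_lipschitz:
  assumes u: "bounded_field u" and v: "bounded_field v"
    and A: "(\<integral>\<^sup>+x. modulus (\<lambda>x. u x - v x) x ^ 2 \<partial>lborel) \<le> ennreal (A\<^sup>2)" "0 \<le> A"
  shows "sqrt (LBINT x:D. \<omega> x * (\<theta> u x)\<^sup>2) \<le> sqrt (LBINT x:D. \<omega> x * (\<theta> v x)\<^sup>2) + 2 * M * A"
proof -
  define w where "w = (\<lambda>x. u x - v x)"
  have w: "bounded_field w" unfolding w_def by (rule bounded_field_diff[OF u v])
  obtain B1 where B1: "\<And>x. x \<in> D \<Longrightarrow> \<bar>\<theta> v x\<bar> \<le> B1" using strain_bounded[OF v] by metis
  obtain B2 where B2: "\<And>x. x \<in> D \<Longrightarrow> \<bar>\<theta> w x\<bar> \<le> B2" using strain_bounded[OF w] by metis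
  have [measurable]: "\<theta> v \<in> borel_measurable borel" "\<theta> w \<in> borel_measurable borel"
    by (intro strain_measurable bounded_field_measurable v w)+
  have eq: "\<theta> u x = \<theta> v x + \<theta> w x" for x
    unfolding w_def strain_diff[OF u v] by simp
  have "sqrt (LBINT x:D. \<omega> x * (\<theta> u x)\<^sup>2)
      \<le> sqrt (LBINT x:D. \<omega> x * (\<theta> v x)\<^sup>2) + sqrt (LBINT x:D. \<omega> x * (\<theta> w x)\<^sup>2)"
    unfolding eq
    by (rule weighted_L2_triangle[where B = "max B1 B2"]) (use B1 B2 in \<open>auto simp: le_max_iff_disj\<close>)
  also have "sqrt (LBINT x:D. \<omega> x * (\<theta> w x)\<^sup>2) \<le> sqrt (LBINT x:D. (\<theta> w x)\<^sup>2)"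
  proof (intro real_sqrt_le_mono set_integral_mono)
    have bd: "(\<theta> w x)\<^sup>2 \<le> B2\<^sup>2" if "x \<in> D" for x
      using power_mono[OF B2[OF that], of 2] by simp
    show "set_integrable lborel D (\<lambda>x. (\<theta> w x)\<^sup>2)"
      by (rule set_integrable_D[where B = "B2\<^sup>2"]) (use bd in auto)
    show "set_integrable lborel D (\<lambda>x. \<omega> x * (\<theta> w x)\<^sup>2)"
    proof (rule set_integrable_D[where B = "1 * B2\<^sup>2"])
      fix x assume "x \<in> D"
      then show "norm (\<omega> x * (\<theta> w x)\<^sup>2) \<le> 1 * B2\<^sup>2"
        unfolding norm_mult using bd \<omega>_nonneg \<omega>_le_1 by (intro mult_mono) auto
    qed measurable
    show "\<omega> x * (\<theta> w x)\<^sup>2 \<le> (\<theta> w x)\<^sup>2" for x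
      using \<omega>_nonneg \<omega>_le_1 by (simp add: mult_left_le_one_le)
  qed
  also have "sqrt (LBINT x:D. (\<theta> w x)\<^sup>2) \<le> 2 * M * A"
    by (rule strain_L2_le[OF w A(1)[folded w_def] A(2)])
  finally show ?thesis by simp
qed

end

section \<open>Piecewise constant fields\<close>

lemma grid_cell_unique:
  fixes x :: "real^'n"
  assumes "0 < h" "x \<in> grid_cell h i" "x \<in> grid_cell h j"
  shows "i = j"
proof -
  have "i $ k = j $ k" for k
  proof -
    have "h * real_of_int (i $ k) - h / 2 \<le> x $ k" "x $ k < h * real_of_int (i $ k) + h / 2"
      "h * real_of_int (j $ k) - h / 2 \<le> x $ k" "x $ k < h * real_of_int (j $ k) + h / 2"
      using assms(2,3) by (simp_all add: grid_cell_def grid_point_def)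
    then have "h * real_of_int (i $ k) < h * real_of_int (j $ k) + h"
      "h * real_of_int (j $ k) < h * real_of_int (i $ k) + h"
      by linarith+
    then have "h * real_of_int (i $ k) < h * real_of_int (j $ k + 1)"
      "h * real_of_int (j $ k) < h * real_of_int (i $ k + 1)"
      by (simp_all add: distrib_left)
    then have "i $ k < j $ k + 1" "j $ k < i $ k + 1"
      using assms(1) by (simp_all only: mult_less_cancel_left_pos of_int_less_iff)
    then show ?thesis by simp
  qed
  then show ?thesis by (simp add: vec_eq_iff)
qed

lemma grid_point_in_grid_cell: "0 < h \<Longrightarrow> grid_point h i \<in> grid_cell h i"
  by (simp add: grid_cell_def)

text \<open>A crude bound through the sum of the components; any multiple of \<^term>\<open>h\<close> would
  serve.\<close>

lemma norm_grid_point_diff_le: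
  fixes x :: "real^'n"
  assumes "0 < h" "x \<in> grid_cell h i"
  shows "norm (grid_point h i - x) \<le> h * real CARD('n)"
proof -
  have "\<bar>(grid_point h i - x) $ k\<bar> \<le> h" for k
  proof -
    have "grid_point h i $ k - h / 2 \<le> x $ k" "x $ k < grid_point h i $ k + h / 2"
      using assms(2) by (simp_all add: grid_cell_def)
    then show ?thesis using assms(1) by simp
  qed
  then have "(\<Sum>k\<in>UNIV. \<bar>(grid_point h i - x) $ k\<bar>) \<le> (\<Sum>k\<in>(UNIV::'n set). h)"
    by (intro sum_mono)
  then show ?thesis
    using norm_le_l1_cart[of "grid_point h i - x"] by (simp add: mult.commute)
qed

lemma grid_cell_sets [measurable]: "grid_cell h (i :: int^'n) \<in> sets borel"
proof -
  have "grid_cell h i = (\<Inter>k. {x. grid_point h i $ k - h / 2 \<le> x $ k} \<inter> {x. x $ k < grid_point h i $ k + h / 2})"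
    by (auto simp: grid_cell_def)
  also have "\<dots> \<in> sets borel"
    by (intro sets.finite_INT sets.Int borel_closed borel_open closed_Collect_le open_Collect_less
        continuous_intros) auto
  finally show ?thesis .
qed

lemma finite_grid_points:
  fixes D :: "(real^'n) set"
  assumes "0 < h" "bounded D"
  shows "finite {i. grid_point h i \<in> D}"
proof -
  obtain B where B: "\<And>x. x \<in> D \<Longrightarrow> norm x \<le> B" using assms(2) unfolding bounded_iff by auto
  define m where "m = \<lceil>B / h\<rceil>"
  have "{i. grid_point h i \<in> D} \<subseteq> (\<lambda>F. \<chi> k. F k) ` ((UNIV :: 'n set) \<rightarrow>\<^sub>E {-m..m})"
  proof
    fix i assume "i \<in> {i. grid_point h i \<in> D}"
    then have n: "norm (grid_point h i) \<le> B" using B by simp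
    have "i $ k \<in> {-m..m}" for k
    proof -
      have "\<bar>h * real_of_int (i $ k)\<bar> \<le> B"
        using component_le_norm_cart[of "grid_point h i" k] n by (simp add: grid_point_def)
      then have "\<bar>real_of_int (i $ k)\<bar> \<le> B / h"
        using assms(1) by (simp add: abs_mult field_simps)
      then have "real_of_int \<bar>i $ k\<bar> \<le> of_int m" unfolding m_def by linarith
      then have "\<bar>i $ k\<bar> \<le> m" by (simp only: of_int_le_iff)
      then show ?thesis by auto
    qed
    then have "(\<lambda>k. i $ k) \<in> (UNIV \<rightarrow>\<^sub>E {-m..m})" by auto
    then show "i \<in> (\<lambda>F. \<chi> k. F k) ` ((UNIV :: 'n set) \<rightarrow>\<^sub>E {-m..m})"
      by (rule image_eqI[rotated]) (simp add: vec_eq_iff)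
  qed
  then show ?thesis
    by (rule finite_subset) (intro finite_imageI finite_PiE; simp)
qed

locale peridynamic_grid = peridynamic_setting D J \<omega> \<epsilon> M
  for D :: "(real^'n) set" and J \<omega> \<epsilon> M +
  fixes h :: real
  assumes h_pos: "0 < h" and h_less: "h < \<epsilon>"
begin

definition cells :: "(int^'n) set" where
  "cells = {i. grid_point h i \<in> D}"

text \<open>The weight is the volume of the part of the cell inside \<^term>\<open>D\<close>, so that the weighted
  norm of the coefficients is exactly the $L^2$ norm on \<^term>\<open>D\<close>.\<close>

definition cell_mass :: "int^'n \<Rightarrow> real" where
  "cell_mass i = measure lborel (D \<inter> grid_cell h i)"

definition grid_norm :: "(int^'n \<Rightarrow> real^'n) \<Rightarrow> real" where
  "grid_norm w = sqrt (\<Sum>i\<in>cells. cell_mass i * (norm (w i))\<^sup>2)"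

lemma finite_cells: "finite cells"
  unfolding cells_def by (rule finite_grid_points[OF h_pos D_bounded])

lemma cell_mass_nonneg: "0 \<le> cell_mass i"
  by (simp add: cell_mass_def)

lemma grid_norm_nonneg: "0 \<le> grid_norm w"
  unfolding grid_norm_def by (intro real_sqrt_ge_zero sum_nonneg mult_nonneg_nonneg cell_mass_nonneg) auto

lemma grid_norm_square: "(grid_norm w)\<^sup>2 = (\<Sum>i\<in>cells. cell_mass i * (norm (w i))\<^sup>2)"
  unfolding grid_norm_def
  by (intro real_sqrt_pow2 sum_nonneg mult_nonneg_nonneg cell_mass_nonneg) auto

lemma emeasure_cell: "emeasure lborel (D \<inter> grid_cell h i) = ennreal (cell_mass i)"
proof -
  have "emeasure lborel (D \<inter> grid_cell h i) < \<infinity>"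
    by (rule emeasure_bounded_finite) (use D_bounded in \<open>auto intro: bounded_subset\<close>)
  then show ?thesis
    unfolding cell_mass_def by (intro emeasure_eq_ennreal_measure) auto
qed

abbreviation "pc \<equiv> pc_extension D h"

lemma pc_extension_sum: "pc w x = (\<Sum>i\<in>cells. indicat_real (grid_cell h i) x *\<^sub>R w i)"
  by (simp add: pc_extension_def cells_def)

lemma pc_extension_on_cell:
  assumes "x \<in> grid_cell h i" "i \<in> cells"
  shows "pc w x = w i"
proof -
  have "pc w x = (\<Sum>j\<in>cells. if j = i then w j else 0)"
    unfolding pc_extension_sum
    using grid_cell_unique[OF h_pos] assms by (intro sum.cong) (auto simp: indicator_def)
  then show ?thesis using assms finite_cells by simp
qed

lemma pc_extension_off_cells:
  assumes "\<And>i. i \<in> cells \<Longrightarrow> x \<notin> grid_cell h i"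
  shows "pc w x = 0"
  unfolding pc_extension_sum using assms by (intro sum.neutral) auto

lemma pc_extension_measurable [measurable]: "pc w \<in> borel_measurable borel"
  unfolding pc_extension_sum[abs_def] by measurable

lemma pc_extension_diff: "pc w x - pc w' x = pc (\<lambda>i. w i - w' i) x"
  unfolding pc_extension_sum by (simp add: sum_subtractf[symmetric] scaleR_right_diff_distrib)

lemma pc_extension_bounded_field: "bounded_field (pc w)"
proof -
  have "norm (pc w x) \<le> (\<Sum>i\<in>cells. norm (w i))" for x
    unfolding pc_extension_sum
    by (rule order_trans[OF norm_sum sum_mono]) (auto simp: indicator_def)
  then show ?thesis unfolding bounded_field_def by auto
qed

lemma norm_pc_extension_square:
  "(norm (pc w x))\<^sup>2 = (\<Sum>i\<in>cells. indicat_real (grid_cell h i) x * (norm (w i))\<^sup>2)"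
proof (cases "\<exists>i\<in>cells. x \<in> grid_cell h i")
  case True
  then obtain i where i: "i \<in> cells" "x \<in> grid_cell h i" by auto
  have "(\<Sum>j\<in>cells. indicat_real (grid_cell h j) x * (norm (w j))\<^sup>2) = (\<Sum>j\<in>cells. if j = i then (norm (w j))\<^sup>2 else 0)"
    using grid_cell_unique[OF h_pos] i by (intro sum.cong) (auto simp: indicator_def)
  then show ?thesis using i finite_cells by (simp add: pc_extension_on_cell)
next
  case False
  then have "(\<Sum>i\<in>cells. indicat_real (grid_cell h i) x * (norm (w i))\<^sup>2) = 0"
    by (intro sum.neutral) auto
  then show ?thesis using False by (simp add: pc_extension_off_cells)
qed

lemma L2_norm_on_pc_extension: "L2_norm_on D (pc w) = grid_norm w"
proof -
  have int: "integrable lborel (indicat_real (D \<inter> grid_cell h i))" for i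
    by (rule integrable_real_indicator) (auto simp: emeasure_cell)
  have "(LBINT x:D. (norm (pc w x))\<^sup>2)
      = (\<integral>x. (\<Sum>i\<in>cells. (norm (w i))\<^sup>2 * indicat_real (D \<inter> grid_cell h i) x) \<partial>lborel)"
    unfolding set_lebesgue_integral_def norm_pc_extension_square
    by (intro Bochner_Integration.integral_cong refl) (auto simp: indicator_def intro!: sum.cong)
  also have "\<dots> = (\<Sum>i\<in>cells. (norm (w i))\<^sup>2 * cell_mass i)"
    using int by (subst Bochner_Integration.integral_sum) (auto simp: cell_mass_def)
  finally show ?thesis
    unfolding L2_norm_on_def grid_norm_def by (simp add: mult.commute)
qed

lemma modulus_pc_L2: "(\<integral>\<^sup>+x. modulus (pc w) x ^ 2 \<partial>lborel) \<le> ennreal ((grid_norm w)\<^sup>2)"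
proof -
  obtain B where "\<And>x. norm (pc w x) \<le> B" using bounded_fieldE[OF pc_extension_bounded_field] by metis
  then have "(\<integral>\<^sup>+x. modulus (pc w) x ^ 2 \<partial>lborel) = ennreal (LBINT x:D. (norm (pc w x))\<^sup>2)"
    by (intro modulus_square_integral_bounded) auto
  also have "(LBINT x:D. (norm (pc w x))\<^sup>2) = (L2_norm_on D (pc w))\<^sup>2"
    unfolding L2_norm_on_def
    by (intro real_sqrt_pow2[symmetric] set_integral_nonneg_real) auto
  finally show ?thesis by (simp add: L2_norm_on_pc_extension)
qed

lemma modulus_pc_diff_L2:
  "(\<integral>\<^sup>+x. modulus (\<lambda>x. pc w x - pc w' x) x ^ 2 \<partial>lborel) \<le> ennreal ((grid_norm (\<lambda>i. w i - w' i))\<^sup>2)"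
  using modulus_pc_L2[of "\<lambda>i. w i - w' i"] by (simp add: pc_extension_diff cong: nn_integral_cong)

lemma sum_cell_mass_le: "(\<Sum>i\<in>cells. cell_mass i) \<le> measure lborel D"
proof -
  have "(\<Sum>i\<in>cells. emeasure lborel (D \<inter> grid_cell h i)) = emeasure lborel (\<Union>i\<in>cells. D \<inter> grid_cell h i)"
    using finite_cells grid_cell_unique[OF h_pos]
    by (intro sum_emeasure) (auto simp: disjoint_family_on_def)
  also have "\<dots> \<le> emeasure lborel D"
    by (intro emeasure_mono) auto
  finally have "ennreal (\<Sum>i\<in>cells. cell_mass i) \<le> ennreal (measure lborel D)"
    by (simp add: emeasure_cell emeasure_D cell_mass_nonneg)
  then show ?thesis by (subst (asm) ennreal_le_iff) auto
qed

lemma grid_cauchy_schwarz: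
  "(\<Sum>i\<in>cells. cell_mass i * (norm (a i) * norm (b i))) \<le> grid_norm a * grid_norm b"
proof -
  have "(\<Sum>i\<in>cells. cell_mass i * (norm (a i) * norm (b i)))
      = (\<Sum>i\<in>cells. \<bar>sqrt (cell_mass i) * norm (a i)\<bar> * \<bar>sqrt (cell_mass i) * norm (b i)\<bar>)"
  proof (rule sum.cong[OF refl])
    fix i
    have "cell_mass i * (norm (a i) * norm (b i)) = (sqrt (cell_mass i) * sqrt (cell_mass i)) * (norm (a i) * norm (b i))"
      by (simp add: cell_mass_nonneg)
    also have "\<dots> = \<bar>sqrt (cell_mass i) * norm (a i)\<bar> * \<bar>sqrt (cell_mass i) * norm (b i)\<bar>"
      by (simp add: abs_mult cell_mass_nonneg mult_ac)
    finally show "cell_mass i * (norm (a i) * norm (b i)) = \<bar>sqrt (cell_mass i) * norm (a i)\<bar> * \<bar>sqrt (cell_mass i) * norm (b i)\<bar>" .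
  qed
  also have "\<dots> \<le> L2_set (\<lambda>i. sqrt (cell_mass i) * norm (a i)) cells * L2_set (\<lambda>i. sqrt (cell_mass i) * norm (b i)) cells"
    by (rule L2_set_mult_ineq)
  also have "\<dots> = grid_norm a * grid_norm b"
    by (simp add: L2_set_def grid_norm_def power_mult_distrib cell_mass_nonneg)
  finally show ?thesis .
qed

text \<open>Cauchy-Schwarz against a constant field of unit vectors.\<close>

lemma sum_bounded_times_norm_le:
  assumes "0 \<le> c"
  shows "(\<Sum>i\<in>cells. cell_mass i * (c * norm (v i))) \<le> c * sqrt (measure lborel D) * grid_norm v"
proof -
  have "(\<Sum>i\<in>cells. cell_mass i * (c * norm (v i))) = c * (\<Sum>i\<in>cells. cell_mass i * (norm (axis undefined 1 :: real^'n) * norm (v i)))"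
    by (simp add: sum_distrib_left mult_ac norm_axis_1)
  also have "\<dots> \<le> c * (grid_norm (\<lambda>_. axis undefined 1) * grid_norm v)"
    by (intro mult_left_mono grid_cauchy_schwarz assms)
  also have "\<dots> \<le> c * (sqrt (measure lborel D) * grid_norm v)"
    using sum_cell_mass_le assms grid_norm_nonneg
    by (intro mult_left_mono mult_right_mono) (auto simp: grid_norm_def norm_axis_1)
  finally show ?thesis by (simp add: mult.assoc)
qed

text \<open>The sum over grid points is an integral over \<^term>\<open>D\<close> of a function that is constant on
  cells. On each cell the ball integral around the grid point is at most the one around the current point with radius
  enlarged by the dimension, because grid point and current point are less than $\epsilon d$ apart; then averaging in
  $L^2$ applies.\<close>

lemma sum_force_D_quadratic_le:
  assumes g': "\<And>r. deriv g r = \<beta> * r" and \<beta>: "0 \<le> \<beta>"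
  shows "(\<Sum>i\<in>cells. cell_mass i * (norm (force_D \<epsilon> J \<omega> g (pc w) (grid_point h i)) * norm (v i)))
    \<le> \<beta> * M\<^sup>2 * (3 * (2 + real CARD('n)) ^ CARD('n) + 1) / \<epsilon>\<^sup>2 * grid_norm w * grid_norm v"
proof -
  define R where "R = 2 + real CARD('n)"
  define F where "F i = norm (force_D \<epsilon> J \<omega> g (pc w) (grid_point h i))" for i
  define c where "c = \<beta> * M\<^sup>2 / \<epsilon>\<^sup>2"
  define H where "H x = (ennreal (3 / unit_vol TYPE('n)) * ball_integral R (modulus (pc w)) x + modulus (pc w) x) * modulus (pc v) x" for x
  have c: "0 \<le> c" using \<beta> by (simp add: c_def)
  have R: "0 \<le> R" by (simp add: R_def)
  have "ennreal (\<Sum>i\<in>cells. cell_mass i * (F i * norm (v i)))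
      = (\<Sum>i\<in>cells. ennreal (F i * norm (v i)) * emeasure lborel (D \<inter> grid_cell h i))"
  proof -
    have "ennreal (F i * norm (v i)) * emeasure lborel (D \<inter> grid_cell h i) = ennreal (cell_mass i * (F i * norm (v i)))" for i
      unfolding emeasure_cell
      by (subst ennreal_mult[symmetric]) (auto simp: F_def cell_mass_nonneg mult.commute)
    then show ?thesis
      by (simp only:) (rule sum_ennreal[symmetric], simp add: F_def cell_mass_nonneg)
  qed
  also have "\<dots> = (\<Sum>i\<in>cells. (\<integral>\<^sup>+x. ennreal (F i * norm (v i)) * indicator (D \<inter> grid_cell h i) x \<partial>lborel))"
    by (intro sum.cong refl nn_integral_cmult_indicator[symmetric]) auto
  also have "\<dots> = (\<integral>\<^sup>+x. (\<Sum>i\<in>cells. ennreal (F i * norm (v i)) * indicator (D \<inter> grid_cell h i) x) \<partial>lborel)"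
    by (rule nn_integral_sum[symmetric]) measurable
  also have "\<dots> \<le> (\<integral>\<^sup>+x. ennreal c * H x \<partial>lborel)"
  proof (rule nn_integral_mono)
    fix x
    show "(\<Sum>i\<in>cells. ennreal (F i * norm (v i)) * indicator (D \<inter> grid_cell h i) x) \<le> ennreal c * H x"
    proof (cases "x \<in> D \<and> (\<exists>i\<in>cells. x \<in> grid_cell h i)")
      case True
      then obtain i where i: "x \<in> D" "i \<in> cells" "x \<in> grid_cell h i" by auto
      then have xi: "grid_point h i \<in> D" by (simp add: cells_def)
      have "(\<Sum>j\<in>cells. ennreal (F j * norm (v j)) * indicator (D \<inter> grid_cell h j) x)
          = (\<Sum>j\<in>cells. if j = i then ennreal (F j * norm (v j)) else 0)"
        using grid_cell_unique[OF h_pos] i by (intro sum.cong) (auto simp: indicator_def)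
      also have "\<dots> = ennreal (F i) * modulus (pc v) x"
        using i finite_cells by (simp add: modulus_def pc_extension_on_cell F_def ennreal_mult)
      also have "\<dots> \<le> (ennreal c * (ennreal (3 / unit_vol TYPE('n)) * ball_integral 2 (modulus (pc w)) (grid_point h i)
          + modulus (pc w) (grid_point h i))) * modulus (pc v) x"
        unfolding F_def c_def
        by (intro mult_right_mono norm_force_D_quadratic_le[OF g' \<beta> _ xi]) auto
      also have "modulus (pc w) (grid_point h i) = modulus (pc w) x"
        using i xi grid_point_in_grid_cell[OF h_pos, of i] by (simp add: modulus_def pc_extension_on_cell)
      also have "(ennreal c * (ennreal (3 / unit_vol TYPE('n)) * ball_integral 2 (modulus (pc w)) (grid_point h i)
          + modulus (pc w) x)) * modulus (pc v) x \<le>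
        (ennreal c * (ennreal (3 / unit_vol TYPE('n)) * ball_integral R (modulus (pc w)) x
          + modulus (pc w) x)) * modulus (pc v) x"
      proof (intro mult_right_mono mult_left_mono add_right_mono)
        have "norm (grid_point h i - x) \<le> h * real CARD('n)"
          by (rule norm_grid_point_diff_le[OF h_pos i(3)])
        also have "\<dots> \<le> \<epsilon> * real CARD('n)"
          using h_less by (intro mult_right_mono) auto
        finally show "ball_integral 2 (modulus (pc w)) (grid_point h i) \<le> ball_integral R (modulus (pc w)) x"
          unfolding R_def by (intro ball_integral_recenter) auto
      qed auto
      finally show ?thesis by (simp add: H_def mult.assoc)
    next
      case False
      then have "(\<Sum>i\<in>cells. ennreal (F i * norm (v i)) * indicator (D \<inter> grid_cell h i) x) = 0"
        by (intro sum.neutral) auto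
      then show ?thesis by simp
    qed
  qed
  also have "\<dots> = ennreal c * (\<integral>\<^sup>+x. H x \<partial>lborel)"
    unfolding H_def by (rule nn_integral_cmult) measurable
  also have "(\<integral>\<^sup>+x. H x \<partial>lborel) = (\<integral>\<^sup>+x. ennreal (3 / unit_vol TYPE('n)) * (ball_integral R (modulus (pc w)) x * modulus (pc v) x)
        + modulus (pc w) x * modulus (pc v) x \<partial>lborel)"
    unfolding H_def by (simp only: distrib_right mult.assoc)
  also have "\<dots> = ennreal (3 / unit_vol TYPE('n)) * (\<integral>\<^sup>+x. ball_integral R (modulus (pc w)) x * modulus (pc v) x \<partial>lborel)
        + (\<integral>\<^sup>+x. modulus (pc w) x * modulus (pc v) x \<partial>lborel)"
    by (subst nn_integral_add) (measurable, subst nn_integral_cmult, measurable)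
  also have "\<dots> \<le> ennreal (3 / unit_vol TYPE('n)) * ennreal (R ^ CARD('n) * unit_vol TYPE('n) * grid_norm w * grid_norm v)
        + ennreal (grid_norm w * grid_norm v)"
    unfolding ball_integral_def
  proof (intro add_mono mult_left_mono nn_integral_smoothing_le nn_integral_mult_le_L2 modulus_pc_L2 grid_norm_nonneg)
    show "(\<integral>\<^sup>+(\<xi>::real^'n). indicator (ball 0 R) \<xi> \<partial>lborel) \<le> ennreal (R ^ CARD('n) * unit_vol TYPE('n))"
      using emeasure_ball_unit_vol[OF R, where 'n = 'n] by simp
    show "0 \<le> R ^ CARD('n) * unit_vol TYPE('n)"
      using R vol_pos by simp
  qed measurable
  also have "\<dots> = ennreal (3 / unit_vol TYPE('n) * (R ^ CARD('n) * unit_vol TYPE('n) * grid_norm w * grid_norm v)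
        + grid_norm w * grid_norm v)"
    using R vol_pos grid_norm_nonneg
    by (subst ennreal_mult[symmetric], simp, simp, subst ennreal_plus[symmetric]) auto
  also have "3 / unit_vol TYPE('n) * (R ^ CARD('n) * unit_vol TYPE('n) * grid_norm w * grid_norm v)
        + grid_norm w * grid_norm v = (3 * R ^ CARD('n) + 1) * grid_norm w * grid_norm v"
    using vol_pos by (simp add: distrib_right)
  finally have "ennreal (\<Sum>i\<in>cells. cell_mass i * (F i * norm (v i)))
      \<le> ennreal c * ennreal ((3 * R ^ CARD('n) + 1) * grid_norm w * grid_norm v)"
    by (simp add: mult_left_mono)
  also have "\<dots> = ennreal (c * ((3 * R ^ CARD('n) + 1) * grid_norm w * grid_norm v))"
    using c R grid_norm_nonneg by (intro ennreal_mult[symmetric]) auto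
  finally have "(\<Sum>i\<in>cells. cell_mass i * (F i * norm (v i))) \<le> c * ((3 * R ^ CARD('n) + 1) * grid_norm w * grid_norm v)"
    using c R grid_norm_nonneg by (subst (asm) ennreal_le_iff) auto
  then show ?thesis by (simp add: F_def c_def R_def mult_ac)
qed

end

section \<open>Regularity of the data\<close>

lemma finite_C0_to_C3E:
  assumes "finite_C0_to_C3 f"
  obtains B C where "0 \<le> C" "\<And>r. \<bar>f r\<bar> \<le> B" "\<And>r. \<bar>deriv f r\<bar> \<le> C"
    "\<And>a b. \<bar>f a - f b\<bar> \<le> C * \<bar>a - b\<bar>" "f \<in> borel_measurable borel"
proof -
  have dif: "f differentiable (at r)" for r
    using assms[unfolded finite_C0_to_C3_def, THEN conjunct1, rule_format, of 0 r] by simp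
  have bdd: "bdd_above (range (\<lambda>r. \<bar>(deriv ^^ i) f r\<bar>))" if "i \<le> 3" for i
    using assms[unfolded finite_C0_to_C3_def, THEN conjunct2, rule_format, OF that] .
  obtain B where B: "\<And>r. \<bar>f r\<bar> \<le> B"
    using bdd[of 0] unfolding bdd_above_def by auto
  obtain C where C: "\<And>r. \<bar>deriv f r\<bar> \<le> C"
    using bdd[of 1] unfolding bdd_above_def by auto
  have der: "(f has_real_derivative deriv f r) (at r)" for r
    using dif[of r] by (simp add: DERIV_deriv_iff_real_differentiable)
  have "\<bar>f a - f b\<bar> \<le> C * \<bar>a - b\<bar>" for a b
    using field_differentiable_bound[of UNIV f "deriv f" C a b] der C by auto
  moreover have "continuous_on UNIV f"
    using der by (meson DERIV_isCont continuous_at_imp_continuous_on)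
  then have "f \<in> borel_measurable borel"
    by (rule borel_measurable_continuous_onI)
  moreover have "0 \<le> C" using C[of 0] by simp
  ultimately show thesis using that B C by blast
qed

text \<open>Hoelder continuity on the open set \<^term>\<open>D\<close> and vanishing outside give a Borel
  function.\<close>

lemma boundary_function_measurable:
  fixes \<omega> :: "real^'n \<Rightarrow> real"
  assumes "boundary_function \<gamma> \<epsilon> D \<omega>" "0 < \<gamma>" "open D"
  shows "\<omega> \<in> borel_measurable borel"
proof -
  obtain L where L: "\<And>x y. x \<in> D \<Longrightarrow> y \<in> D \<Longrightarrow> \<bar>\<omega> x - \<omega> y\<bar> \<le> L * dist x y powr \<gamma>"
    using assms(1) unfolding boundary_function_def holder_space_def by blast
  have out: "\<And>x. x \<notin> D \<Longrightarrow> \<omega> x = 0"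
    using assms(1) unfolding boundary_function_def by blast
  have "continuous_on D \<omega>"
    unfolding continuous_on_def
  proof
    fix x assume x: "x \<in> D"
    have "((\<lambda>y. dist y x) \<longlongrightarrow> 0) (at x within D)"
      by (auto intro!: tendsto_eq_intros)
    then have "((\<lambda>y. dist y x powr \<gamma>) \<longlongrightarrow> 0) (at x within D)"
      by (rule tendsto_zero_powrI[OF _ tendsto_const]) (simp_all add: assms(2))
    from tendsto_mult[OF tendsto_const[of L] this]
    have lim: "((\<lambda>y. L * dist y x powr \<gamma>) \<longlongrightarrow> 0) (at x within D)"
      by simp
    have "\<forall>\<^sub>F y in at x within D. norm (\<omega> y - \<omega> x) \<le> L * dist y x powr \<gamma>"
      unfolding eventually_at_filter by (rule always_eventually) (simp add: L x)
    then have "((\<lambda>y. \<omega> y - \<omega> x) \<longlongrightarrow> 0) (at x within D)"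
      using lim by (rule Lim_null_comparison)
    then show "(\<omega> \<longlongrightarrow> \<omega> x) (at x within D)"
      by (simp add: LIM_zero_iff)
  qed
  then have "(\<lambda>x. indicator D x *\<^sub>R \<omega> x) \<in> borel_measurable borel"
    using assms(3) by (intro borel_measurable_continuous_on_indicator) auto
  also have "(\<lambda>x. indicator D x *\<^sub>R \<omega> x) = \<omega>"
    using out by (auto simp: indicator_def fun_eq_iff)
  finally show ?thesis .
qed

lemma influence_function_norm_measurable:
  assumes "influence_function J"
  shows "(\<lambda>\<xi>::real^'n. J (norm \<xi>)) \<in> borel_measurable borel"
proof -
  have "J \<in> borel_measurable (restrict_space borel {0..})"
    using assms by (simp add: influence_function_def)
  moreover have "(norm :: real^'n \<Rightarrow> real) \<in> measurable borel (restrict_space borel {0..})"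
    by (rule measurable_restrict_space2) auto
  ultimately show ?thesis
    by (rule measurable_compose[rotated])
qed

section \<open>Energy balance along a semi-discrete motion\<close>

text \<open>A solution together with its velocities. The properties of \<^term>\<open>f\<close> are common to both
  energy bounds and belong to the context, whereas \<^term>\<open>g\<close> is either convex-concave or quadratic and
  is constrained in the two lemmas.\<close>

locale semidiscrete_motion = peridynamic_grid D J \<omega> \<epsilon> M h
  for D :: "(real^'n) set" and J \<omega> \<epsilon> M h +
  fixes f g :: "real \<Rightarrow> real" and T :: real
    and b :: "real \<Rightarrow> real^'n \<Rightarrow> real^'n" and w w' :: "int^'n \<Rightarrow> real \<Rightarrow> real^'n"
    and Bf Cf :: real
  assumes T_pos: "0 < T"
    and velocity: "\<And>i t. i \<in> cells \<Longrightarrow> t \<in> {0..T} \<Longrightarrow>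
          (w i has_vector_derivative w' i t) (at t within {0..T})"
    and acceleration: "\<And>i t. i \<in> cells \<Longrightarrow> t \<in> {0..T} \<Longrightarrow>
          (w' i has_vector_derivative
             force \<epsilon> J \<omega> f g (pc_extension D h (\<lambda>j. w j t)) (grid_point h i) + b t (grid_point h i))
            (at t within {0..T})"
    and f_zero: "f 0 = 0" and f_nonneg: "\<And>r. 0 \<le> f r" and f_bounded: "\<And>r. \<bar>f r\<bar> \<le> Bf"
    and Cf_nonneg: "0 \<le> Cf" and f'_bounded: "\<And>r. \<bar>deriv f r\<bar> \<le> Cf"
    and f_lipschitz: "\<And>p q. \<bar>f p - f q\<bar> \<le> Cf * \<bar>p - q\<bar>"
    and f_measurable: "f \<in> borel_measurable borel"
begin

definition U :: "real \<Rightarrow> real^'n \<Rightarrow> real^'n" where "U t = pc (\<lambda>i. w i t)"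
definition speed :: "real \<Rightarrow> real" where "speed t = grid_norm (\<lambda>i. w' i t)"
definition path_length :: "real \<Rightarrow> real" where "path_length t = integral {0..t} speed"
definition load :: "real \<Rightarrow> real" where "load t = grid_norm (\<lambda>i. b t (grid_point h i))"

text \<open>The rate at which force and load increase the kinetic energy. The force is evaluated at grid points, as in
  the equation of motion.\<close>

definition supplied_power :: "real \<Rightarrow> real" where
  "supplied_power t = (\<Sum>i\<in>cells. cell_mass i *
     (w' i t \<bullet> (force \<epsilon> J \<omega> f g (U t) (grid_point h i) + b t (grid_point h i))))"

lemma U_bounded_field: "bounded_field (U t)"
  unfolding U_def by (rule pc_extension_bounded_field)

lemma speed_nonneg: "0 \<le> speed t"
  by (simp add: speed_def grid_norm_nonneg)

lemma load_nonneg: "0 \<le> load t"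
  by (simp add: load_def grid_norm_nonneg)

lemma velocity_continuous: "i \<in> cells \<Longrightarrow> continuous_on {0..T} (w' i)"
  unfolding continuous_on_eq_continuous_within
  by (blast intro: has_vector_derivative_continuous acceleration)

lemma speed_continuous: "continuous_on {0..T} speed"
  unfolding speed_def grid_norm_def by (intro continuous_intros velocity_continuous)

lemma path_length_zero: "path_length 0 = 0"
  by (simp add: path_length_def)

lemma path_length_derivative:
  assumes "t \<in> {0..T}"
  shows "(path_length has_real_derivative speed t) (at t within {0..T})"
  unfolding path_length_def using assms by (intro integral_has_real_derivative speed_continuous)

lemma path_length_nonneg:
  assumes "t \<in> {0..T}"
  shows "0 \<le> path_length t"
  unfolding path_length_def
  by (rule integral_nonneg[OF integrable_continuous_real[OF continuous_on_subset[OF speed_continuous]]])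
     (use assms speed_nonneg in auto)

lemma displacement_le_path_length:
  assumes "t \<in> {0..T}"
  shows "grid_norm (\<lambda>i. w i t - w i 0) \<le> path_length t"
  unfolding path_length_def speed_def grid_norm_def
  by (rule weighted_displacement_le_integral_velocity[OF cell_mass_nonneg assms velocity velocity_continuous])

lemma modulus_displacement_L2:
  assumes "t \<in> {0..T}"
  shows "(\<integral>\<^sup>+x. modulus (\<lambda>x. U t x - U 0 x) x ^ 2 \<partial>lborel) \<le> ennreal ((path_length t)\<^sup>2)"
proof -
  have "(\<integral>\<^sup>+x. modulus (\<lambda>x. U t x - U 0 x) x ^ 2 \<partial>lborel) \<le> ennreal ((grid_norm (\<lambda>i. w i t - w i 0))\<^sup>2)"
    unfolding U_def by (rule modulus_pc_diff_L2)
  also have "\<dots> \<le> ennreal ((path_length t)\<^sup>2)"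
    by (intro ennreal_leI power_mono displacement_le_path_length assms grid_norm_nonneg)
  finally show ?thesis .
qed

lemma velocity_U:
  assumes "t \<in> {0..T}"
  shows "velocity T U t = pc (\<lambda>i. w' i t)"
proof
  fix x
  have "((\<lambda>s. U s x) has_vector_derivative pc (\<lambda>i. w' i t) x) (at t within {0..T})"
    unfolding U_def pc_extension_sum
    by (intro has_vector_derivative_sum bounded_linear.has_vector_derivative[OF bounded_linear_scaleR_right] velocity assms)
  then show "Defs.velocity T U t x = pc (\<lambda>i. w' i t) x"
    unfolding velocity_def using T_pos assms
    by (intro vector_derivative_within_closed_interval) auto
qed

lemma total_energy_eq:
  assumes "t \<in> {0..T}"
  shows "total_energy D \<epsilon> J \<omega> f g T U t = 1/2 * (speed t)\<^sup>2 + bond_energy f (U t) + dilation_energy g (U t)"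
  unfolding total_energy_def velocity_U[OF assms] L2_norm_on_pc_extension
    potential_energy_eq[OF f_zero f_measurable bounded_field_measurable[OF U_bounded_field]]
  by (simp add: speed_def)

lemma half_square_sum_derivative:
  fixes z z' :: "int^'n \<Rightarrow> real \<Rightarrow> real^'n"
  assumes "\<And>i. i \<in> cells \<Longrightarrow> (z i has_vector_derivative z' i t) (at t within {0..T})"
  shows "((\<lambda>t. 1/2 * (grid_norm (\<lambda>i. z i t))\<^sup>2) has_real_derivative
            (\<Sum>i\<in>cells. cell_mass i * (z i t \<bullet> z' i t))) (at t within {0..T})"
proof -
  have "((\<lambda>t. \<Sum>i\<in>cells. cell_mass i * (z i t \<bullet> z i t)) has_vector_derivative
      (\<Sum>i\<in>cells. cell_mass i * (z i t \<bullet> z' i t + z' i t \<bullet> z i t))) (at t within {0..T})"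
    by (intro has_vector_derivative_sum has_vector_derivative_mult_right
        bounded_bilinear.has_vector_derivative[OF bounded_bilinear_inner] assms)
  then have "((\<lambda>t. 1/2 * (\<Sum>i\<in>cells. cell_mass i * (z i t \<bullet> z i t))) has_vector_derivative
      1/2 * (\<Sum>i\<in>cells. cell_mass i * (z i t \<bullet> z' i t + z' i t \<bullet> z i t))) (at t within {0..T})"
    by (rule has_vector_derivative_mult_right)
  then show ?thesis
    unfolding grid_norm_square has_real_derivative_iff_has_vector_derivative power2_norm_eq_inner
    by (simp add: sum_distrib_left inner_commute[of "z' _ _"] algebra_simps)
qed

lemma kinetic_derivative:
  assumes "t \<in> {0..T}"
  shows "((\<lambda>t. 1/2 * (speed t)\<^sup>2) has_real_derivative supplied_power t) (at t within {0..T})"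
  unfolding speed_def supplied_power_def U_def
  by (rule half_square_sum_derivative) (rule acceleration[OF _ assms])

lemma supplied_power_le:
  "supplied_power t \<le> (\<Sum>i\<in>cells. cell_mass i * (norm (force_T \<epsilon> J \<omega> f (U t) (grid_point h i)) * norm (w' i t)))
     + (\<Sum>i\<in>cells. cell_mass i * (norm (force_D \<epsilon> J \<omega> g (U t) (grid_point h i)) * norm (w' i t)))
     + load t * speed t"
proof -
  let ?FT = "\<lambda>i. force_T \<epsilon> J \<omega> f (U t) (grid_point h i)"
  let ?FD = "\<lambda>i. force_D \<epsilon> J \<omega> g (U t) (grid_point h i)"
  let ?b = "\<lambda>i. b t (grid_point h i)"
  have "supplied_power t \<le> (\<Sum>i\<in>cells. cell_mass i * (norm (?FT i) * norm (w' i t) + norm (?FD i) * norm (w' i t) + norm (?b i) * norm (w' i t)))"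
    unfolding supplied_power_def
  proof (intro sum_mono mult_left_mono cell_mass_nonneg)
    fix i
    have "w' i t \<bullet> (force \<epsilon> J \<omega> f g (U t) (grid_point h i) + ?b i) = w' i t \<bullet> ?FT i + w' i t \<bullet> ?FD i + w' i t \<bullet> ?b i"
      by (simp add: force_def inner_add_right)
    also have "\<dots> \<le> norm (w' i t) * norm (?FT i) + norm (w' i t) * norm (?FD i) + norm (w' i t) * norm (?b i)"
      by (intro add_mono norm_cauchy_schwarz)
    finally show "w' i t \<bullet> (force \<epsilon> J \<omega> f g (U t) (grid_point h i) + ?b i)
        \<le> norm (?FT i) * norm (w' i t) + norm (?FD i) * norm (w' i t) + norm (?b i) * norm (w' i t)"
      by (simp only: mult.commute)
  qed
  also have "\<dots> = (\<Sum>i\<in>cells. cell_mass i * (norm (?FT i) * norm (w' i t)))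
     + (\<Sum>i\<in>cells. cell_mass i * (norm (?FD i) * norm (w' i t)))
     + (\<Sum>i\<in>cells. cell_mass i * (norm (?b i) * norm (w' i t)))"
    by (simp only: distrib_left sum.distrib)
  also have "\<dots> \<le> (\<Sum>i\<in>cells. cell_mass i * (norm (?FT i) * norm (w' i t)))
     + (\<Sum>i\<in>cells. cell_mass i * (norm (?FD i) * norm (w' i t))) + load t * speed t"
    unfolding load_def speed_def by (intro add_left_mono grid_cauchy_schwarz)
  finally show ?thesis .
qed

definition bond_constant :: real where
  "bond_constant = 2 * M * Cf * inverse_sqrt_mass TYPE('n) / unit_vol TYPE('n) * sqrt (measure lborel D)"

lemma bond_constant_nonneg: "0 \<le> bond_constant"
  unfolding bond_constant_def using M_nonneg Cf_nonneg inverse_sqrt_mass_nonneg[where 'n = 'n] vol_pos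
  by simp

lemma force_T_power_le:
  "(\<Sum>i\<in>cells. cell_mass i * (norm (force_T \<epsilon> J \<omega> f (U t) (grid_point h i)) * norm (w' i t)))
     \<le> bond_constant / \<epsilon>\<^sup>2 * speed t"
proof -
  define c where "c = 2 * M * Cf * inverse_sqrt_mass TYPE('n) / unit_vol TYPE('n) / \<epsilon>\<^sup>2"
  have c: "0 \<le> c"
    unfolding c_def using M_nonneg Cf_nonneg inverse_sqrt_mass_nonneg[where 'n = 'n] vol_pos by simp
  have "(\<Sum>i\<in>cells. cell_mass i * (norm (force_T \<epsilon> J \<omega> f (U t) (grid_point h i)) * norm (w' i t)))
      \<le> (\<Sum>i\<in>cells. cell_mass i * (c * norm (w' i t)))"
    unfolding c_def
    by (intro sum_mono mult_left_mono mult_right_mono norm_force_T_le f'_bounded cell_mass_nonneg) auto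
  also have "\<dots> \<le> c * sqrt (measure lborel D) * speed t"
    unfolding speed_def by (rule sum_bounded_times_norm_le[OF c])
  finally show ?thesis by (simp add: c_def bond_constant_def)
qed

text \<open>The bond part of the majorant: the energy is controlled by the distance travelled, without differentiating
  it in time.\<close>

lemma bond_energy_le:
  assumes "t \<in> {0..T}"
  shows "bond_energy f (U t) \<le> bond_energy f (U 0) + bond_constant / \<epsilon>\<^sup>2 * path_length t"
proof -
  have "\<bar>bond_energy f (U t) - bond_energy f (U 0)\<bar>
      \<le> 2 * M * Cf * inverse_sqrt_mass TYPE('n) * sqrt (measure lborel D) / unit_vol TYPE('n) / \<epsilon>\<^sup>2 * path_length t"
    by (rule bond_energy_lipschitz[OF f_lipschitz Cf_nonneg f_bounded f_measurable U_bounded_field U_bounded_field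
          modulus_displacement_L2[OF assms] path_length_nonneg[OF assms]])
  also have "\<dots> = bond_constant / \<epsilon>\<^sup>2 * path_length t"
    by (simp add: bond_constant_def)
  finally show ?thesis by simp
qed

section \<open>The two energy bounds\<close>

text \<open>The constant \<open>C\<close> occurs twice, once for the increment of the potential energy along the path
  and once for the power of the force; hence the factor two.\<close>

lemma energy_bound_convex_concave:
  assumes g: "\<And>r. 0 \<le> g r" "\<And>r. \<bar>g r\<bar> \<le> Bg" "0 \<le> Cg" "\<And>r. \<bar>deriv g r\<bar> \<le> Cg"
      "\<And>p q. \<bar>g p - g q\<bar> \<le> Cg * \<bar>p - q\<bar>" "g \<in> borel_measurable borel"
    and int: "set_integrable lborel {0..T} load" and t: "t \<in> {0..T}"
  shows "total_energy D \<epsilon> J \<omega> f g T U t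
    \<le> (sqrt (total_energy D \<epsilon> J \<omega> f g T U 0)
        + t * (2 * (bond_constant + 2 * M * Cg * sqrt (measure lborel D))) / \<epsilon>\<^sup>2 + (LBINT s:{0..t}. load s))\<^sup>2"
proof -
  define C where "C = (bond_constant + 2 * M * Cg * sqrt (measure lborel D)) / \<epsilon>\<^sup>2"
  have C: "0 \<le> C"
    unfolding C_def using bond_constant_nonneg M_nonneg g(3) by simp
  define P0 where "P0 = bond_energy f (U 0) + dilation_energy g (U 0)"
  have P0: "0 \<le> P0"
    unfolding P0_def using bond_energy_nonneg[OF f_nonneg] dilation_energy_nonneg[OF g(1)] by simp
  \<comment> \<open>The majorant: kinetic energy, initial potential energy, and the Lipschitz bound for the increment
    of the potential energy.\<close>
  define E where "E s = 1/2 * (speed s)\<^sup>2 + P0 + C * path_length s" for s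
  define k where "k s = 2 * C + load s" for s
  have zero: "(0::real) \<in> {0..T}" using T_pos by simp
  have E_nonneg: "0 \<le> E s" if "s \<in> {0..T}" for s
    unfolding E_def using P0 C path_length_nonneg[OF that] by simp
  have le: "total_energy D \<epsilon> J \<omega> f g T U t \<le> E t"
  proof -
    have "\<bar>dilation_energy g (U t) - dilation_energy g (U 0)\<bar>
        \<le> 2 * M * Cg * sqrt (measure lborel D) / \<epsilon>\<^sup>2 * path_length t"
      by (rule dilation_energy_lipschitz[OF g(5,3,2,6) U_bounded_field U_bounded_field
            modulus_displacement_L2[OF t] path_length_nonneg[OF t]])
    then have "dilation_energy g (U t) \<le> dilation_energy g (U 0) + 2 * M * Cg * sqrt (measure lborel D) / \<epsilon>\<^sup>2 * path_length t"
      by simp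
    then show ?thesis
      using bond_energy_le[OF t]
      unfolding total_energy_eq[OF t] E_def P0_def C_def by (simp add: add_divide_distrib distrib_right)
  qed
  have eq0: "E 0 = total_energy D \<epsilon> J \<omega> f g T U 0"
    unfolding total_energy_eq[OF zero] E_def P0_def path_length_zero by simp
  have k_int: "set_integrable lborel {0..s} load" if "s \<in> {0..T}" for s
    by (rule set_integrable_subset[OF int]) (use that in auto)
  have const_int: "set_integrable lborel {0..s} (\<lambda>_. c :: real)" for s c :: real
    by (rule borel_integrable_atLeastAtMost') simp
  have "E t \<le> (sqrt (E 0) + (LBINT s:{0..t}. k s))\<^sup>2"
  proof (rule sqrt_growth_bound[OF t])
    fix s assume s: "s \<in> {0..T}"
    show "(E has_real_derivative supplied_power s + C * speed s) (at s within {0..T})"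
      unfolding E_def
      by (rule derivative_eq_intros kinetic_derivative[OF s] path_length_derivative[OF s] refl | simp)+
    have FD: "(\<Sum>i\<in>cells. cell_mass i * (norm (force_D \<epsilon> J \<omega> g (U s) (grid_point h i)) * norm (w' i s)))
        \<le> 2 * M * Cg / \<epsilon>\<^sup>2 * sqrt (measure lborel D) * speed s"
    proof -
      have "(\<Sum>i\<in>cells. cell_mass i * (norm (force_D \<epsilon> J \<omega> g (U s) (grid_point h i)) * norm (w' i s)))
          \<le> (\<Sum>i\<in>cells. cell_mass i * (2 * M * Cg / \<epsilon>\<^sup>2 * norm (w' i s)))"
        by (intro sum_mono mult_left_mono mult_right_mono norm_force_D_le g cell_mass_nonneg) auto
      also have "\<dots> \<le> 2 * M * Cg / \<epsilon>\<^sup>2 * sqrt (measure lborel D) * speed s"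
        unfolding speed_def using M_nonneg g(3) by (intro sum_bounded_times_norm_le) auto
      finally show ?thesis .
    qed
    have "supplied_power s \<le> bond_constant / \<epsilon>\<^sup>2 * speed s + 2 * M * Cg / \<epsilon>\<^sup>2 * sqrt (measure lborel D) * speed s + load s * speed s"
      using supplied_power_le[of s] force_T_power_le[of s] FD by linarith
    also have "\<dots> = C * speed s + load s * speed s"
      unfolding C_def by (simp add: add_divide_distrib distrib_right)
    finally have "supplied_power s + C * speed s \<le> k s * speed s"
      by (simp add: k_def distrib_right)
    also have "\<dots> \<le> k s * sqrt (2 * E s)"
    proof (rule mult_left_mono)
      show "speed s \<le> sqrt (2 * E s)"
        by (rule real_le_rsqrt) (use P0 C path_length_nonneg[OF s] in \<open>simp add: E_def\<close>)
      show "0 \<le> k s" using C load_nonneg by (simp add: k_def)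
    qed
    finally show "supplied_power s + C * speed s \<le> k s * sqrt (2 * E s)" .
  next
    show "set_integrable lborel {0..T} k"
      unfolding k_def by (intro set_integral_add int const_int)
  qed (use E_nonneg C load_nonneg in \<open>auto simp: k_def\<close>)
  also have "(LBINT s:{0..t}. k s) = t * (2 * C) + (LBINT s:{0..t}. load s)"
    unfolding k_def set_integral_add(2)[OF const_int k_int[OF t]]
    using t by (simp add: set_lebesgue_integral_def)
  finally show ?thesis
    using le by (simp add: eq0 C_def add.assoc)
qed

text \<open>The constant \<^term>\<open>C\<^sub>1\<close> collects the bond part, which enters once through the energy
  and once through the force. In \<^term>\<open>C\<^sub>2\<close> the first summand comes from the growth of the
  dilatational energy and the second one from the power of the dilatational force.\<close>

lemma augmented_energy_bound_quadratic:
  assumes g: "\<And>r. g r = \<beta> * r\<^sup>2 / 2" and \<beta>: "0 < \<beta>"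
    and int: "set_integrable lborel {0..T} (\<lambda>s. (load s)\<^sup>2)" and t: "t \<in> {0..T}"
    and C\<^sub>1: "C\<^sub>1 = 2 * bond_constant"
    and C\<^sub>2: "C\<^sub>2 = 2 * M * (1 + \<beta>) + \<beta> * M\<^sup>2 * (3 * (2 + real CARD('n)) ^ CARD('n) + 1)"
  shows "augmented_energy D \<epsilon> J \<omega> f g T U t
    \<le> exp (3 * (C\<^sub>2 / \<epsilon>\<^sup>2 + 1) * t) *
        (augmented_energy D \<epsilon> J \<omega> f g T U 0 +
         (LBINT s:{0..T}. (C\<^sub>1\<^sup>2 / \<epsilon>^4 + (load s)\<^sup>2) * exp (- (3 * (C\<^sub>2 / \<epsilon>\<^sup>2 + 1)) * s)))"
proof -
  define c\<^sub>3 where "c\<^sub>3 = \<beta> * M\<^sup>2 * (3 * (2 + real CARD('n)) ^ CARD('n) + 1)"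
  have c\<^sub>3: "0 \<le> c\<^sub>3" using \<beta> by (simp add: c\<^sub>3_def)
  have g': "deriv g r = \<beta> * r" for r
  proof -
    have "(g has_real_derivative \<beta> * r) (at r)"
      unfolding g[abs_def] by (auto intro!: derivative_eq_intros)
    then show ?thesis by (rule DERIV_imp_deriv)
  qed
  define N where "N s = sqrt (LBINT x:D. \<omega> x * (\<theta> (U s) x)\<^sup>2)" for s
  have N_nonneg: "0 \<le> N s" for s
    unfolding N_def by (intro real_sqrt_ge_zero set_integral_nonneg_real) (simp add: \<omega>_nonneg)
  have dil: "dilation_energy g (U s) = \<beta> / (2 * \<epsilon>\<^sup>2) * (N s)\<^sup>2" for s
  proof -
    have "(N s)\<^sup>2 = (LBINT x:D. \<omega> x * (\<theta> (U s) x)\<^sup>2)"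
      unfolding N_def by (intro real_sqrt_pow2 set_integral_nonneg_real) (simp add: \<omega>_nonneg)
    moreover have "dilation_energy g (U s) = (LBINT x:D. \<beta> / (2 * \<epsilon>\<^sup>2) * (\<omega> x * (\<theta> (U s) x)\<^sup>2))"
      unfolding dilation_energy_def by (simp add: g mult_ac)
    ultimately show ?thesis by simp
  qed
  \<comment> \<open>An affine function of the path length that dominates the seminorm of the strain; its square
    replaces the dilatational energy in the majorant.\<close>
  define q where "q s = N 0 + 2 * M * path_length s" for s
  define size where "size s = grid_norm (\<lambda>i. w i s)" for s
  define B0 where "B0 = bond_energy f (U 0)"
  define a where "a = bond_constant / \<epsilon>\<^sup>2"
  have a: "0 \<le> a" unfolding a_def using bond_constant_nonneg by simp
  have B0: "0 \<le> B0" unfolding B0_def by (rule bond_energy_nonneg[OF f_nonneg])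
  define E where "E s = 1/2 * (speed s)\<^sup>2 + (B0 + a * path_length s)
      + \<beta> / (2 * \<epsilon>\<^sup>2) * (q s)\<^sup>2 + 1/2 * (size s)\<^sup>2" for s
  define K where "K = 3 * (C\<^sub>2 / \<epsilon>\<^sup>2 + 1)"
  define r where "r s = C\<^sub>1\<^sup>2 / \<epsilon>^4 + (load s)\<^sup>2" for s
  have zero: "(0::real) \<in> {0..T}" using T_pos by simp
  have aug: "augmented_energy D \<epsilon> J \<omega> f g T U s = 1/2 * (speed s)\<^sup>2 + bond_energy f (U s)
      + \<beta> / (2 * \<epsilon>\<^sup>2) * (N s)\<^sup>2 + 1/2 * (size s)\<^sup>2" if "s \<in> {0..T}" for s
    unfolding augmented_energy_def total_energy_eq[OF that] dil
    by (simp add: size_def U_def L2_norm_on_pc_extension)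
  have Nq: "N s \<le> q s" if "s \<in> {0..T}" for s
    unfolding N_def q_def
    by (rule weighted_strain_L2_lipschitz[OF U_bounded_field U_bounded_field
          modulus_displacement_L2[OF that] path_length_nonneg[OF that]])
  have le: "augmented_energy D \<epsilon> J \<omega> f g T U t \<le> E t"
  proof -
    have "\<beta> / (2 * \<epsilon>\<^sup>2) * (N t)\<^sup>2 \<le> \<beta> / (2 * \<epsilon>\<^sup>2) * (q t)\<^sup>2"
      using \<beta> by (intro mult_left_mono power_mono Nq[OF t] N_nonneg) auto
    then show ?thesis
      using bond_energy_le[OF t] unfolding aug[OF t] E_def B0_def a_def by simp
  qed
  have eq0: "E 0 = augmented_energy D \<epsilon> J \<omega> f g T U 0"
    unfolding aug[OF zero] E_def B0_def q_def path_length_zero by simp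
  have "E t \<le> exp (K * t) * (E 0 + (LBINT s:{0..T}. r s * exp (- K * s)))"
  proof (rule gronwall_bound[OF t])
    fix s assume s: "s \<in> {0..T}"
    define sp where "sp = (\<Sum>i\<in>cells. cell_mass i * (w i s \<bullet> w' i s))"
    show "(E has_real_derivative supplied_power s + a * speed s + \<beta> / (2 * \<epsilon>\<^sup>2) * (2 * q s * (2 * M * speed s)) + sp)
        (at s within {0..T})"
    proof -
      have "((\<lambda>s. 1/2 * (size s)\<^sup>2) has_real_derivative sp) (at s within {0..T})"
        unfolding size_def sp_def by (rule half_square_sum_derivative) (rule velocity[OF _ s])
      moreover have "((\<lambda>s. \<beta> / (2 * \<epsilon>\<^sup>2) * (q s)\<^sup>2) has_real_derivative
          \<beta> / (2 * \<epsilon>\<^sup>2) * (2 * q s * (2 * M * speed s))) (at s within {0..T})"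
        unfolding q_def
        by (rule derivative_eq_intros path_length_derivative[OF s] refl | simp)+
      moreover have "((\<lambda>s. B0 + a * path_length s) has_real_derivative a * speed s) (at s within {0..T})"
        by (rule derivative_eq_intros path_length_derivative[OF s] refl | simp)+
      ultimately show ?thesis
        unfolding E_def by (intro DERIV_add kinetic_derivative[OF s])
    qed
    have sp: "sp \<le> size s * speed s"
    proof -
      have "sp \<le> (\<Sum>i\<in>cells. cell_mass i * (norm (w i s) * norm (w' i s)))"
        unfolding sp_def by (intro sum_mono mult_left_mono norm_cauchy_schwarz cell_mass_nonneg)
      also have "\<dots> \<le> size s * speed s"
        unfolding size_def speed_def by (rule grid_cauchy_schwarz)
      finally show ?thesis .
    qed
    have FD: "(\<Sum>i\<in>cells. cell_mass i * (norm (force_D \<epsilon> J \<omega> g (U s) (grid_point h i)) * norm (w' i s)))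
        \<le> c\<^sub>3 / \<epsilon>\<^sup>2 * size s * speed s"
      unfolding U_def c\<^sub>3_def size_def speed_def
      by (rule sum_force_D_quadratic_le[OF g']) (use \<beta> in simp)
    define V where "V = speed s"
    define S where "S = size s"
    define L where "L = load s"
    define Q where "Q = q s"
    have nn: "0 \<le> V" "0 \<le> S" "0 \<le> L" "0 \<le> Q"
      using N_nonneg[of 0] M_nonneg path_length_nonneg[OF s]
      by (simp_all add: V_def S_def L_def Q_def speed_nonneg load_nonneg size_def grid_norm_nonneg q_def)
    have E1: "1/2 * V\<^sup>2 + \<beta> / (2 * \<epsilon>\<^sup>2) * Q\<^sup>2 + 1/2 * S\<^sup>2 \<le> E s"
      using B0 a path_length_nonneg[OF s] by (simp add: E_def V_def Q_def S_def)
    have q2: "0 \<le> \<beta> / (2 * \<epsilon>\<^sup>2) * Q\<^sup>2" using \<beta> by simp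
    have VE: "1/2 * V\<^sup>2 \<le> E s" using E1 q2 zero_le_power2[of S] by linarith
    have young: "x * y \<le> 1/2 * x\<^sup>2 + 1/2 * y\<^sup>2" for x y :: real
      using sum_squares_bound[of x y] by simp
    have SV: "S * V \<le> E s"
      using young[of S V] E1 q2 by linarith
    \<comment> \<open>Each product in the derivative is split by Young's inequality; the resulting squares are parts
      of the majorant.\<close>
    have t1: "2 * a * V \<le> 1/2 * (C\<^sub>1\<^sup>2 / \<epsilon>^4) + E s"
    proof -
      have "2 * a * V \<le> 1/2 * (2 * a)\<^sup>2 + 1/2 * V\<^sup>2" by (rule young)
      moreover have "(2 * a)\<^sup>2 = C\<^sub>1\<^sup>2 / \<epsilon>^4"
        by (simp add: a_def C\<^sub>1 power_mult_distrib power_divide flip: power_mult)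
      ultimately show ?thesis using VE by linarith
    qed
    have t2: "L * V \<le> 1/2 * L\<^sup>2 + E s" using young[of L V] VE by linarith
    have t3: "c\<^sub>3 / \<epsilon>\<^sup>2 * S * V \<le> c\<^sub>3 / \<epsilon>\<^sup>2 * E s"
      using c\<^sub>3 SV by (simp add: mult.assoc mult_left_mono divide_right_mono)
    have t4: "\<beta> / (2 * \<epsilon>\<^sup>2) * (2 * Q * (2 * M * V)) \<le> 2 * M * (1 + \<beta>) / \<epsilon>\<^sup>2 * E s"
    proof -
      have "\<epsilon>\<^sup>2 \<le> 1" using \<epsilon>_pos \<epsilon>_less_1 by (simp add: power_le_one)
      \<comment> \<open>The factor $1/\epsilon^2$ of the dilatational energy may be dropped here, as $\epsilon <
        1$.\<close>
      then have "\<beta> / 2 * Q\<^sup>2 \<le> \<beta> / (2 * \<epsilon>\<^sup>2) * Q\<^sup>2"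
        using \<beta> \<epsilon>_pos by (intro mult_right_mono divide_left_mono) auto
      then have Q2: "\<beta> * (1/2 * Q\<^sup>2) \<le> E s"
      proof -
        have "\<beta> * (1/2 * Q\<^sup>2) = \<beta> / 2 * Q\<^sup>2" by simp
        then show ?thesis
          using \<open>\<beta> / 2 * Q\<^sup>2 \<le> \<beta> / (2 * \<epsilon>\<^sup>2) * Q\<^sup>2\<close> E1 zero_le_power2[of V] zero_le_power2[of S] by linarith
      qed
      have "\<beta> * (Q * V) \<le> \<beta> * (1/2 * Q\<^sup>2 + 1/2 * V\<^sup>2)"
        using \<beta> by (intro mult_left_mono young) auto
      also have "\<dots> \<le> E s + \<beta> * E s"
        using Q2 VE \<beta> by (simp add: distrib_left add_mono mult_left_mono)
      finally have "2 * M / \<epsilon>\<^sup>2 * (\<beta> * (Q * V)) \<le> 2 * M / \<epsilon>\<^sup>2 * (E s + \<beta> * E s)"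
        using M_nonneg by (intro mult_left_mono) auto
      moreover have "2 * M / \<epsilon>\<^sup>2 * (\<beta> * (Q * V)) = \<beta> / (2 * \<epsilon>\<^sup>2) * (2 * Q * (2 * M * V))"
        by simp
      moreover have "2 * M / \<epsilon>\<^sup>2 * (E s + \<beta> * E s) = 2 * M * (1 + \<beta>) / \<epsilon>\<^sup>2 * E s"
        by (simp add: algebra_simps)
      ultimately show ?thesis by linarith
    qed
    have C2E: "C\<^sub>2 / \<epsilon>\<^sup>2 * E s = 2 * M * (1 + \<beta>) / \<epsilon>\<^sup>2 * E s + c\<^sub>3 / \<epsilon>\<^sup>2 * E s"
      by (simp add: C\<^sub>2 c\<^sub>3_def add_divide_distrib distrib_right)
    have E_nonneg: "0 \<le> E s" using VE zero_le_power2[of V] by linarith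
    have C2E_nonneg: "0 \<le> C\<^sub>2 / \<epsilon>\<^sup>2 * E s"
      using E_nonneg c\<^sub>3 M_nonneg \<beta> unfolding C\<^sub>2 c\<^sub>3_def[symmetric]
      by (intro mult_nonneg_nonneg divide_nonneg_nonneg add_nonneg_nonneg) auto
    have KE: "K * E s = 3 * (C\<^sub>2 / \<epsilon>\<^sup>2 * E s) + 3 * E s"
      by (simp add: K_def algebra_simps)
    have "supplied_power s \<le> a * V + c\<^sub>3 / \<epsilon>\<^sup>2 * S * V + L * V"
      using supplied_power_le[of s] force_T_power_le[of s] FD unfolding a_def V_def S_def L_def by linarith
    moreover have "0 \<le> C\<^sub>1\<^sup>2 / \<epsilon>^4" by simp
    moreover have "0 \<le> L\<^sup>2" by simp
    moreover have "sp \<le> S * V" using sp by (simp add: S_def V_def)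
    moreover have "a * V + a * V = 2 * a * V" by simp
    ultimately have "supplied_power s + a * V + \<beta> / (2 * \<epsilon>\<^sup>2) * (2 * Q * (2 * M * V)) + sp
        \<le> K * E s + (C\<^sub>1\<^sup>2 / \<epsilon>^4 + L\<^sup>2)"
      using t1 t2 t3 t4 SV C2E C2E_nonneg KE by linarith
    then show "supplied_power s + a * speed s + \<beta> / (2 * \<epsilon>\<^sup>2) * (2 * q s * (2 * M * speed s)) + sp \<le> K * E s + r s"
      by (simp only: V_def Q_def L_def r_def)
  next
    show "0 \<le> r s" for s by (simp add: r_def)
    have "set_integrable lborel {0..T} (\<lambda>_. C\<^sub>1\<^sup>2 / \<epsilon>^4)"
      by (rule borel_integrable_atLeastAtMost') simp
    then show "set_integrable lborel {0..T} r"
      unfolding r_def by (intro set_integral_add int)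
  qed
  then show ?thesis
    using le unfolding eq0 K_def r_def by linarith
qed

end

text \<open>Every admissible choice of horizon, mesh, boundary function and data falls under the locale with the same
  constants \<^term>\<open>M\<close>, \<^term>\<open>Bf\<close> and \<^term>\<open>Cf\<close>, which is what makes the
  final constants uniform.\<close>

lemma semidiscrete_motionI:
  fixes D :: "(real^'n) set"
  assumes "open D" "bounded D" "influence_function J"
    and M: "\<forall>r. 0 \<le> r \<and> r < 1 \<longrightarrow> 0 \<le> J r \<and> J r \<le> M"
    and f: "convex_concave f" "0 \<le> Cf" "\<And>r. \<bar>f r\<bar> \<le> Bf" "\<And>r. \<bar>deriv f r\<bar> \<le> Cf"
      "\<And>p q. \<bar>f p - f q\<bar> \<le> Cf * \<bar>p - q\<bar>" "f \<in> borel_measurable borel"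
    and data: "0 < h" "h < \<epsilon>" "\<epsilon> < 1" "0 < T" "0 < \<gamma>" "boundary_function \<gamma> \<epsilon> D \<omega>"
    and sol: "semidiscrete_solution D h \<epsilon> J \<omega> f g T u\<^sub>0 v\<^sub>0 b w"
  obtains w' where "semidiscrete_motion D J \<omega> \<epsilon> M h f g T b w w' Bf Cf"
proof -
  have \<omega>: "\<And>x. x \<in> D \<Longrightarrow> 0 \<le> \<omega> x \<and> \<omega> x \<le> 1" "\<And>x. x \<notin> D \<Longrightarrow> \<omega> x = 0"
    using data(6) unfolding boundary_function_def by blast+
  interpret peridynamic_grid D J \<omega> \<epsilon> M h
  proof unfold_locales
    show "0 \<le> \<omega> x" "\<omega> x \<le> 1" for x
      using \<omega>[of x] by (cases "x \<in> D"; simp)+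
    show "\<omega> \<in> borel_measurable borel"
      by (rule boundary_function_measurable[OF data(6,5) assms(1)])
    show "(\<lambda>\<xi>::real^'n. J (norm \<xi>)) \<in> borel_measurable borel"
      by (rule influence_function_norm_measurable[OF assms(3)])
    show "0 \<le> J r" "J r \<le> M" if "0 \<le> r" "r < 1" for r
      using M that by blast+
    show "0 < \<epsilon>" using data(1,2) by (rule less_trans)
  qed (fact assms(1,2) data(1-3) \<omega>(2))+
  obtain w' where w': "\<And>i t. grid_point h i \<in> D \<Longrightarrow> t \<in> {0..T} \<Longrightarrow>
        (w i has_vector_derivative w' i t) (at t within {0..T}) \<and>
        (w' i has_vector_derivative
           force \<epsilon> J \<omega> f g (pc_extension D h (\<lambda>j. w j t)) (grid_point h i) + b t (grid_point h i))
          (at t within {0..T})"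
    using sol unfolding semidiscrete_solution_def by blast
  have "semidiscrete_motion D J \<omega> \<epsilon> M h f g T b w w' Bf Cf"
  proof unfold_locales
    show "f 0 = 0" using f(1) by (simp add: convex_concave_def)
    show "0 \<le> f r" for r by (rule convex_concave_nonneg[OF f(1)])
    fix i t assume "i \<in> cells" and t: "t \<in> {0..T}"
    then have "grid_point h i \<in> D" by (simp add: cells_def)
    from w'[OF this t] show "(w i has_vector_derivative w' i t) (at t within {0..T})"
      and "(w' i has_vector_derivative
           force \<epsilon> J \<omega> f g (pc_extension D h (\<lambda>j. w j t)) (grid_point h i) + b t (grid_point h i))
          (at t within {0..T})"
      by blast+
  qed (fact data(4) f(2-6))+
  then show thesis by (rule that)
qed

theorem theorem2:
  fixes D :: "(real^'n) set" and J f g :: "real \<Rightarrow> real"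
  assumes "CARD('n) = 2 \<or> CARD('n) = 3"
    and "open D" and "bounded D"
    and "influence_function J"
    and "convex_concave f" and "finite_C0_to_C3 f"
  shows
    "(convex_concave g \<and> finite_C0_to_C3 g \<longrightarrow>
       (\<exists>C\<ge>0. \<forall>(\<epsilon>::real) (h::real) (\<gamma>::real) (\<omega> :: real^'n \<Rightarrow> real) (T::real)
          (u\<^sub>0 :: real^'n \<Rightarrow> real^'n) (v\<^sub>0 :: real^'n \<Rightarrow> real^'n)
          (b :: real \<Rightarrow> real^'n \<Rightarrow> real^'n) (w :: int^'n \<Rightarrow> real \<Rightarrow> real^'n).
          let u = (\<lambda>t. pc_extension D h (\<lambda>i. w i t));
              bh = (\<lambda>t. pc_extension D h (\<lambda>i. b t (grid_point h i)))
          in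
            0 < h \<and> h < \<epsilon> \<and> \<epsilon> < 1 \<and> 0 < T \<and> 0 < \<gamma> \<and> \<gamma> \<le> 1 \<and>
            boundary_function \<gamma> \<epsilon> D \<omega> \<and>
            semidiscrete_solution D h \<epsilon> J \<omega> f g T u\<^sub>0 v\<^sub>0 b w \<and>
            set_integrable lborel {0..T} (\<lambda>s. L2_norm_on D (bh s)) \<longrightarrow>
            (\<forall>t\<in>{0..T}.
               total_energy D \<epsilon> J \<omega> f g T u t
                 \<le> (sqrt (total_energy D \<epsilon> J \<omega> f g T u 0) + t * C / \<epsilon>\<^sup>2
                     + (LBINT s:{0..t}. L2_norm_on D (bh s)))\<^sup>2)))
     \<and>
     (quadratic_potential g \<longrightarrow>
       (\<exists>C\<^sub>1\<ge>0. \<exists>C\<^sub>2\<ge>0. \<forall>(\<epsilon>::real) (h::real) (\<gamma>::real) (\<omega> :: real^'n \<Rightarrow> real) (T::real)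
          (u\<^sub>0 :: real^'n \<Rightarrow> real^'n) (v\<^sub>0 :: real^'n \<Rightarrow> real^'n)
          (b :: real \<Rightarrow> real^'n \<Rightarrow> real^'n) (w :: int^'n \<Rightarrow> real \<Rightarrow> real^'n).
          let u = (\<lambda>t. pc_extension D h (\<lambda>i. w i t));
              bh = (\<lambda>t. pc_extension D h (\<lambda>i. b t (grid_point h i)))
          in
            0 < h \<and> h < \<epsilon> \<and> \<epsilon> < 1 \<and> 0 < T \<and> 0 < \<gamma> \<and> \<gamma> \<le> 1 \<and>
            boundary_function \<gamma> \<epsilon> D \<omega> \<and>
            semidiscrete_solution D h \<epsilon> J \<omega> f g T u\<^sub>0 v\<^sub>0 b w \<and>
            set_integrable lborel {0..T} (\<lambda>s. (L2_norm_on D (bh s))\<^sup>2) \<longrightarrow>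
            (\<forall>t\<in>{0..T}.
               augmented_energy D \<epsilon> J \<omega> f g T u t
                 \<le> exp (3 * (C\<^sub>2 / \<epsilon>\<^sup>2 + 1) * t) *
                    (augmented_energy D \<epsilon> J \<omega> f g T u 0 +
                     (LBINT s:{0..T}. (C\<^sub>1\<^sup>2 / \<epsilon>^4 + (L2_norm_on D (bh s))\<^sup>2)
                         * exp (- 3 * (C\<^sub>2 / \<epsilon>\<^sup>2 + 1) * s))))))"
proof -
  obtain M where M: "\<forall>r. 0 \<le> r \<and> r < 1 \<longrightarrow> 0 \<le> J r \<and> J r \<le> M"
    using assms(4) unfolding influence_function_def by blast
  have M_nonneg: "0 \<le> M" using M[rule_format, of 0] by simp
  obtain Bf Cf where f: "0 \<le> Cf" "\<And>r. \<bar>f r\<bar> \<le> Bf" "\<And>r. \<bar>deriv f r\<bar> \<le> Cf"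
      "\<And>p q. \<bar>f p - f q\<bar> \<le> Cf * \<bar>p - q\<bar>" "f \<in> borel_measurable borel"
    using assms(6) by (rule finite_C0_to_C3E) (rule that)
  define k where "k = 2 * M * Cf * inverse_sqrt_mass TYPE('n) / unit_vol TYPE('n) * sqrt (measure lborel D)"
  have k: "0 \<le> k"
    unfolding k_def using M_nonneg f(1) inverse_sqrt_mass_nonneg[where 'n = 'n] unit_vol_pos[where 'n = 'n] by simp
  note motionI = semidiscrete_motionI[OF assms(2,3,4) M assms(5) f]
  show ?thesis
  proof (intro conjI impI)
    assume cg: "convex_concave g \<and> finite_C0_to_C3 g"
    obtain Bg Cg where g: "0 \<le> Cg" "\<And>r. \<bar>g r\<bar> \<le> Bg" "\<And>r. \<bar>deriv g r\<bar> \<le> Cg"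
        "\<And>p q. \<bar>g p - g q\<bar> \<le> Cg * \<bar>p - q\<bar>" "g \<in> borel_measurable borel"
      using conjunct2[OF cg] by (rule finite_C0_to_C3E) (rule that)
    define C where "C = 2 * (k + 2 * M * Cg * sqrt (measure lborel D))"
    show "\<exists>C\<ge>0. \<forall>(\<epsilon>::real) (h::real) (\<gamma>::real) (\<omega> :: real^'n \<Rightarrow> real) (T::real)
          (u\<^sub>0 :: real^'n \<Rightarrow> real^'n) (v\<^sub>0 :: real^'n \<Rightarrow> real^'n)
          (b :: real \<Rightarrow> real^'n \<Rightarrow> real^'n) (w :: int^'n \<Rightarrow> real \<Rightarrow> real^'n).
          let u = (\<lambda>t. pc_extension D h (\<lambda>i. w i t));
              bh = (\<lambda>t. pc_extension D h (\<lambda>i. b t (grid_point h i)))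
          in
            0 < h \<and> h < \<epsilon> \<and> \<epsilon> < 1 \<and> 0 < T \<and> 0 < \<gamma> \<and> \<gamma> \<le> 1 \<and>
            boundary_function \<gamma> \<epsilon> D \<omega> \<and>
            semidiscrete_solution D h \<epsilon> J \<omega> f g T u\<^sub>0 v\<^sub>0 b w \<and>
            set_integrable lborel {0..T} (\<lambda>s. L2_norm_on D (bh s)) \<longrightarrow>
            (\<forall>t\<in>{0..T}.
               total_energy D \<epsilon> J \<omega> f g T u t
                 \<le> (sqrt (total_energy D \<epsilon> J \<omega> f g T u 0) + t * C / \<epsilon>\<^sup>2
                     + (LBINT s:{0..t}. L2_norm_on D (bh s)))\<^sup>2)"
      unfolding Let_def
    proof (intro exI[of _ C] conjI allI impI ballI)
      show "0 \<le> C" unfolding C_def using k M_nonneg g(1) by simp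
    next
      fix \<epsilon> h \<gamma> T t :: real and \<omega> :: "real^'n \<Rightarrow> real" and u\<^sub>0 v\<^sub>0 :: "real^'n \<Rightarrow> real^'n"
        and b :: "real \<Rightarrow> real^'n \<Rightarrow> real^'n" and w :: "int^'n \<Rightarrow> real \<Rightarrow> real^'n"
      assume H: "0 < h \<and> h < \<epsilon> \<and> \<epsilon> < 1 \<and> 0 < T \<and> 0 < \<gamma> \<and> \<gamma> \<le> 1 \<and>
            boundary_function \<gamma> \<epsilon> D \<omega> \<and>
            semidiscrete_solution D h \<epsilon> J \<omega> f g T u\<^sub>0 v\<^sub>0 b w \<and>
            set_integrable lborel {0..T} (\<lambda>s. L2_norm_on D (pc_extension D h (\<lambda>i. b s (grid_point h i))))"
        and t: "t \<in> {0..T}"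
      have data: "0 < h" "h < \<epsilon>" "\<epsilon> < 1" "0 < T" "0 < \<gamma>" "boundary_function \<gamma> \<epsilon> D \<omega>"
          "semidiscrete_solution D h \<epsilon> J \<omega> f g T u\<^sub>0 v\<^sub>0 b w"
        using H by simp_all
      obtain w' where "semidiscrete_motion D J \<omega> \<epsilon> M h f g T b w w' Bf Cf"
        by (rule motionI[OF data])
      then interpret semidiscrete_motion D J \<omega> \<epsilon> M h f g T b w w' Bf Cf .
      have load: "L2_norm_on D (pc_extension D h (\<lambda>i. b s (grid_point h i))) = load s" for s
        unfolding load_def by (rule L2_norm_on_pc_extension)
      have "set_integrable lborel {0..T} load" using H by (simp add: load)
      from energy_bound_convex_concave[OF convex_concave_nonneg[OF conjunct1[OF cg]] g(2,1,3,4,5) this t]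
      show "total_energy D \<epsilon> J \<omega> f g T (\<lambda>t. pc_extension D h (\<lambda>i. w i t)) t
          \<le> (sqrt (total_energy D \<epsilon> J \<omega> f g T (\<lambda>t. pc_extension D h (\<lambda>i. w i t)) 0) + t * C / \<epsilon>\<^sup>2
              + (LBINT s:{0..t}. L2_norm_on D (pc_extension D h (\<lambda>i. b s (grid_point h i)))))\<^sup>2"
        unfolding load C_def k_def bond_constant_def U_def[abs_def] .
    qed
  next
    assume "quadratic_potential g"
    then obtain \<beta> where \<beta>: "0 < \<beta>" and g: "\<And>r. g r = \<beta> * r\<^sup>2 / 2"
      unfolding quadratic_potential_def by blast
    define C\<^sub>1 where "C\<^sub>1 = 2 * k"
    define C\<^sub>2 where "C\<^sub>2 = 2 * M * (1 + \<beta>) + \<beta> * M\<^sup>2 * (3 * (2 + real CARD('n)) ^ CARD('n) + 1)"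
    have C\<^sub>1_nonneg: "0 \<le> C\<^sub>1" unfolding C\<^sub>1_def using k by simp
    have C\<^sub>2_nonneg: "0 \<le> C\<^sub>2" unfolding C\<^sub>2_def using \<beta> M_nonneg by simp
    show "\<exists>C\<^sub>1\<ge>0. \<exists>C\<^sub>2\<ge>0. \<forall>(\<epsilon>::real) (h::real) (\<gamma>::real) (\<omega> :: real^'n \<Rightarrow> real) (T::real)
          (u\<^sub>0 :: real^'n \<Rightarrow> real^'n) (v\<^sub>0 :: real^'n \<Rightarrow> real^'n)
          (b :: real \<Rightarrow> real^'n \<Rightarrow> real^'n) (w :: int^'n \<Rightarrow> real \<Rightarrow> real^'n).
          let u = (\<lambda>t. pc_extension D h (\<lambda>i. w i t));
              bh = (\<lambda>t. pc_extension D h (\<lambda>i. b t (grid_point h i)))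
          in
            0 < h \<and> h < \<epsilon> \<and> \<epsilon> < 1 \<and> 0 < T \<and> 0 < \<gamma> \<and> \<gamma> \<le> 1 \<and>
            boundary_function \<gamma> \<epsilon> D \<omega> \<and>
            semidiscrete_solution D h \<epsilon> J \<omega> f g T u\<^sub>0 v\<^sub>0 b w \<and>
            set_integrable lborel {0..T} (\<lambda>s. (L2_norm_on D (bh s))\<^sup>2) \<longrightarrow>
            (\<forall>t\<in>{0..T}.
               augmented_energy D \<epsilon> J \<omega> f g T u t
                 \<le> exp (3 * (C\<^sub>2 / \<epsilon>\<^sup>2 + 1) * t) *
                    (augmented_energy D \<epsilon> J \<omega> f g T u 0 +
                     (LBINT s:{0..T}. (C\<^sub>1\<^sup>2 / \<epsilon>^4 + (L2_norm_on D (bh s))\<^sup>2)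
                         * exp (- 3 * (C\<^sub>2 / \<epsilon>\<^sup>2 + 1) * s))))"
      unfolding Let_def
    proof (rule exI[of _ C\<^sub>1], rule conjI[OF C\<^sub>1_nonneg], rule exI[of _ C\<^sub>2], rule conjI[OF C\<^sub>2_nonneg],
        intro allI impI ballI)
      fix \<epsilon> h \<gamma> T t :: real and \<omega> :: "real^'n \<Rightarrow> real" and u\<^sub>0 v\<^sub>0 :: "real^'n \<Rightarrow> real^'n"
        and b :: "real \<Rightarrow> real^'n \<Rightarrow> real^'n" and w :: "int^'n \<Rightarrow> real \<Rightarrow> real^'n"
      assume H: "0 < h \<and> h < \<epsilon> \<and> \<epsilon> < 1 \<and> 0 < T \<and> 0 < \<gamma> \<and> \<gamma> \<le> 1 \<and>
            boundary_function \<gamma> \<epsilon> D \<omega> \<and>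
            semidiscrete_solution D h \<epsilon> J \<omega> f g T u\<^sub>0 v\<^sub>0 b w \<and>
            set_integrable lborel {0..T} (\<lambda>s. (L2_norm_on D (pc_extension D h (\<lambda>i. b s (grid_point h i))))\<^sup>2)"
        and t: "t \<in> {0..T}"
      have data: "0 < h" "h < \<epsilon>" "\<epsilon> < 1" "0 < T" "0 < \<gamma>" "boundary_function \<gamma> \<epsilon> D \<omega>"
          "semidiscrete_solution D h \<epsilon> J \<omega> f g T u\<^sub>0 v\<^sub>0 b w"
        using H by simp_all
      obtain w' where "semidiscrete_motion D J \<omega> \<epsilon> M h f g T b w w' Bf Cf"
        by (rule motionI[OF data])
      then interpret semidiscrete_motion D J \<omega> \<epsilon> M h f g T b w w' Bf Cf .
      have load: "L2_norm_on D (pc_extension D h (\<lambda>i. b s (grid_point h i))) = load s" for s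
        unfolding load_def by (rule L2_norm_on_pc_extension)
      have "set_integrable lborel {0..T} (\<lambda>s. (load s)\<^sup>2)" using H by (simp add: load)
      from augmented_energy_bound_quadratic[OF g \<beta> this t C\<^sub>1_def[unfolded k_def, folded bond_constant_def] C\<^sub>2_def]
      show "augmented_energy D \<epsilon> J \<omega> f g T (\<lambda>t. pc_extension D h (\<lambda>i. w i t)) t
          \<le> exp (3 * (C\<^sub>2 / \<epsilon>\<^sup>2 + 1) * t) *
             (augmented_energy D \<epsilon> J \<omega> f g T (\<lambda>t. pc_extension D h (\<lambda>i. w i t)) 0 +
              (LBINT s:{0..T}. (C\<^sub>1\<^sup>2 / \<epsilon>^4 + (L2_norm_on D (pc_extension D h (\<lambda>i. b s (grid_point h i))))\<^sup>2)
                  * exp (- 3 * (C\<^sub>2 / \<epsilon>\<^sup>2 + 1) * s)))"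
        unfolding load U_def[abs_def] by (simp only: mult_minus_left)
    qed
  qed
qed

end
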